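(* Let $\kappa:\mathbb R\to(0,\infty)$ be continuously differentiable with $c_1e^{-a_1|t|}\le\kappa(t)$, $\kappa(t)\le c_2e^{a_2|t|}$ and $|\kappa'(t)|\le c_2e^{a_2|t|}$ for all $t\in\mathbb R$, for some $c_1,c_2,a_1,a_2>0$. Then the solution $(u_0^N,\dots,u_J^N)$ of the Galerkin system converges in probability in $L^2(\mathbb T^d;\mathbb R^{J+1})$, as $N\to\infty$, to the weak solution $(u_0,\dots,u_J)$ of the SPDE system (driven by the same white noises).
   Context: Let $d\in\{1,2,3\}$, $\mathbb T^d=\mathbb R^d/\mathbb Z^d$, $L^2=L^2(\mathbb T^d)$ with inner product $\langle\cdot,\cdot\rangle$. $\{\phi_p\}_{p\in\mathbb Z}$ is the orthonormal Fourier basis $\{e^{2\pi i\mathbf k\cdot\mathbf x}\}_{\mathbf k\in\mathbb Z^d}$ enumerated so that for each $n\ge0$, with $N=((2n+1)^d-1)/2$, $\phi_{-N},\dots,\phi_N$ are those with $\mathbf k\in\{-n,\dots,n\}^d$; $H_N=\mathrm{span}\{\phi_{-N},\dots,\phi_N\}$; $N\to\infty$ along these values. Fix $\nu>0$, an integer $J\ge0$, and a real constant $u_{-1}$. $\kappa(v)=\kappa\circ v$, $\kappa^a(v)=(\kappa\circ v)^a$. White noises $w_i=\sum_p\widehat w_i(p)\phi_p$, $i=0,\dots,J$, with independent standard Gaussian coefficients (conjugate-symmetric so $w_i$ is real); $w_i^N=\sum_{p=-N}^N\widehat w_i(p)\phi_p$. SPDE system: almost surely bounded $u_0,\dots,u_J$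 with $-\langle u_i,\Delta\phi\rangle+\langle\kappa^2(u_{i-1})u_i,\phi\rangle=\sum_p\widehat w_i(p)\langle\kappa^\nu(u_{i-1})\phi_p,\phi\rangle$ for all $\phi\in C^2(\mathbb T^d)$, $i=0,\dots,J$. Galerkin system: $u_{-1}^N:=u_{-1}$ and $u_i^N\in H_N$ with $\langle\nabla u_i^N,\nabla\phi\rangle+\langle\kappa^2(u_{i-1}^N)u_i^N,\phi\rangle=\langle\kappa^\nu(u_{i-1}^N)w_i^N,\phi\rangle$ for all $\phi\in H_N$, $i=0,\dots,J$. *)

theory Defs
  imports "HOL-Analysis.Analysis" "HOL-Probability.Probability"
begin

text \<open>Functions on the torus T^d = R^d / Z^d are represented as functions on
  real^'d (d = CARD('d)); integrals over the torus are integrals over the unit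
  cube [0,1]^d with Lebesgue measure.\<close>

definition cube :: "(real^'d) set" where
  "cube = cbox 0 One"

definition fourier :: "int^'d \<Rightarrow> real^'d \<Rightarrow> complex" where
  "fourier k x = cis (2 * pi * (\<Sum>j\<in>UNIV. real_of_int (k $ j) * x $ j))"

text \<open>Frequencies in the box {-n..n}^d; these index phi_{-N},...,phi_N with
  N = ((2n+1)^d - 1)/2.\<close>
definition freq_box :: "nat \<Rightarrow> (int^'d) set" where
  "freq_box n = {k. \<forall>j. \<bar>k $ j\<bar> \<le> int n}"

definition H :: "nat \<Rightarrow> (real^'d \<Rightarrow> complex) set" where
  "H n = {f. \<exists>c. \<forall>x. f x = (\<Sum>k\<in>freq_box n. c k * fourier k x)}"

definition ip :: "(real^'d \<Rightarrow> complex) \<Rightarrow> (real^'d \<Rightarrow> complex) \<Rightarrow> complex" where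
  "ip f g = (LINT x:cube|lborel. f x * cnj (g x))"

definition pd :: "'d \<Rightarrow> (real^'d \<Rightarrow> complex) \<Rightarrow> real^'d \<Rightarrow> complex" where
  "pd j f x = vector_derivative (\<lambda>t. f (x + t *\<^sub>R axis j 1)) (at 0)"

definition has_pd :: "'d \<Rightarrow> (real^'d \<Rightarrow> complex) \<Rightarrow> bool" where
  "has_pd j f \<longleftrightarrow> (\<forall>x. (\<lambda>t. f (x + t *\<^sub>R axis j 1)) differentiable (at 0))"

definition Zperiodic :: "(real^'d \<Rightarrow> 'a) \<Rightarrow> bool" where
  "Zperiodic f \<longleftrightarrow> (\<forall>x (k::int^'d). f (x + (\<chi> j. real_of_int (k $ j))) = f x)"

definition C2_torus :: "(real^'d \<Rightarrow> complex) \<Rightarrow> bool" where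
  "C2_torus f \<longleftrightarrow> Zperiodic f \<and> continuous_on UNIV f \<and>
     (\<forall>j. has_pd j f \<and> continuous_on UNIV (pd j f) \<and>
        (\<forall>l. has_pd l (pd j f) \<and> continuous_on UNIV (pd l (pd j f))))"

definition laplacian :: "(real^'d \<Rightarrow> complex) \<Rightarrow> real^'d \<Rightarrow> complex" where
  "laplacian f x = (\<Sum>j\<in>UNIV. pd j (pd j f) x)"

definition grad_ip :: "(real^'d \<Rightarrow> complex) \<Rightarrow> (real^'d \<Rightarrow> complex) \<Rightarrow> complex" where
  "grad_ip f g = (\<Sum>j\<in>UNIV. ip (pd j f) (pd j g))"

definition cplx :: "(real^'d \<Rightarrow> real) \<Rightarrow> real^'d \<Rightarrow> complex" where
  "cplx f x = complex_of_real (f x)"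

text \<open>Given independent standard real Gaussians xi_i(k), the coefficients
  w_i(k) = ((xi_i(k) + xi_i(-k)) + i (xi_i(k) - xi_i(-k))) / 2 are
  conjugate-symmetric, w_i(0) = xi_i(0) ~ N(0,1) real, and for k <> 0 the
  pairs are independent standard complex Gaussians (Re, Im iid N(0,1/2)).
  Conversely every such family arises this way (xi_i(k) = Re w_i(k) + Im w_i(k)).\<close>
definition noise_coeff :: "(nat \<Rightarrow> int^'d \<Rightarrow> 'w \<Rightarrow> real) \<Rightarrow> nat \<Rightarrow> int^'d \<Rightarrow> 'w \<Rightarrow> complex" where
  "noise_coeff \<xi> i k \<omega> =
     (complex_of_real (\<xi> i k \<omega> + \<xi> i (-k) \<omega>) + \<i> * complex_of_real (\<xi> i k \<omega> - \<xi> i (-k) \<omega>)) / 2"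

definition noise_trunc :: "(nat \<Rightarrow> int^'d \<Rightarrow> 'w \<Rightarrow> real) \<Rightarrow> nat \<Rightarrow> nat \<Rightarrow> 'w \<Rightarrow> real^'d \<Rightarrow> complex" where
  "noise_trunc \<xi> n i \<omega> x = (\<Sum>k\<in>freq_box n. noise_coeff \<xi> i k \<omega> * fourier k x)"

definition prev :: "real \<Rightarrow> (nat \<Rightarrow> real^'d \<Rightarrow> real) \<Rightarrow> nat \<Rightarrow> real^'d \<Rightarrow> real" where
  "prev um1 v i = (if i = 0 then (\<lambda>_. um1) else v (i - 1))"

definition galerkin_sol ::
  "(real \<Rightarrow> real) \<Rightarrow> real \<Rightarrow> real \<Rightarrow> nat \<Rightarrow> (nat \<Rightarrow> int^'d \<Rightarrow> 'w \<Rightarrow> real) \<Rightarrow> nat \<Rightarrow> 'w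
    \<Rightarrow> (nat \<Rightarrow> real^'d \<Rightarrow> real) \<Rightarrow> bool" where
  "galerkin_sol \<kappa> \<nu> um1 J \<xi> n \<omega> v \<longleftrightarrow>
     (\<forall>i\<le>J. cplx (v i) \<in> H n \<and>
       (\<forall>\<phi>\<in>H n.
          grad_ip (cplx (v i)) \<phi>
          + ip (\<lambda>x. complex_of_real ((\<kappa> (prev um1 v i x))\<^sup>2 * v i x)) \<phi>
          = ip (\<lambda>x. complex_of_real (\<kappa> (prev um1 v i x) powr \<nu>) * noise_trunc \<xi> n i \<omega> x) \<phi>))"

definition weak_sol ::
  "'w measure \<Rightarrow> (real \<Rightarrow> real) \<Rightarrow> real \<Rightarrow> real \<Rightarrow> nat \<Rightarrow> (nat \<Rightarrow> int^'d \<Rightarrow> 'w \<Rightarrow> real)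
    \<Rightarrow> (nat \<Rightarrow> 'w \<Rightarrow> real^'d \<Rightarrow> real) \<Rightarrow> bool" where
  "weak_sol M \<kappa> \<nu> um1 J \<xi> u \<longleftrightarrow>
     (\<forall>i\<le>J. AE \<omega> in M. u i \<omega> \<in> borel_measurable lborel \<and>
                        (\<exists>C. AE x in lborel. x \<in> cube \<longrightarrow> \<bar>u i \<omega> x\<bar> \<le> C)) \<and>
     (\<forall>i\<le>J. \<forall>\<phi>. C2_torus \<phi> \<longrightarrow>
        (AE \<omega> in M.
           ((\<lambda>n. \<Sum>k\<in>freq_box n. noise_coeff \<xi> i k \<omega> *
                  ip (\<lambda>x. complex_of_real (\<kappa> (prev um1 (\<lambda>j. u j \<omega>) i x) powr \<nu>) * fourier k x) \<phi>)
            \<longlonglongrightarrow>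
            (- ip (cplx (u i \<omega>)) (laplacian \<phi>)
             + ip (\<lambda>x. complex_of_real ((\<kappa> (prev um1 (\<lambda>j. u j \<omega>) i x))\<^sup>2 * u i \<omega> x)) \<phi>))))"

text \<open>D_n -> 0 in probability, phrased with outer probability so that no
  measurability of D_n needs to be presupposed (for measurable D_n this is
  the usual notion: P(D_n > eps) -> 0 for every eps > 0).\<close>
definition tendsto_zero_in_prob :: "'w measure \<Rightarrow> (nat \<Rightarrow> 'w \<Rightarrow> ennreal) \<Rightarrow> bool" where
  "tendsto_zero_in_prob M D \<longleftrightarrow>
     (\<forall>\<epsilon>>0. \<forall>\<delta>>0. eventually (\<lambda>n. \<exists>A\<in>sets M.
          {\<omega>\<in>space M. D n \<omega> > ennreal \<epsilon>} \<subseteq> A \<and> measure M A < \<delta>) sequentially)"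

definition L2dist_sq :: "nat \<Rightarrow> (nat \<Rightarrow> real^'d \<Rightarrow> real) \<Rightarrow> (nat \<Rightarrow> real^'d \<Rightarrow> real) \<Rightarrow> ennreal" where
  "L2dist_sq J v w = (\<Sum>i\<le>J. \<integral>\<^sup>+ x\<in>cube. ennreal ((v i x - w i x)\<^sup>2) \<partial>lborel)"

end

theory Submission
  imports Defs
begin

text \<open>In the real Fourier basis \<open>cos (2 \<pi> k \<bullet> x) - sin (2 \<pi> k \<bullet> x)\<close> the whole problem is real. Write \<open>V = \<kappa>\<^sup>2(v)\<close>,
  \<open>s = \<kappa>\<^sup>\<nu>(v)\<close> for the coefficients given by the previous layer \<open>v\<close>. Coercivity, \<open>L\<^sup>2 \<rightarrow> H\<^sup>2\<close> regularity and
  duality bound the Galerkin solution operator from \<open>H\<^sup>-\<^sup>2\<close> to \<open>L\<^sup>2\<close>, with a constant depending only on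
  \<open>\<integral>V\<^sup>2\<close> and \<open>\<integral>1/V\<close>. Since \<open>d \<le> 3\<close>, an \<open>L\<^sup>1\<close> function is in \<open>H\<^sup>-\<^sup>2\<close> and, given the lower layers, the
  expected squared \<open>H\<^sup>-\<^sup>2\<close> norm of the noise residual is bounded by \<open>\<parallel>s\<^sub>N - s\<parallel>\<^sup>2\<close> plus a vanishing tail. So the
  error of the projected weak solution tends to zero layer by layer, provided that \<open>\<integral>exp (a |v\<^sub>N|)\<close> stays
  bounded in probability. For the latter, the Galerkin solution is split into a part bounded uniformly in \<open>x\<close>
  and a part that is conditionally Gaussian with bounded pointwise variance; both use a weighted \<open>L\<^sup>2\<close> bound for
  the Green's function of \<open>1 - \<Delta>\<close>. The weak solution is not assumed measurable in \<open>\<omega>\<close>, so convergence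
  is first shown almost surely along subsequences, which yields a measurable version of the error.\<close>

section \<open>The Galerkin system in an abstract basis\<close>

text \<open>\<open>kappa\<close> may grow and decay exponentially and the Galerkin layers have no
  deterministic bound, so no estimate may use a supremum of a discrete coefficient. This is why
  stability is stated through two integrals of \<open>V\<close>, and why differences of
  \<open>V\<close> are measured in \<open>L\<^sup>1\<close>, where a local Lipschitz bound and
  Cauchy-Schwarz give an error times an exponential moment. The conditional bound for the
  exponential moment of a layer is itself exponential in the moment of the layer below; iterating it
  would require moments of iterated exponentials. Boundedness in probability passes from layer to
  layer without them. The rate \<open>28 * b\<close> comes from the Green's function: its weighted
  bound costs the seventh power of a weight that is the square of a coefficient of rate
  \<open>b\<close>, and \<open>28 * b\<close> covers this \<open>14 * b\<close> and all smaller
  rates at once. The limiting right-hand side is known only as an almost sure limit for each single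
  test function, hence the testing against the countable family of basis functions and the use of
  Fatou's lemma for the expected residual.\<close>

definition ess_bounded :: "'a measure \<Rightarrow> ('a \<Rightarrow> real) \<Rightarrow> bool" where
  "ess_bounded Q f \<longleftrightarrow> f \<in> borel_measurable Q \<and> (\<exists>C. AE x in Q. \<bar>f x\<bar> \<le> C)"

lemma ess_boundedI:
  "f \<in> borel_measurable Q \<Longrightarrow> AE x in Q. \<bar>f x\<bar> \<le> C \<Longrightarrow> ess_bounded Q f"
  unfolding ess_bounded_def by blast

lemma ess_bounded_measurable: "ess_bounded Q f \<Longrightarrow> f \<in> borel_measurable Q"
  unfolding ess_bounded_def by blast

lemma ess_bounded_const: "ess_bounded Q (\<lambda>x. c)"
  by (rule ess_boundedI[where C="\<bar>c\<bar>"]) auto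

lemma ess_bounded_mult:
  assumes "ess_bounded Q f" "ess_bounded Q g"
  shows "ess_bounded Q (\<lambda>x. f x * g x)"
proof -
  obtain C D where C: "AE x in Q. \<bar>f x\<bar> \<le> C" and D: "AE x in Q. \<bar>g x\<bar> \<le> D"
    using assms unfolding ess_bounded_def by blast
  have "AE x in Q. \<bar>f x * g x\<bar> \<le> C * D"
    using C D
  proof eventually_elim
    case (elim x)
    then show ?case unfolding abs_mult by (intro mult_mono) auto
  qed
  then show ?thesis
    using assms unfolding ess_bounded_def by auto
qed

lemma ess_bounded_add:
  assumes "ess_bounded Q f" "ess_bounded Q g"
  shows "ess_bounded Q (\<lambda>x. f x + g x)"
proof -
  obtain C D where C: "AE x in Q. \<bar>f x\<bar> \<le> C" and D: "AE x in Q. \<bar>g x\<bar> \<le> D"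
    using assms unfolding ess_bounded_def by blast
  have "AE x in Q. \<bar>f x + g x\<bar> \<le> C + D"
    using C D by eventually_elim auto
  then show ?thesis
    using assms unfolding ess_bounded_def by auto
qed

lemma ess_bounded_diff:
  assumes "ess_bounded Q f" "ess_bounded Q g"
  shows "ess_bounded Q (\<lambda>x. f x - g x)"
  using ess_bounded_add[OF assms(1) ess_bounded_mult[OF ess_bounded_const[of _ "-1"] assms(2)]] by simp

lemma ess_bounded_sum:
  "(\<And>i. i \<in> I \<Longrightarrow> ess_bounded Q (f i)) \<Longrightarrow> ess_bounded Q (\<lambda>x. \<Sum>i\<in>I. f i x)"
  by (induction I rule: infinite_finite_induct) (auto intro!: ess_bounded_const ess_bounded_add)

lemma ess_bounded_power: "ess_bounded Q f \<Longrightarrow> ess_bounded Q (\<lambda>x. f x ^ n)"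
  by (induction n) (auto intro!: ess_bounded_const ess_bounded_mult)

lemma ess_bounded_abs: "ess_bounded Q f \<Longrightarrow> ess_bounded Q (\<lambda>x. \<bar>f x\<bar>)"
  unfolding ess_bounded_def by auto

text \<open>A continuous function is bounded on the compact interval \<open>{-C..C}\<close>, so no
  growth condition on \<open>h\<close> enters. This covers powers of the coefficient function, their
  reciprocals and exponentials.\<close>

lemma ess_bounded_compose:
  assumes "ess_bounded Q f" "continuous_on UNIV (h :: real \<Rightarrow> real)"
  shows "ess_bounded Q (\<lambda>x. h (f x))"
proof -
  obtain C where C: "AE x in Q. \<bar>f x\<bar> \<le> C"
    using assms unfolding ess_bounded_def by blast
  have "compact (h ` {-C..C})"
    using assms(2) by (intro compact_continuous_image) (auto intro: continuous_on_subset)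
  then obtain D where D: "\<And>t. t \<in> {-C..C} \<Longrightarrow> \<bar>h t\<bar> \<le> D"
    unfolding bounded_iff by (metis bounded_iff compact_imp_bounded image_eqI real_norm_def)
  have "AE x in Q. \<bar>h (f x)\<bar> \<le> D"
    using C by eventually_elim (auto intro!: D)
  moreover have "h \<in> borel_measurable borel"
    using assms(2) by (rule borel_measurable_continuous_onI)
  ultimately show ?thesis
    using assms(1) unfolding ess_bounded_def by auto
qed

lemma (in finite_measure) ess_bounded_integrable: "ess_bounded M f \<Longrightarrow> integrable M f"
  unfolding ess_bounded_def by (auto intro!: integrable_const_bound)

lemmas ess_bounded_intros =
  ess_bounded_const ess_bounded_mult ess_bounded_add ess_bounded_diff ess_bounded_sum
  ess_bounded_power ess_bounded_abs

section \<open>Elementary inequalities and Cauchy-Schwarz for bounded functions\<close>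

lemma power2_sum_le: "(a + b)\<^sup>2 \<le> 2 * a\<^sup>2 + 2 * (b::real)\<^sup>2"
  using sum_squares_bound[of a b] by (simp add: power2_sum)

lemma power2_sum3_le: "(a + b + c)\<^sup>2 \<le> 3 * (a\<^sup>2 + b\<^sup>2 + (c::real)\<^sup>2)"
proof -
  have "0 \<le> (a - b)\<^sup>2 + (b - c)\<^sup>2 + (a - c)\<^sup>2" by simp
  then show ?thesis by (simp add: power2_eq_square algebra_simps)
qed

lemma power2_le_imp_le_mult:
  fixes x y :: real
  assumes "x\<^sup>2 \<le> y * x" "0 \<le> y"
  shows "x \<le> y"
  using assms by (metis linorder_not_le mult_right_le_imp_le power2_eq_square order_le_less_trans)

lemma (in finite_measure) integral_Cauchy_Schwarz:
  assumes f: "ess_bounded M f" and g: "ess_bounded M g"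
  shows "(\<integral>x. f x * g x \<partial>M)\<^sup>2 \<le> (\<integral>x. (f x)\<^sup>2 \<partial>M) * (\<integral>x. (g x)\<^sup>2 \<partial>M)"
proof -
  define a b c where "a = (\<integral>x. (f x)\<^sup>2 \<partial>M)" and "b = (\<integral>x. f x * g x \<partial>M)"
    and "c = (\<integral>x. (g x)\<^sup>2 \<partial>M)"
  have q: "0 \<le> a - 2 * t * b + t\<^sup>2 * c" for t
  proof -
    have "0 \<le> (\<integral>x. (f x - t * g x)\<^sup>2 \<partial>M)" by simp
    also have "\<dots> = (\<integral>x. (f x)\<^sup>2 - 2 * t * (f x * g x) + t\<^sup>2 * (g x)\<^sup>2 \<partial>M)"
      by (intro Bochner_Integration.integral_cong) (auto simp: power2_eq_square algebra_simps)
    also have "\<dots> = a - 2 * t * b + t\<^sup>2 * c"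
      unfolding a_def b_def c_def
      by (subst Bochner_Integration.integral_add Bochner_Integration.integral_diff;
          (intro Bochner_Integration.integrable_diff ess_bounded_integrable ess_bounded_intros f g)?)+ simp
    finally show ?thesis .
  qed
  have a: "a \<ge> 0" and c: "c \<ge> 0" unfolding a_def c_def by auto
  have "b\<^sup>2 \<le> a * c"
  proof (cases "c = 0")
    case True
    show ?thesis
    proof (rule ccontr)
      assume "\<not> b\<^sup>2 \<le> a * c"
      then have "b \<noteq> 0" using True by auto
      \<comment> \<open>With \<open>c = 0\<close> the quadratic is affine in \<open>t\<close>; at
        this \<open>t\<close> it takes the value \<open>a - (a + 1) = -1\<close>.\<close>
      then show False
        using q[of "(a + 1) / (2 * b)"] True by simp
    qed
  next
    case False
    then show ?thesis
      using q[of "b / c"] c by (simp add: field_simps power2_eq_square)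
  qed
  then show ?thesis unfolding a_def b_def c_def .
qed

text \<open>Elimination of one unknown at a time uses arithmetic operations only, so the solution is
  as measurable in the parameter as the data. Positivity of the quadratic form passes to principal
  submatrices (extend the vector by zero), which makes it available to the induction
  hypothesis.\<close>

lemma solve_linear_system_measurable:
  fixes A :: "'k \<Rightarrow> 'k \<Rightarrow> 't \<Rightarrow> real"
  assumes "finite F" "\<And>i j. A i j \<in> borel_measurable N" "\<And>j. f j \<in> borel_measurable N"
    and "\<And>\<theta> c k. \<theta> \<in> space N \<Longrightarrow> k \<in> F \<Longrightarrow> c k \<noteq> 0 \<Longrightarrow> 0 < (\<Sum>j\<in>F. c j * (\<Sum>i\<in>F. A j i \<theta> * c i))"
  shows "\<exists>c. (\<forall>k. c k \<in> borel_measurable N) \<and>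
    (\<forall>\<theta>\<in>space N. \<forall>j\<in>F. (\<Sum>i\<in>F. A j i \<theta> * c i \<theta>) = f j \<theta>)"
  using assms
proof (induction F arbitrary: f rule: finite_induct)
  case empty
  show ?case by (rule exI[of _ "\<lambda>k \<theta>. 0"]) auto
next
  case (insert m F)
  note [measurable] = insert.prems(1,2)
  have pos: "0 < (\<Sum>j\<in>F. c j * (\<Sum>i\<in>F. A j i \<theta> * c i))"
    if "\<theta> \<in> space N" "k \<in> F" "c k \<noteq> 0" for \<theta> c k
  proof -
    have km: "k \<noteq> m" using that insert.hyps by auto
    have "0 < (\<Sum>j\<in>insert m F. (c(m := 0)) j * (\<Sum>i\<in>insert m F. A j i \<theta> * (c(m := 0)) i))"
      using that km by (intro insert.prems(3)[of \<theta> k]) auto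
    also have "\<dots> = (\<Sum>j\<in>F. (c(m := 0)) j * (\<Sum>i\<in>F. A j i \<theta> * (c(m := 0)) i))"
      using insert.hyps by simp
    also have "\<dots> = (\<Sum>j\<in>F. c j * (\<Sum>i\<in>F. A j i \<theta> * c i))"
      using insert.hyps by (auto intro!: sum.cong)
    finally show ?thesis .
  qed
  \<comment> \<open>The vector with entry 1 at \<open>m\<close> and entries \<open>z\<close> on
    \<open>F\<close> satisfies all equations of \<open>F\<close> with right-hand side zero.\<close>
  have "\<exists>z. (\<forall>k. z k \<in> borel_measurable N) \<and>
      (\<forall>\<theta>\<in>space N. \<forall>j\<in>F. (\<Sum>i\<in>F. A j i \<theta> * z i \<theta>) = - A j m \<theta>)"
    by (rule insert.IH) (measurable, rule pos)
  then obtain z where z [measurable]: "\<And>k. z k \<in> borel_measurable N"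
    and zeq: "\<And>\<theta> j. \<theta> \<in> space N \<Longrightarrow> j \<in> F \<Longrightarrow> (\<Sum>i\<in>F. A j i \<theta> * z i \<theta>) = - A j m \<theta>"
    by blast
  have "\<exists>c. (\<forall>k. c k \<in> borel_measurable N) \<and>
      (\<forall>\<theta>\<in>space N. \<forall>j\<in>F. (\<Sum>i\<in>F. A j i \<theta> * c i \<theta>) = f j \<theta>)"
    by (rule insert.IH) (measurable, rule pos)
  then obtain c where c [measurable]: "\<And>k. c k \<in> borel_measurable N"
    and ceq: "\<And>\<theta> j. \<theta> \<in> space N \<Longrightarrow> j \<in> F \<Longrightarrow> (\<Sum>i\<in>F. A j i \<theta> * c i \<theta>) = f j \<theta>"
    by blast
  \<comment> \<open>\<open>S\<close> is the Schur complement of the block \<open>F\<close>, the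
    value of equation \<open>m\<close> at that vector; \<open>t\<close> is the resulting value of
    the unknown \<open>m\<close>.\<close>
  define S where "S \<theta> = A m m \<theta> + (\<Sum>i\<in>F. A m i \<theta> * z i \<theta>)" for \<theta>
  define t where "t \<theta> = (f m \<theta> - (\<Sum>i\<in>F. A m i \<theta> * c i \<theta>)) / S \<theta>" for \<theta>
  have [measurable]: "S \<in> borel_measurable N" "t \<in> borel_measurable N"
    unfolding S_def t_def by measurable
  have S: "S \<theta> > 0" if th: "\<theta> \<in> space N" for \<theta>
  proof -
    define w where "w k = (if k = m then 1 else z k \<theta>)" for k
    have wm: "(\<Sum>i\<in>insert m F. A j i \<theta> * w i) = A j m \<theta> + (\<Sum>i\<in>F. A j i \<theta> * z i \<theta>)" for j
      using insert.hyps unfolding w_def by (simp, intro sum.cong) auto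
    \<comment> \<open>The quadratic form at \<open>w\<close> reduces to \<open>S\<close>, because
      all rows of \<open>F\<close> vanish there.\<close>
    have "0 < (\<Sum>j\<in>insert m F. w j * (\<Sum>i\<in>insert m F. A j i \<theta> * w i))"
      using th by (intro insert.prems(3)[of \<theta> m]) (auto simp: w_def)
    also have "\<dots> = (\<Sum>j\<in>insert m F. w j * (A j m \<theta> + (\<Sum>i\<in>F. A j i \<theta> * z i \<theta>)))"
      unfolding wm ..
    also have "\<dots> = w m * S \<theta> + (\<Sum>j\<in>F. w j * (A j m \<theta> + (\<Sum>i\<in>F. A j i \<theta> * z i \<theta>)))"
      using insert.hyps by (simp add: S_def)
    also have "(\<Sum>j\<in>F. w j * (A j m \<theta> + (\<Sum>i\<in>F. A j i \<theta> * z i \<theta>))) = 0"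
      using zeq[OF th] by (intro sum.neutral) auto
    finally show ?thesis by (simp add: w_def)
  qed
  define d where "d k \<theta> = (if k = m then t \<theta> else c k \<theta> + t \<theta> * z k \<theta>)" for k \<theta>
  have dm: "(\<Sum>i\<in>insert m F. A j i \<theta> * d i \<theta>)
      = A j m \<theta> * t \<theta> + (\<Sum>i\<in>F. A j i \<theta> * c i \<theta>) + t \<theta> * (\<Sum>i\<in>F. A j i \<theta> * z i \<theta>)" for j \<theta>
  proof -
    have "(\<Sum>i\<in>F. A j i \<theta> * d i \<theta>) = (\<Sum>i\<in>F. A j i \<theta> * c i \<theta> + t \<theta> * (A j i \<theta> * z i \<theta>))"
      using insert.hyps by (intro sum.cong) (auto simp: d_def algebra_simps)
    then show ?thesis
      using insert.hyps by (simp add: sum.distrib sum_distrib_left) (simp add: d_def)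
  qed
  have "(\<Sum>i\<in>insert m F. A j i \<theta> * d i \<theta>) = f j \<theta>" if th: "\<theta> \<in> space N" and j: "j \<in> insert m F" for \<theta> j
  proof (cases "j = m")
    case True
    have "A m m \<theta> * t \<theta> + t \<theta> * (\<Sum>i\<in>F. A m i \<theta> * z i \<theta>) = t \<theta> * S \<theta>"
      unfolding S_def by (simp add: algebra_simps)
    also have "\<dots> = f m \<theta> - (\<Sum>i\<in>F. A m i \<theta> * c i \<theta>)"
      unfolding t_def using S[OF th] by simp
    finally show ?thesis unfolding dm True by simp
  next
    case False
    then have "j \<in> F" using j by auto
    then show ?thesis unfolding dm using zeq[OF th] ceq[OF th] by simp
  qed
  moreover have "d k \<in> borel_measurable N" for k
    unfolding d_def by (cases "k = m") auto
  ultimately show ?case by (intro exI[of _ d]) auto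
qed

text \<open>The trigonometric basis of the torus enters the deterministic part of the argument only through
  the properties below: \<open>lam\<close> are the eigenvalues of the negative Laplacian, and \<open>kernel\<close> bounds the
  truncated Green's function of \<open>1 - \<Delta>\<close> in weighted \<open>L\<^sup>2\<close>.\<close>

locale galerkin_basis = Q: prob_space Q for Q :: "'x measure" +
  fixes B :: "nat \<Rightarrow> 'k set" and psi :: "'k \<Rightarrow> 'x \<Rightarrow> real" and lam :: "'k \<Rightarrow> real"
    and z0 :: 'k and Lam CK :: real
  assumes finite_B: "\<And>n. finite (B n)" and B_mono: "\<And>m n. m \<le> n \<Longrightarrow> B m \<subseteq> B n"
    and z0_B: "\<And>n. z0 \<in> B n" and B_cover: "\<And>k. \<exists>n. k \<in> B n"
    and psi_measurable [measurable]: "\<And>k. psi k \<in> borel_measurable Q"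
    and psi_bound: "\<And>k x. \<bar>psi k x\<bar> \<le> 2"
    and psi_orthonormal: "\<And>k l. (\<integral>x. psi k x * psi l x \<partial>Q) = (if k = l then 1 else 0)"
    and psi_z0: "\<And>x. psi z0 x = 1" and lam_z0: "lam z0 = 0"
    and lam_ge: "\<And>k. k \<noteq> z0 \<Longrightarrow> lam k \<ge> 1"
    and sum_lam_le: "\<And>n. (\<Sum>k\<in>B n. 1 / (1 + lam k)\<^sup>2) \<le> Lam"
    and kernel_bound: "\<And>g n x. ess_bounded Q g \<Longrightarrow> (\<And>y. 0 \<le> g y) \<Longrightarrow>
        (\<integral>y. (\<Sum>j\<in>B n. psi j x * psi j y / (1 + lam j))\<^sup>2 * g y \<partial>Q) \<le> CK * (1 + (\<integral>y. g y ^ 7 \<partial>Q))"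
    and parseval: "\<And>f. ess_bounded Q f \<Longrightarrow>
        (\<lambda>n. \<Sum>k\<in>B n. (\<integral>x. f x * psi k x \<partial>Q)\<^sup>2) \<longlonglongrightarrow> (\<integral>x. (f x)\<^sup>2 \<partial>Q)"
begin

definition trig :: "nat \<Rightarrow> ('k \<Rightarrow> real) \<Rightarrow> 'x \<Rightarrow> real" where
  "trig n c x = (\<Sum>k\<in>B n. c k * psi k x)"

definition coeff :: "('x \<Rightarrow> real) \<Rightarrow> 'k \<Rightarrow> real" where
  "coeff f k = (\<integral>x. f x * psi k x \<partial>Q)"

text \<open>The stiffness part is diagonal since \<open>psi\<close> consists of eigenfunctions. The
  right-hand side is a family of coefficients rather than a function, so that noise functionals and
  the data of the dual problem fit equally.\<close>

definition galerkin_eq :: "nat \<Rightarrow> ('x \<Rightarrow> real) \<Rightarrow> ('k \<Rightarrow> real) \<Rightarrow> ('k \<Rightarrow> real) \<Rightarrow> bool" where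
  "galerkin_eq n V f c \<longleftrightarrow> (\<forall>j\<in>B n. lam j * c j + coeff (\<lambda>x. V x * trig n c x) j = f j)"

section \<open>Expansions in the basis\<close>

lemma lam_nonneg: "lam k \<ge> 0"
  using lam_z0 lam_ge[of k] by (cases "k = z0") auto

lemma one_lam_pos: "1 + lam k > 0" "1 + lam k \<noteq> 0" "1 + lam k \<ge> 1"
  using lam_nonneg[of k] by auto

lemma ess_bounded_psi [intro, simp]: "ess_bounded Q (psi k)"
  by (rule ess_boundedI[where C=2]) (auto simp: psi_bound)

lemma ess_bounded_trig [intro, simp]: "ess_bounded Q (trig n c)"
  unfolding trig_def by (intro ess_bounded_intros ess_bounded_psi)

lemma trig_measurable [measurable]: "trig n c \<in> borel_measurable Q"
  unfolding trig_def by measurable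

lemmas bdd_intros = ess_bounded_intros ess_bounded_psi ess_bounded_trig

lemma trig_diff: "trig n (\<lambda>k. c k - d k) x = trig n c x - trig n d x"
  unfolding trig_def by (simp add: left_diff_distrib sum_subtractf)

lemma coeff_add:
  assumes "ess_bounded Q f" "ess_bounded Q g"
  shows "coeff (\<lambda>x. f x + g x) k = coeff f k + coeff g k"
  unfolding coeff_def distrib_right
  by (intro Bochner_Integration.integral_add Q.ess_bounded_integrable bdd_intros assms)

lemma coeff_diff:
  assumes "ess_bounded Q f" "ess_bounded Q g"
  shows "coeff (\<lambda>x. f x - g x) k = coeff f k - coeff g k"
  unfolding coeff_def left_diff_distrib
  by (intro Bochner_Integration.integral_diff Q.ess_bounded_integrable bdd_intros assms)

lemma integral_mult_trig:
  assumes f: "ess_bounded Q f"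
  shows "(\<integral>x. f x * trig n c x \<partial>Q) = (\<Sum>k\<in>B n. c k * coeff f k)"
proof -
  have "(\<integral>x. f x * trig n c x \<partial>Q) = (\<integral>x. (\<Sum>k\<in>B n. c k * (f x * psi k x)) \<partial>Q)"
    unfolding trig_def sum_distrib_left by (simp add: ac_simps)
  also have "\<dots> = (\<Sum>k\<in>B n. (\<integral>x. c k * (f x * psi k x) \<partial>Q))"
    by (intro Bochner_Integration.integral_sum Q.ess_bounded_integrable bdd_intros f)
  finally show ?thesis unfolding coeff_def by simp
qed

lemma coeff_trig: "coeff (trig n c) k = (if k \<in> B n then c k else 0)"
proof -
  have "coeff (trig n c) k = (\<integral>x. psi k x * trig n c x \<partial>Q)"
    unfolding coeff_def by (simp add: ac_simps)
  also have "\<dots> = (\<Sum>l\<in>B n. c l * (if k = l then 1 else 0))"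
    by (subst integral_mult_trig) (auto simp: coeff_def psi_orthonormal)
  also have "\<dots> = (if k \<in> B n then c k else 0)"
    by (simp add: finite_B if_distrib cong: if_cong)
  finally show ?thesis .
qed

lemma integral_trig_sq: "(\<integral>x. (trig n c x)\<^sup>2 \<partial>Q) = (\<Sum>k\<in>B n. (c k)\<^sup>2)"
  unfolding power2_eq_square by (subst integral_mult_trig) (auto simp: coeff_trig)

lemma projection_error:
  assumes f: "ess_bounded Q f"
  shows "(\<integral>x. (f x - trig n (coeff f) x)\<^sup>2 \<partial>Q) = (\<integral>x. (f x)\<^sup>2 \<partial>Q) - (\<Sum>k\<in>B n. (coeff f k)\<^sup>2)"
proof -
  have "(\<integral>x. (f x - trig n (coeff f) x)\<^sup>2 \<partial>Q)
      = (\<integral>x. (f x)\<^sup>2 - 2 * (f x * trig n (coeff f) x) + (trig n (coeff f) x)\<^sup>2 \<partial>Q)"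
    by (intro Bochner_Integration.integral_cong) (auto simp: power2_eq_square algebra_simps)
  also have "\<dots> = (\<integral>x. (f x)\<^sup>2 \<partial>Q) - 2 * (\<integral>x. f x * trig n (coeff f) x \<partial>Q) + (\<integral>x. (trig n (coeff f) x)\<^sup>2 \<partial>Q)"
    by (subst Bochner_Integration.integral_add Bochner_Integration.integral_diff;
        (intro Bochner_Integration.integrable_diff Q.ess_bounded_integrable bdd_intros f)?)+ simp
  also have "\<dots> = (\<integral>x. (f x)\<^sup>2 \<partial>Q) - (\<Sum>k\<in>B n. (coeff f k)\<^sup>2)"
    by (simp add: integral_mult_trig[OF f] integral_trig_sq) (simp add: power2_eq_square)
  finally show ?thesis .
qed

lemma bessel:
  assumes f: "ess_bounded Q f"
  shows "(\<Sum>k\<in>B n. (coeff f k)\<^sup>2) \<le> (\<integral>x. (f x)\<^sup>2 \<partial>Q)"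
proof -
  have "0 \<le> (\<integral>x. (f x - trig n (coeff f) x)\<^sup>2 \<partial>Q)" by simp
  then show ?thesis unfolding projection_error[OF f] by simp
qed

lemma projection_error_tendsto_0:
  assumes f: "ess_bounded Q f"
  shows "(\<lambda>n. \<integral>x. (f x - trig n (coeff f) x)\<^sup>2 \<partial>Q) \<longlonglongrightarrow> 0"
  unfolding projection_error[OF f]
  using tendsto_diff[OF tendsto_const[of "\<integral>x. (f x)\<^sup>2 \<partial>Q"] parseval[OF f]]
  by (simp add: coeff_def)

lemma galerkin_energy:
  assumes "galerkin_eq n V f c" and V: "ess_bounded Q V"
  shows "(\<Sum>k\<in>B n. lam k * c k * d k) + (\<integral>x. V x * trig n c x * trig n d x \<partial>Q) = (\<Sum>k\<in>B n. f k * d k)"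
proof -
  have "(\<integral>x. V x * trig n c x * trig n d x \<partial>Q) = (\<Sum>k\<in>B n. d k * coeff (\<lambda>x. V x * trig n c x) k)"
    by (rule integral_mult_trig) (intro bdd_intros V)
  then have "(\<Sum>k\<in>B n. lam k * c k * d k) + (\<integral>x. V x * trig n c x * trig n d x \<partial>Q)
     = (\<Sum>k\<in>B n. (lam k * c k + coeff (\<lambda>x. V x * trig n c x) k) * d k)"
    by (simp add: sum.distrib algebra_simps)
  also have "\<dots> = (\<Sum>k\<in>B n. f k * d k)"
    using assms unfolding galerkin_eq_def by (intro sum.cong) auto
  finally show ?thesis .
qed

text \<open>The mean value is invisible to the gradient, and \<open>V\<close> has no uniform lower
  bound; writing the mean as the integral of \<open>sqrt (1 / V)\<close> times
  \<open>sqrt V * t\<close> recovers it from the potential term at the cost of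
  \<open>\<integral>1 / V\<close>. All other modes have \<open>lam \<ge> 1\<close>, and
  \<open>1 \<le> A\<close> puts both contributions under one constant.\<close>

lemma coercive:
  assumes V: "ess_bounded Q V" "\<And>x. V x > 0" and iV: "ess_bounded Q (\<lambda>x. 1 / V x)"
    and A: "(\<integral>x. 1 / V x \<partial>Q) \<le> A" "1 \<le> A"
  shows "(\<Sum>k\<in>B n. (c k)\<^sup>2) \<le> A * ((\<Sum>k\<in>B n. lam k * c k * c k) + (\<integral>x. V x * trig n c x * trig n c x \<partial>Q))"
proof -
  define t where "t = trig n c"
  have t: "ess_bounded Q t" unfolding t_def by simp
  have sq: "ess_bounded Q (\<lambda>x. sqrt (V x))"
    by (rule ess_bounded_compose[OF V(1)]) (intro continuous_intros)
  have isq: "ess_bounded Q (\<lambda>x. sqrt (1 / V x))"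
    by (rule ess_bounded_compose[OF iV]) (intro continuous_intros)
  have "c z0 = (\<integral>x. t x \<partial>Q)"
    using coeff_trig[of n c z0] z0_B[of n] unfolding coeff_def t_def by (simp add: psi_z0)
  also have "\<dots> = (\<integral>x. sqrt (1 / V x) * (sqrt (V x) * t x) \<partial>Q)"
    using V(2) by (intro Bochner_Integration.integral_cong)
      (auto simp: real_sqrt_mult[symmetric] real_sqrt_divide less_imp_neq[symmetric])
  finally have "(c z0)\<^sup>2 \<le> (\<integral>x. (sqrt (1 / V x))\<^sup>2 \<partial>Q) * (\<integral>x. (sqrt (V x) * t x)\<^sup>2 \<partial>Q)"
    using Q.integral_Cauchy_Schwarz[OF isq ess_bounded_mult[OF sq t]] by simp
  also have "\<dots> = (\<integral>x. 1 / V x \<partial>Q) * (\<integral>x. V x * t x * t x \<partial>Q)"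
    using V(2) by (simp add: power_mult_distrib less_imp_le) (simp add: power2_eq_square mult.assoc)
  also have "\<dots> \<le> A * (\<integral>x. V x * t x * t x \<partial>Q)"
    using V(2) by (intro mult_right_mono A Bochner_Integration.integral_nonneg)
      (auto simp: mult.assoc less_imp_le)
  finally have 1: "(c z0)\<^sup>2 \<le> A * (\<integral>x. V x * t x * t x \<partial>Q)" .
  have "(\<Sum>k\<in>B n - {z0}. (c k)\<^sup>2) \<le> (\<Sum>k\<in>B n - {z0}. lam k * c k * c k)"
    using mult_right_mono[OF lam_ge, of _ "(c _)\<^sup>2"]
    by (intro sum_mono) (auto simp: power2_eq_square mult.assoc)
  also have "\<dots> = (\<Sum>k\<in>B n. lam k * c k * c k)"
    by (rule sum.mono_neutral_left) (auto simp: finite_B lam_z0)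
  also have "\<dots> \<le> A * (\<Sum>k\<in>B n. lam k * c k * c k)"
    using A(2) by (intro mult_right_mono[of 1 A, simplified] sum_nonneg) (auto simp: lam_nonneg mult.assoc)
  finally have 2: "(\<Sum>k\<in>B n - {z0}. (c k)\<^sup>2) \<le> A * (\<Sum>k\<in>B n. lam k * c k * c k)" .
  have "(\<Sum>k\<in>B n. (c k)\<^sup>2) = (c z0)\<^sup>2 + (\<Sum>k\<in>B n - {z0}. (c k)\<^sup>2)"
    by (rule sum.remove) (auto simp: finite_B z0_B)
  with 1 2 show ?thesis unfolding t_def by (simp add: distrib_left)
qed

lemma lam_tail:
  assumes "\<epsilon> > 0"
  obtains m where "\<And>n. (\<Sum>k\<in>B n - B m. 1 / (1 + lam k)\<^sup>2) \<le> \<epsilon>"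
proof -
  define S where "S n = (\<Sum>k\<in>B n. 1 / (1 + lam k)\<^sup>2)" for n
  have "incseq S"
    unfolding S_def by (intro monoI sum_mono2 B_mono finite_B) auto
  moreover have "\<forall>n. S n \<le> Lam" using sum_lam_le unfolding S_def by auto
  ultimately obtain L where L: "S \<longlonglongrightarrow> L" "\<forall>n. S n \<le> L"
    using incseq_convergent by blast
  from LIMSEQ_D[OF L(1) assms] obtain m where "norm (S m - L) < \<epsilon>" by blast
  then have m: "L - S m \<le> \<epsilon>" by auto
  show thesis
  proof (rule that)
    fix n
    show "(\<Sum>k\<in>B n - B m. 1 / (1 + lam k)\<^sup>2) \<le> \<epsilon>"
    proof (cases "m \<le> n")
      case True
      then have "(\<Sum>k\<in>B n - B m. 1 / (1 + lam k)\<^sup>2) = S n - S m"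
        unfolding S_def by (intro sum_diff finite_B B_mono)
      also have "\<dots> \<le> \<epsilon>" using L(2)[rule_format, of n] m by linarith
      finally show ?thesis .
    next
      case False
      then have "B n - B m = {}" using B_mono[of n m] by auto
      then have "(\<Sum>k\<in>B n - B m. 1 / (1 + lam k)\<^sup>2) = 0" by (simp only: sum.empty)
      then show ?thesis using assms by simp
    qed
  qed
qed

text \<open>Interpolation of the supremum norm between \<open>L\<^sup>2\<close> and \<open>H\<^sup>2\<close>; this is where \<open>d \<le> 3\<close> is needed.\<close>

lemma trig_sup_bound:
  fixes c :: "'k \<Rightarrow> real"
  assumes m: "\<And>n. (\<Sum>k\<in>B n - B m. 1 / (1 + lam k)\<^sup>2) \<le> \<epsilon>"
  shows "(trig n c x)\<^sup>2 \<le> 8 * (card (B m) * (\<Sum>k\<in>B n. (c k)\<^sup>2) + \<epsilon> * (\<Sum>k\<in>B n. ((1 + lam k) * c k)\<^sup>2))"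
proof -
  \<comment> \<open>Low modes are counted, at most \<open>card (B m)\<close> of them; high modes are
    weighted with \<open>1 + lam\<close>, whose inverse squares have a small tail.\<close>
  define p where "p = (\<Sum>k\<in>B n \<inter> B m. \<bar>c k\<bar>)"
  define q where "q = (\<Sum>k\<in>B n - B m. \<bar>c k\<bar>)"
  have "p\<^sup>2 = (\<Sum>k\<in>B n \<inter> B m. 1 * \<bar>c k\<bar>)\<^sup>2" unfolding p_def by simp
  also have "\<dots> \<le> (\<Sum>k\<in>B n \<inter> B m. 1\<^sup>2) * (\<Sum>k\<in>B n \<inter> B m. \<bar>c k\<bar>\<^sup>2)"
    by (rule Cauchy_Schwarz_ineq_sum)
  also have "\<dots> \<le> card (B m) * (\<Sum>k\<in>B n. (c k)\<^sup>2)"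
    by (intro mult_mono sum_nonneg) (auto intro!: sum_mono2 card_mono simp: finite_B)
  finally have p: "p\<^sup>2 \<le> card (B m) * (\<Sum>k\<in>B n. (c k)\<^sup>2)" .
  have "q\<^sup>2 = (\<Sum>k\<in>B n - B m. (1 / (1 + lam k)) * ((1 + lam k) * \<bar>c k\<bar>))\<^sup>2"
    unfolding q_def using one_lam_pos by simp
  also have "\<dots> \<le> (\<Sum>k\<in>B n - B m. (1 / (1 + lam k))\<^sup>2) * (\<Sum>k\<in>B n - B m. ((1 + lam k) * \<bar>c k\<bar>)\<^sup>2)"
    by (rule Cauchy_Schwarz_ineq_sum)
  also have "\<dots> \<le> \<epsilon> * (\<Sum>k\<in>B n. ((1 + lam k) * c k)\<^sup>2)"
  proof (rule mult_mono)
    show "(\<Sum>k\<in>B n - B m. (1 / (1 + lam k))\<^sup>2) \<le> \<epsilon>"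
      using m[of n] by (simp add: power_one_over)
    then show "0 \<le> \<epsilon>" by (rule order_trans[rotated]) (auto intro!: sum_nonneg)
    show "(\<Sum>k\<in>B n - B m. ((1 + lam k) * \<bar>c k\<bar>)\<^sup>2) \<le> (\<Sum>k\<in>B n. ((1 + lam k) * c k)\<^sup>2)"
      by (rule order_trans[OF _ sum_mono2[of _ "B n - B m"]]) (auto simp: finite_B power_mult_distrib)
  qed (auto intro!: sum_nonneg)
  finally have q: "q\<^sup>2 \<le> \<epsilon> * (\<Sum>k\<in>B n. ((1 + lam k) * c k)\<^sup>2)" .
  have "\<bar>trig n c x\<bar> \<le> (\<Sum>k\<in>B n. \<bar>c k\<bar> * 2)"
    unfolding trig_def
    by (rule order_trans[OF sum_abs]) (auto intro!: sum_mono mult_left_mono psi_bound simp: abs_mult)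
  also have "\<dots> = 2 * (p + q)"
    unfolding p_def q_def
    by (subst sum.Int_Diff[of _ _ "B m"]) (auto simp: finite_B sum_distrib_right[symmetric])
  finally have "(trig n c x)\<^sup>2 \<le> (2 * (p + q))\<^sup>2"
    by (metis abs_ge_zero power2_abs power_mono)
  \<comment> \<open>The factor 8 is \<open>2\<^sup>2\<close>, from \<open>psi_bound\<close>, times 2
    from squaring a sum.\<close>
  also have "\<dots> \<le> 8 * (p\<^sup>2 + q\<^sup>2)"
    using power2_sum_le[of p q] unfolding power_mult_distrib by simp
  also have "\<dots> \<le> 8 * (card (B m) * (\<Sum>k\<in>B n. (c k)\<^sup>2) + \<epsilon> * (\<Sum>k\<in>B n. ((1 + lam k) * c k)\<^sup>2))"
    by (intro mult_left_mono add_mono p q) simp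
  finally show ?thesis .
qed

text \<open>The integrals enter for different reasons: that of \<open>1 / V\<close> gives coercivity
  at the zero mode, that of \<open>V\<^sup>2\<close> bounds the potential term as an
  \<open>L\<^sup>2\<close> source. One constant serves both, so that later bounds depend on a single
  number.\<close>

definition admissible :: "real \<Rightarrow> ('x \<Rightarrow> real) \<Rightarrow> bool" where
  "admissible A V \<longleftrightarrow> ess_bounded Q V \<and> (\<forall>x. V x > 0) \<and> ess_bounded Q (\<lambda>x. 1 / V x) \<and>
     (\<integral>x. 1 / V x \<partial>Q) \<le> A \<and> (\<integral>x. (V x)\<^sup>2 \<partial>Q) \<le> A \<and> 1 \<le> A"

text \<open>Mode by mode the equation reads \<open>(1 + lam) z = f + z - V z\<close>. Coercivity
  controls \<open>z\<close> in \<open>L\<^sup>2\<close>; the product \<open>V z\<close> is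
  controlled by the supremum of \<open>z\<close>, and the \<open>H\<^sup>2\<close> part of the
  interpolated supremum is made small enough to be absorbed on the left.\<close>

lemma galerkin_regularity:
  assumes A: "1 \<le> A"
  obtains C where "C \<ge> 0" and
    "\<And>n V f z. admissible A V \<Longrightarrow> galerkin_eq n V f z \<Longrightarrow>
       (\<Sum>k\<in>B n. ((1 + lam k) * z k)\<^sup>2) \<le> C * (\<Sum>k\<in>B n. (f k)\<^sup>2)"
proof -
  \<comment> \<open>With this tail the \<open>H\<^sup>2\<close> part of the potential term is
    \<open>8 * A * X / (48 * A) = X / 6\<close>; the factor 3 of \<open>power2_sum3_le\<close> turns
    it into \<open>X / 2\<close>, which is absorbed, whence the 6 in \<open>C\<close>.\<close>
  obtain m where m: "\<And>n. (\<Sum>k\<in>B n - B m. 1 / (1 + lam k)\<^sup>2) \<le> 1 / (48 * A)"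
    using lam_tail[of "1 / (48 * A)"] A by auto
  define C where "C = 6 * (1 + A\<^sup>2 * (1 + 8 * A * card (B m)))"
  have "C \<ge> 0" unfolding C_def using A by auto
  moreover have "(\<Sum>k\<in>B n. ((1 + lam k) * z k)\<^sup>2) \<le> C * (\<Sum>k\<in>B n. (f k)\<^sup>2)"
    if V: "admissible A V" and g: "galerkin_eq n V f z" for n V f z
  proof -
    note V' = V[unfolded admissible_def]
    define X E Z where "X = (\<Sum>k\<in>B n. ((1 + lam k) * z k)\<^sup>2)" and "E = (\<Sum>k\<in>B n. (f k)\<^sup>2)"
      and "Z = (\<Sum>k\<in>B n. (z k)\<^sup>2)"
    have nn: "X \<ge> 0" "E \<ge> 0" "Z \<ge> 0" unfolding X_def E_def Z_def by (auto intro: sum_nonneg)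
    have "Z \<le> A * (\<Sum>k\<in>B n. f k * z k)"
      unfolding Z_def galerkin_energy[OF g V'[THEN conjunct1], symmetric]
      by (rule coercive) (use V' in auto)
    moreover have "0 \<le> Z" using nn by simp
    ultimately have "Z\<^sup>2 \<le> (A * (\<Sum>k\<in>B n. f k * z k))\<^sup>2" by (rule power_mono)
    also have "\<dots> \<le> A\<^sup>2 * (E * Z)"
      unfolding power_mult_distrib E_def Z_def by (intro mult_left_mono Cauchy_Schwarz_ineq_sum) auto
    finally have Z: "Z \<le> A\<^sup>2 * E"
      using nn by - (rule power2_le_imp_le_mult, simp_all add: mult_ac)
    define t where "t = trig n z"
    have sup: "(t x)\<^sup>2 \<le> 8 * (card (B m) * Z + 1 / (48 * A) * X)" for x
      unfolding t_def Z_def X_def by (rule trig_sup_bound[OF m])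
    have "(\<Sum>k\<in>B n. (coeff (\<lambda>x. V x * t x) k)\<^sup>2) \<le> (\<integral>x. (V x * t x)\<^sup>2 \<partial>Q)"
      unfolding t_def by (intro bessel bdd_intros) (use V' in auto)
    also have "\<dots> \<le> (\<integral>x. (V x)\<^sup>2 * (8 * (card (B m) * Z + 1 / (48 * A) * X)) \<partial>Q)"
      unfolding power_mult_distrib t_def
      by (intro integral_mono Q.ess_bounded_integrable bdd_intros mult_left_mono sup[unfolded t_def])
        (use V' in auto)
    also have "\<dots> = (8 * (card (B m) * Z + 1 / (48 * A) * X)) * (\<integral>x. (V x)\<^sup>2 \<partial>Q)" by simp
    also have "\<dots> \<le> (8 * (card (B m) * Z + 1 / (48 * A) * X)) * A"
      using V' nn A by (intro mult_left_mono) auto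
    also have "\<dots> = 8 * A * card (B m) * Z + X / 6"
      using A by (simp add: field_simps)
    finally have VT: "(\<Sum>k\<in>B n. (coeff (\<lambda>x. V x * t x) k)\<^sup>2) \<le> 8 * A * card (B m) * Z + X / 6" .
    have "X = (\<Sum>k\<in>B n. (f k + z k + (- coeff (\<lambda>x. V x * t x) k))\<^sup>2)"
      unfolding X_def
    proof (intro sum.cong refl)
      fix k assume "k \<in> B n"
      with g have "lam k * z k + coeff (\<lambda>x. V x * t x) k = f k"
        unfolding galerkin_eq_def t_def by auto
      then have "(1 + lam k) * z k = f k + z k + (- coeff (\<lambda>x. V x * t x) k)"
        by (simp add: algebra_simps)
      then show "((1 + lam k) * z k)\<^sup>2 = (f k + z k + (- coeff (\<lambda>x. V x * t x) k))\<^sup>2"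
        by simp
    qed
    also have "\<dots> \<le> (\<Sum>k\<in>B n. 3 * ((f k)\<^sup>2 + (z k)\<^sup>2 + (- coeff (\<lambda>x. V x * t x) k)\<^sup>2))"
      by (intro sum_mono power2_sum3_le)
    also have "\<dots> = 3 * (E + Z + (\<Sum>k\<in>B n. (coeff (\<lambda>x. V x * t x) k)\<^sup>2))"
      unfolding E_def Z_def by (simp add: sum_distrib_left[symmetric] sum.distrib)
    finally have "X \<le> 6 * (E + Z + W)" if "(\<Sum>k\<in>B n. (coeff (\<lambda>x. V x * t x) k)\<^sup>2) \<le> W + X / 6" for W
      using that by (simp add: algebra_simps)
    then have "X \<le> 6 * (E + Z + 8 * A * card (B m) * Z)" using VT by blast
    also have "\<dots> = 6 * (E + Z * (1 + 8 * A * card (B m)))" by (simp add: algebra_simps)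
    also have "\<dots> \<le> 6 * (E + (A\<^sup>2 * E) * (1 + 8 * A * card (B m)))"
      using Z A by (intro mult_left_mono add_mono mult_right_mono) auto
    also have "\<dots> = C * E" unfolding C_def by (simp add: algebra_simps)
    finally show ?thesis unfolding X_def E_def .
  qed
  ultimately show thesis by (rule that)
qed

lemma galerkin_pos_def:
  assumes "admissible A V" "k \<in> B n" "c k \<noteq> 0"
  shows "0 < (\<Sum>j\<in>B n. lam j * c j * c j) + (\<integral>x. V x * trig n c x * trig n c x \<partial>Q)"
proof -
  have "0 < (\<Sum>k\<in>B n. (c k)\<^sup>2)"
    using assms(2,3) by (intro sum_pos2[of _ k]) (auto simp: finite_B)
  also have "\<dots> \<le> A * ((\<Sum>j\<in>B n. lam j * c j * c j) + (\<integral>x. V x * trig n c x * trig n c x \<partial>Q))"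
    by (rule coercive) (use assms(1) in \<open>auto simp: admissible_def\<close>)
  finally show ?thesis
    using assms(1) by (auto simp: admissible_def zero_less_mult_iff)
qed

section \<open>Existence by positive definiteness\<close>

definition galerkin_matrix :: "('x \<Rightarrow> real) \<Rightarrow> 'k \<Rightarrow> 'k \<Rightarrow> real" where
  "galerkin_matrix V j i = (if i = j then lam j else 0) + (\<integral>x. V x * psi i x * psi j x \<partial>Q)"

lemma coeff_mult_trig:
  assumes V: "ess_bounded Q V"
  shows "coeff (\<lambda>x. V x * trig n c x) j = (\<Sum>i\<in>B n. c i * (\<integral>x. V x * psi i x * psi j x \<partial>Q))"
proof -
  have "coeff (\<lambda>x. V x * trig n c x) j = (\<integral>x. (V x * psi j x) * trig n c x \<partial>Q)"
    unfolding coeff_def by (simp add: ac_simps)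
  also have "\<dots> = (\<Sum>i\<in>B n. c i * coeff (\<lambda>x. V x * psi j x) i)"
    by (intro integral_mult_trig bdd_intros V)
  finally show ?thesis unfolding coeff_def by (simp add: ac_simps)
qed

lemma galerkin_matrix_mult:
  assumes V: "ess_bounded Q V" and j: "j \<in> B n"
  shows "(\<Sum>i\<in>B n. galerkin_matrix V j i * c i) = lam j * c j + coeff (\<lambda>x. V x * trig n c x) j"
proof -
  have "(\<Sum>i\<in>B n. galerkin_matrix V j i * c i) = (\<Sum>i\<in>B n. if i = j then lam j * c j else 0)
      + (\<Sum>i\<in>B n. c i * (\<integral>x. V x * psi i x * psi j x \<partial>Q))"
    unfolding galerkin_matrix_def sum.distrib[symmetric] by (intro sum.cong) (auto simp: algebra_simps)
  then show ?thesis unfolding coeff_mult_trig[OF V] using j by (simp add: finite_B)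
qed

text \<open>Any \<open>c\<close> solves the Galerkin system whose data are read off from
  \<open>c\<close> itself, so the energy identity evaluates the quadratic form.\<close>

lemma galerkin_matrix_pos_def:
  assumes V: "admissible A V" and k: "k \<in> B n" "c k \<noteq> 0"
  shows "0 < (\<Sum>j\<in>B n. c j * (\<Sum>i\<in>B n. galerkin_matrix V j i * c i))"
proof -
  have V': "ess_bounded Q V" using V unfolding admissible_def by simp
  have "galerkin_eq n V (\<lambda>j. lam j * c j + coeff (\<lambda>x. V x * trig n c x) j) c"
    unfolding galerkin_eq_def by simp
  from galerkin_energy[OF this V', of c] galerkin_pos_def[where n=n and c=c, OF V k]
  have "0 < (\<Sum>j\<in>B n. (lam j * c j + coeff (\<lambda>x. V x * trig n c x) j) * c j)" by simp
  also have "\<dots> = (\<Sum>j\<in>B n. c j * (\<Sum>i\<in>B n. galerkin_matrix V j i * c i))"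
    by (intro sum.cong) (auto simp: galerkin_matrix_mult[OF V'])
  finally show ?thesis .
qed

lemma galerkin_exists:
  assumes V: "admissible A V"
  obtains c where "galerkin_eq n V f c"
proof -
  have V': "ess_bounded Q V" using V unfolding admissible_def by simp
  \<comment> \<open>The measurable solver is used over a one-point parameter space.\<close>
  have "\<exists>c. (\<forall>k. c k \<in> borel_measurable (count_space (UNIV :: unit set))) \<and>
      (\<forall>\<theta>\<in>space (count_space (UNIV :: unit set)). \<forall>j\<in>B n.
        (\<Sum>i\<in>B n. galerkin_matrix V j i * c i \<theta>) = f j)"
    by (rule solve_linear_system_measurable) (auto simp: finite_B intro: galerkin_matrix_pos_def[OF V])
  then obtain c where "\<forall>j\<in>B n. (\<Sum>i\<in>B n. galerkin_matrix V j i * c i ()) = f j"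
    by auto
  then have "galerkin_eq n V f (\<lambda>k. c k ())"
    unfolding galerkin_eq_def using galerkin_matrix_mult[OF V', where c = "\<lambda>k. c k ()"] by auto
  then show thesis by (rule that)
qed

text \<open>Duality turns the \<open>L\<^sup>2 \<rightarrow> H\<^sup>2\<close> bound into an \<open>H\<^sup>-\<^sup>2 \<rightarrow> L\<^sup>2\<close> bound, which is weak enough
  on the right-hand side to be applied to white noise.\<close>

lemma galerkin_estimate:
  assumes A: "1 \<le> A"
  obtains C where "C \<ge> 0" and
    "\<And>n V f c. admissible A V \<Longrightarrow> galerkin_eq n V f c \<Longrightarrow>
       (\<Sum>k\<in>B n. (c k)\<^sup>2) \<le> C * (\<Sum>k\<in>B n. (f k)\<^sup>2 / (1 + lam k)\<^sup>2)"
proof -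
  obtain C where C: "C \<ge> 0" "\<And>n V f z. admissible A V \<Longrightarrow> galerkin_eq n V f z \<Longrightarrow>
       (\<Sum>k\<in>B n. ((1 + lam k) * z k)\<^sup>2) \<le> C * (\<Sum>k\<in>B n. (f k)\<^sup>2)"
    using galerkin_regularity[OF A] by blast
  have "(\<Sum>k\<in>B n. (c k)\<^sup>2) \<le> C * (\<Sum>k\<in>B n. (f k)\<^sup>2 / (1 + lam k)\<^sup>2)"
    if V: "admissible A V" and g: "galerkin_eq n V f c" for n V f c
  proof -
    have V': "ess_bounded Q V" using V unfolding admissible_def by simp
    \<comment> \<open>\<open>z\<close> solves the dual problem with data \<open>c\<close>. Testing
      its equation with \<open>c\<close> and that of \<open>c\<close> with \<open>z\<close>
      identifies the sum of \<open>(c k)\<^sup>2\<close> with the sum of \<open>f k * z k\<close>,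
      as the form is symmetric.\<close>
    obtain z where z: "galerkin_eq n V c z" by (rule galerkin_exists[OF V])
    define X R where "X = (\<Sum>k\<in>B n. (c k)\<^sup>2)" and "R = (\<Sum>k\<in>B n. (f k)\<^sup>2 / (1 + lam k)\<^sup>2)"
    have nn: "X \<ge> 0" "R \<ge> 0" unfolding X_def R_def by (auto intro: sum_nonneg)
    have "X = (\<Sum>k\<in>B n. lam k * z k * c k) + (\<integral>x. V x * trig n z x * trig n c x \<partial>Q)"
      unfolding galerkin_energy[OF z V'] X_def power2_eq_square ..
    also have "\<dots> = (\<Sum>k\<in>B n. f k * z k)"
      unfolding galerkin_energy[OF g V', of z, symmetric] by (simp add: ac_simps)
    also have "\<dots> = (\<Sum>k\<in>B n. (f k / (1 + lam k)) * ((1 + lam k) * z k))"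
      using one_lam_pos by simp
    finally have X: "X = (\<Sum>k\<in>B n. (f k / (1 + lam k)) * ((1 + lam k) * z k))" .
    have "X\<^sup>2 \<le> (\<Sum>k\<in>B n. (f k / (1 + lam k))\<^sup>2) * (\<Sum>k\<in>B n. ((1 + lam k) * z k)\<^sup>2)"
      by (subst X) (rule Cauchy_Schwarz_ineq_sum)
    also have "\<dots> \<le> R * (C * X)"
      unfolding X_def R_def power_divide
      by (intro mult_left_mono C(2)[OF V z]) (auto intro: sum_nonneg)
    finally have "X \<le> C * R"
      using nn C(1) by - (rule power2_le_imp_le_mult, simp_all add: mult_ac)
    then show ?thesis unfolding X_def R_def .
  qed
  with C(1) show thesis by (rule that)
qed

text \<open>Uniformly bounded basis functions give an \<open>L\<^sup>1\<close> function bounded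
  coefficients; together with the summable weights of \<open>sum_weight_le\<close> this is the
  embedding of \<open>L\<^sup>1\<close> into \<open>H\<^sup>-\<^sup>2\<close>.\<close>

lemma coeff_sq_le:
  assumes g: "ess_bounded Q g"
  shows "(coeff g j)\<^sup>2 \<le> 4 * (\<integral>x. \<bar>g x\<bar> \<partial>Q)\<^sup>2"
proof -
  have "\<bar>coeff g j\<bar> \<le> (\<integral>x. \<bar>g x * psi j x\<bar> \<partial>Q)"
    unfolding coeff_def by (rule integral_abs_bound)
  also have "\<dots> \<le> (\<integral>x. 2 * \<bar>g x\<bar> \<partial>Q)"
    by (intro integral_mono Q.ess_bounded_integrable bdd_intros g)
      (auto simp: abs_mult mult.commute[of 2] intro!: mult_left_mono psi_bound)
  finally have "\<bar>coeff g j\<bar> \<le> 2 * (\<integral>x. \<bar>g x\<bar> \<partial>Q)" by simp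
  from power_mono[OF this, of 2] show ?thesis by (simp add: power_mult_distrib)
qed

lemma sum_weight_le:
  assumes "\<And>j. j \<in> B n \<Longrightarrow> a j \<le> K" "0 \<le> K"
  shows "(\<Sum>j\<in>B n. a j / (1 + lam j)\<^sup>2) \<le> Lam * K"
proof -
  have "(\<Sum>j\<in>B n. a j / (1 + lam j)\<^sup>2) \<le> (\<Sum>j\<in>B n. K * (1 / (1 + lam j)\<^sup>2))"
    using assms by (intro sum_mono) (auto intro: divide_right_mono)
  also have "\<dots> = K * (\<Sum>j\<in>B n. 1 / (1 + lam j)\<^sup>2)" by (simp add: sum_distrib_left)
  also have "\<dots> \<le> K * Lam" by (intro mult_left_mono sum_lam_le assms)
  finally show ?thesis by (simp add: mult.commute)
qed

lemma integral_diff_trig_sq: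
  assumes u: "ess_bounded Q u"
  shows "(\<integral>x. (u x - trig n c x)\<^sup>2 \<partial>Q)
    \<le> 2 * (\<Sum>k\<in>B n. (coeff u k - c k)\<^sup>2) + 2 * (\<integral>x. (u x - trig n (coeff u) x)\<^sup>2 \<partial>Q)"
proof -
  have "(\<integral>x. (u x - trig n c x)\<^sup>2 \<partial>Q)
      \<le> (\<integral>x. 2 * (trig n (\<lambda>k. coeff u k - c k) x)\<^sup>2 + 2 * (u x - trig n (coeff u) x)\<^sup>2 \<partial>Q)"
  proof (intro integral_mono Q.ess_bounded_integrable bdd_intros u)
    fix x
    show "(u x - trig n c x)\<^sup>2 \<le> 2 * (trig n (\<lambda>k. coeff u k - c k) x)\<^sup>2 + 2 * (u x - trig n (coeff u) x)\<^sup>2"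
      using power2_sum_le[of "trig n (\<lambda>k. coeff u k - c k) x" "u x - trig n (coeff u) x"]
      by (simp add: trig_diff)
  qed
  also have "\<dots> = 2 * (\<integral>x. (trig n (\<lambda>k. coeff u k - c k) x)\<^sup>2 \<partial>Q) + 2 * (\<integral>x. (u x - trig n (coeff u) x)\<^sup>2 \<partial>Q)"
    by (subst Bochner_Integration.integral_add) (intro Q.ess_bounded_integrable bdd_intros u | simp)+
  finally show ?thesis unfolding integral_trig_sq .
qed

text \<open>Subtracting the two equations, the projected error solves the Galerkin system with the residual
  \<open>(L - f) + (V' - V) u - V' (u - P\<^sub>n u)\<close>.\<close>

lemma galerkin_error:
  assumes C: "\<And>n V f c. admissible A V \<Longrightarrow> galerkin_eq n V f c \<Longrightarrow>
       (\<Sum>k\<in>B n. (c k)\<^sup>2) \<le> C * (\<Sum>k\<in>B n. (f k)\<^sup>2 / (1 + lam k)\<^sup>2)" "C \<ge> 0"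
    and V': "admissible A V'" and V: "ess_bounded Q V" and u: "ess_bounded Q u" "AE x in Q. \<bar>u x\<bar> \<le> U"
    and weak: "\<And>j. j \<in> B n \<Longrightarrow> lam j * coeff u j + coeff (\<lambda>x. V x * u x) j = L j"
    and gal: "galerkin_eq n V' f c"
  shows "(\<Sum>k\<in>B n. (coeff u k - c k)\<^sup>2) \<le> 3 * C * ((\<Sum>k\<in>B n. (L k - f k)\<^sup>2 / (1 + lam k)\<^sup>2)
     + 4 * Lam * U\<^sup>2 * (\<integral>x. \<bar>V' x - V x\<bar> \<partial>Q)\<^sup>2 + 4 * Lam * A * (\<integral>x. (u x - trig n (coeff u) x)\<^sup>2 \<partial>Q))"
proof -
  have eV': "ess_bounded Q V'" using V' unfolding admissible_def by simp
  define e where "e k = coeff u k - c k" for k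
  define w where "w x = u x - trig n (coeff u) x" for x
  have ew: "ess_bounded Q w" unfolding w_def by (intro bdd_intros u)
  define R1 where "R1 j = coeff (\<lambda>x. (V' x - V x) * u x) j" for j
  define R2 where "R2 j = coeff (\<lambda>x. V' x * w x) j" for j
  have gal_e: "galerkin_eq n V' (\<lambda>j. (L j - f j) + R1 j + - R2 j) e"
    unfolding galerkin_eq_def
  proof
    fix j assume j: "j \<in> B n"
    have "coeff (\<lambda>x. V' x * trig n e x) j
        = coeff (\<lambda>x. ((V x * u x + (V' x - V x) * u x) - V' x * w x) - V' x * trig n c x) j"
      by (rule arg_cong[of _ _ "\<lambda>f. coeff f j"]) (auto simp: e_def[abs_def] w_def trig_diff algebra_simps)
    also have "\<dots> = coeff (\<lambda>x. V x * u x) j + R1 j - R2 j - coeff (\<lambda>x. V' x * trig n c x) j"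
      unfolding R1_def R2_def
      by (subst coeff_diff coeff_add; (intro bdd_intros eV' V u ew)?)+ simp
    finally show "lam j * e j + coeff (\<lambda>x. V' x * trig n e x) j = (L j - f j) + R1 j + - R2 j"
      using weak[OF j] gal j unfolding galerkin_eq_def e_def by (auto simp: algebra_simps)
  qed
  have R1: "(R1 j)\<^sup>2 \<le> 4 * (U\<^sup>2 * (\<integral>x. \<bar>V' x - V x\<bar> \<partial>Q)\<^sup>2)" for j
  proof -
    have "(\<integral>x. \<bar>(V' x - V x) * u x\<bar> \<partial>Q) \<le> (\<integral>x. U * \<bar>V' x - V x\<bar> \<partial>Q)"
    proof (intro integral_mono_AE Q.ess_bounded_integrable bdd_intros eV' V u)
      show "AE x in Q. \<bar>(V' x - V x) * u x\<bar> \<le> U * \<bar>V' x - V x\<bar>"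
        using u(2) by eventually_elim (auto simp: abs_mult mult.commute intro: mult_right_mono)
    qed
    then have "(\<integral>x. \<bar>(V' x - V x) * u x\<bar> \<partial>Q) \<le> U * (\<integral>x. \<bar>V' x - V x\<bar> \<partial>Q)" by simp
    then have "(\<integral>x. \<bar>(V' x - V x) * u x\<bar> \<partial>Q)\<^sup>2 \<le> (U * (\<integral>x. \<bar>V' x - V x\<bar> \<partial>Q))\<^sup>2"
      by (intro power_mono) auto
    moreover have "(R1 j)\<^sup>2 \<le> 4 * (\<integral>x. \<bar>(V' x - V x) * u x\<bar> \<partial>Q)\<^sup>2"
      unfolding R1_def by (intro coeff_sq_le bdd_intros eV' V u)
    ultimately show ?thesis by (simp add: power_mult_distrib)
  qed
  \<comment> \<open>Here \<open>V'\<close> is controlled only in \<open>L\<^sup>2\<close>, so its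
    product with \<open>w\<close> is estimated in \<open>L\<^sup>1\<close> by
    Cauchy-Schwarz.\<close>
  have R2: "(R2 j)\<^sup>2 \<le> 4 * (A * (\<integral>x. (w x)\<^sup>2 \<partial>Q))" for j
  proof -
    have "(R2 j)\<^sup>2 \<le> 4 * (\<integral>x. \<bar>V' x * w x\<bar> \<partial>Q)\<^sup>2"
      unfolding R2_def by (intro coeff_sq_le bdd_intros eV' ew)
    also have "(\<integral>x. \<bar>V' x * w x\<bar> \<partial>Q)\<^sup>2 \<le> (\<integral>x. (V' x)\<^sup>2 \<partial>Q) * (\<integral>x. (w x)\<^sup>2 \<partial>Q)"
      using Q.integral_Cauchy_Schwarz[OF ess_bounded_abs[OF eV'] ess_bounded_abs[OF ew]] by (simp add: abs_mult)
    also have "\<dots> \<le> A * (\<integral>x. (w x)\<^sup>2 \<partial>Q)"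
      using V' by (intro mult_right_mono) (auto simp: admissible_def)
    finally show ?thesis by simp
  qed
  have A: "0 \<le> A" using V' by (auto simp: admissible_def)
  have "(\<Sum>k\<in>B n. (e k)\<^sup>2) \<le> C * (\<Sum>k\<in>B n. ((L k - f k) + R1 k + - R2 k)\<^sup>2 / (1 + lam k)\<^sup>2)"
    by (rule C(1)[OF V' gal_e])
  also have "(\<Sum>k\<in>B n. ((L k - f k) + R1 k + - R2 k)\<^sup>2 / (1 + lam k)\<^sup>2)
     \<le> (\<Sum>k\<in>B n. 3 * ((L k - f k)\<^sup>2 + (R1 k)\<^sup>2 + (- R2 k)\<^sup>2) / (1 + lam k)\<^sup>2)"
    by (intro sum_mono divide_right_mono power2_sum3_le) auto
  also have "\<dots> = 3 * ((\<Sum>k\<in>B n. (L k - f k)\<^sup>2 / (1 + lam k)\<^sup>2)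
       + (\<Sum>k\<in>B n. (R1 k)\<^sup>2 / (1 + lam k)\<^sup>2) + (\<Sum>k\<in>B n. (R2 k)\<^sup>2 / (1 + lam k)\<^sup>2))" (is "_ = 3 * ?S")
    by (simp add: sum_distrib_left[symmetric] sum.distrib add_divide_distrib times_divide_eq_right[symmetric] del: times_divide_eq_right)
  finally have "(\<Sum>k\<in>B n. (e k)\<^sup>2) \<le> C * (3 * ?S)" using C(2) by (simp add: mult_left_mono)
  also have "\<dots> \<le> C * (3 * ((\<Sum>k\<in>B n. (L k - f k)\<^sup>2 / (1 + lam k)\<^sup>2)
       + Lam * (4 * (U\<^sup>2 * (\<integral>x. \<bar>V' x - V x\<bar> \<partial>Q)\<^sup>2)) + Lam * (4 * (A * (\<integral>x. (w x)\<^sup>2 \<partial>Q)))))"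
    using A C(2) by (intro mult_left_mono add_mono sum_weight_le R1 R2 order_refl) auto
  finally show ?thesis unfolding e_def w_def by (simp add: algebra_simps)
qed

section \<open>Green's function and pointwise bounds\<close>

definition green :: "nat \<Rightarrow> 'x \<Rightarrow> 'x \<Rightarrow> real" where
  "green n x y = (\<Sum>j\<in>B n. psi j x * psi j y / (1 + lam j))"

lemma ess_bounded_green: "ess_bounded Q (green n x)"
proof -
  have "green n x = trig n (\<lambda>j. psi j x / (1 + lam j))"
    unfolding green_def trig_def by (auto simp: algebra_simps)
  then show ?thesis by simp
qed

lemma integral_mult_green:
  assumes "ess_bounded Q h"
  shows "(\<integral>y. h y * green n x y \<partial>Q) = (\<Sum>j\<in>B n. psi j x * coeff h j / (1 + lam j))"
proof -
  have "green n x = trig n (\<lambda>j. psi j x / (1 + lam j))"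
    unfolding green_def trig_def by (auto simp: algebra_simps)
  then show ?thesis using integral_mult_trig[OF assms] by simp
qed

text \<open>\<open>kernel_bound\<close> with the weight \<open>h\<^sup>2\<close>; the seventh power
  of this weight is the origin of the exponent 14.\<close>

lemma green_weighted:
  assumes h: "ess_bounded Q h"
  shows "(\<integral>y. (h y * green n x y)\<^sup>2 \<partial>Q) \<le> CK * (1 + (\<integral>y. h y ^ 14 \<partial>Q))"
proof -
  have "(\<integral>y. (h y * green n x y)\<^sup>2 \<partial>Q)
      = (\<integral>y. (\<Sum>j\<in>B n. psi j x * psi j y / (1 + lam j))\<^sup>2 * (h y)\<^sup>2 \<partial>Q)"
    unfolding green_def power_mult_distrib by (simp add: mult.commute)
  also have "\<dots> \<le> CK * (1 + (\<integral>y. ((h y)\<^sup>2) ^ 7 \<partial>Q))"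
    by (intro kernel_bound bdd_intros h) auto
  finally show ?thesis by (simp add: power_mult[symmetric])
qed

text \<open>Subtracting \<open>(1 - \<Delta>)\<^sup>-\<^sup>1 f\<close> from the solution
  \<open>v\<close> leaves \<open>(1 - \<Delta>)\<^sup>-\<^sup>1 ((1 - V) v)\<close>, an integral
  against the Green's function. Cauchy-Schwarz then bounds it at every point by the
  \<open>L\<^sup>2\<close> norm of the solution and an integral of the coefficient.\<close>

lemma galerkin_minus_noise:
  assumes V: "ess_bounded Q V" and gal: "galerkin_eq n V f c"
  shows "(trig n c x - (\<Sum>j\<in>B n. psi j x * f j / (1 + lam j)))\<^sup>2
    \<le> (\<Sum>k\<in>B n. (c k)\<^sup>2) * (CK * (1 + (\<integral>y. (1 - V y) ^ 14 \<partial>Q)))"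
proof -
  define h where "h y = (1 - V y) * trig n c y" for y
  have h: "ess_bounded Q h" unfolding h_def by (intro bdd_intros V)
  have "c j = f j / (1 + lam j) + coeff h j / (1 + lam j)" if j: "j \<in> B n" for j
  proof -
    have "coeff h j = coeff (\<lambda>y. trig n c y - V y * trig n c y) j"
      unfolding h_def by (simp add: algebra_simps)
    also have "\<dots> = c j - coeff (\<lambda>y. V y * trig n c y) j"
      by (subst coeff_diff) (auto simp: coeff_trig j intro!: bdd_intros V)
    finally have "(1 + lam j) * c j = f j + coeff h j"
      using gal j unfolding galerkin_eq_def by (auto simp: algebra_simps)
    then have "c j = (f j + coeff h j) / (1 + lam j)"
      using one_lam_pos[of j] by (simp add: eq_divide_eq mult.commute)
    then show ?thesis by (simp add: add_divide_distrib)
  qed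
  then have "trig n c x = (\<Sum>j\<in>B n. psi j x * f j / (1 + lam j) + psi j x * coeff h j / (1 + lam j))"
    unfolding trig_def by (intro sum.cong) (auto simp: algebra_simps)
  then have "trig n c x - (\<Sum>j\<in>B n. psi j x * f j / (1 + lam j)) = (\<integral>y. h y * green n x y \<partial>Q)"
    unfolding integral_mult_green[OF h] by (simp add: sum.distrib)
  also have "\<dots> = (\<integral>y. trig n c y * ((1 - V y) * green n x y) \<partial>Q)"
    unfolding h_def by (simp add: ac_simps)
  finally have "(trig n c x - (\<Sum>j\<in>B n. psi j x * f j / (1 + lam j)))\<^sup>2
    = (\<integral>y. trig n c y * ((1 - V y) * green n x y) \<partial>Q)\<^sup>2" by simp
  also have "\<dots> \<le> (\<integral>y. (trig n c y)\<^sup>2 \<partial>Q) * (\<integral>y. ((1 - V y) * green n x y)\<^sup>2 \<partial>Q)"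
    by (intro Q.integral_Cauchy_Schwarz bdd_intros V ess_bounded_green)
  also have "\<dots> \<le> (\<Sum>k\<in>B n. (c k)\<^sup>2) * (CK * (1 + (\<integral>y. (1 - V y) ^ 14 \<partial>Q)))"
    unfolding integral_trig_sq
    by (intro mult_left_mono green_weighted bdd_intros V) (auto intro: sum_nonneg)
  finally show ?thesis .
qed

text \<open>\<open>k\<close> indexes the noise mode and \<open>j\<close> the test function: the
  matrix takes noise coefficients to the right-hand side of the Galerkin system.\<close>

definition noise_matrix :: "('x \<Rightarrow> real) \<Rightarrow> 'k \<Rightarrow> 'k \<Rightarrow> real" where
  "noise_matrix s k j = (\<integral>x. s x * psi k x * psi j x \<partial>Q)"

lemma noise_matrix_eq_coeff: "noise_matrix s k j = coeff (\<lambda>x. s x * psi j x) k"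
  unfolding noise_matrix_def coeff_def by (simp add: ac_simps)

lemma noise_matrix_diff:
  "ess_bounded Q s \<Longrightarrow> ess_bounded Q t \<Longrightarrow>
    noise_matrix s k j - noise_matrix t k j = noise_matrix (\<lambda>x. s x - t x) k j"
  unfolding noise_matrix_eq_coeff
  by (subst coeff_diff[symmetric]) (auto intro!: bdd_intros simp: algebra_simps)

lemma integral_mult_psi_sq_le:
  assumes s: "ess_bounded Q s"
  shows "(\<integral>x. (s x * psi j x)\<^sup>2 \<partial>Q) \<le> 4 * (\<integral>x. (s x)\<^sup>2 \<partial>Q)"
proof -
  have "(psi j x)\<^sup>2 \<le> 4" for x
    using power_mono[OF psi_bound[of j x], of 2] by simp
  then have "(\<integral>x. (s x * psi j x)\<^sup>2 \<partial>Q) \<le> (\<integral>x. (s x)\<^sup>2 * 4 \<partial>Q)"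
    unfolding power_mult_distrib by (intro integral_mono Q.ess_bounded_integrable bdd_intros s mult_left_mono) auto
  then show ?thesis by simp
qed

lemma noise_matrix_row:
  assumes s: "ess_bounded Q s"
  shows "(\<Sum>k\<in>B n. (noise_matrix s k j)\<^sup>2) \<le> 4 * (\<integral>x. (s x)\<^sup>2 \<partial>Q)"
  unfolding noise_matrix_eq_coeff
  by (rule order_trans[OF bessel integral_mult_psi_sq_le]) (intro bdd_intros s)+

lemma noise_matrix_sq_le:
  assumes s: "ess_bounded Q s"
  shows "(noise_matrix s k j)\<^sup>2 \<le> 4 * (\<integral>x. (s x)\<^sup>2 \<partial>Q)"
proof -
  obtain n where "k \<in> B n" using B_cover by blast
  then have "(noise_matrix s k j)\<^sup>2 \<le> (\<Sum>k\<in>B n. (noise_matrix s k j)\<^sup>2)"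
    by (intro member_le_sum) (auto simp: finite_B)
  also note noise_matrix_row[OF s]
  finally show ?thesis .
qed

text \<open>For fixed \<open>x\<close> the weight of the noise mode \<open>k\<close> is the
  \<open>k\<close>-th coefficient of \<open>s * green n x\<close>, so Bessel's inequality collapses
  the sum over \<open>k\<close> to a weighted \<open>L\<^sup>2\<close> norm of the Green's function.
  The left side is the variance at \<open>x\<close> of the noise smoothed by
  \<open>(1 - \<Delta>)\<^sup>-\<^sup>1\<close>.\<close>

lemma green_noise_variance:
  assumes s: "ess_bounded Q s"
  shows "(\<Sum>k\<in>B n. (\<Sum>j\<in>B n. psi j x * noise_matrix s k j / (1 + lam j))\<^sup>2)
    \<le> CK * (1 + (\<integral>y. s y ^ 14 \<partial>Q))"
proof -
  have "(\<Sum>j\<in>B n. psi j x * noise_matrix s k j / (1 + lam j)) = coeff (\<lambda>y. s y * green n x y) k" for k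
  proof -
    have "coeff (\<lambda>y. s y * green n x y) k = (\<integral>y. (s y * psi k y) * green n x y \<partial>Q)"
      unfolding coeff_def by (simp add: ac_simps)
    then show ?thesis
      by (subst (asm) integral_mult_green) (auto intro!: bdd_intros s simp: noise_matrix_def coeff_def)
  qed
  then have "(\<Sum>k\<in>B n. (\<Sum>j\<in>B n. psi j x * noise_matrix s k j / (1 + lam j))\<^sup>2)
     = (\<Sum>k\<in>B n. (coeff (\<lambda>y. s y * green n x y) k)\<^sup>2)" by simp
  also have "\<dots> \<le> (\<integral>y. (s y * green n x y)\<^sup>2 \<partial>Q)"
    by (intro bessel bdd_intros s ess_bounded_green)
  also note green_weighted[OF s]
  finally show ?thesis .
qed

lemma bessel_tail:
  assumes f: "ess_bounded Q f"
  shows "(\<Sum>k\<in>B n - B m. (coeff f k)\<^sup>2) \<le> (\<integral>x. (f x - trig m (coeff f) x)\<^sup>2 \<partial>Q)"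
proof -
  have "(\<Sum>k\<in>B n - B m. (coeff f k)\<^sup>2) \<le> (\<Sum>k\<in>B (max m n) - B m. (coeff f k)\<^sup>2)"
    using B_mono[of n "max m n"] by (intro sum_mono2) (auto simp: finite_B)
  also have "\<dots> = (\<Sum>k\<in>B (max m n). (coeff f k)\<^sup>2) - (\<Sum>k\<in>B m. (coeff f k)\<^sup>2)"
    by (intro sum_diff finite_B B_mono) auto
  finally show ?thesis
    using bessel[OF f, of "max m n"] unfolding projection_error[OF f] by linarith
qed

text \<open>Dominated convergence for the sum over \<open>j\<close>: each projection error tends to
  zero, all are bounded by \<open>K\<close>, and the weights are summable. The growing range
  \<open>B m\<close> is split at a fixed \<open>B p\<close>.\<close>

lemma noise_tail_tendsto_0:
  assumes s: "ess_bounded Q s"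
  shows "(\<lambda>m. \<Sum>j\<in>B m. (\<integral>x. (s x * psi j x - trig m (coeff (\<lambda>x. s x * psi j x)) x)\<^sup>2 \<partial>Q) / (1 + lam j)\<^sup>2)
    \<longlonglongrightarrow> 0" (is "?f \<longlonglongrightarrow> 0")
proof -
  define T where "T m j = (\<integral>x. (s x * psi j x - trig m (coeff (\<lambda>x. s x * psi j x)) x)\<^sup>2 \<partial>Q)" for m j
  \<comment> \<open>The added 1 keeps \<open>K\<close> positive for the division by
    \<open>2 * K\<close>.\<close>
  define K where "K = 4 * (\<integral>x. (s x)\<^sup>2 \<partial>Q) + 1"
  have K: "K > 0" unfolding K_def by (rule add_nonneg_pos) auto
  have eb: "ess_bounded Q (\<lambda>x. s x * psi j x)" for j by (intro bdd_intros s)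
  have T0: "0 \<le> T m j" for m j unfolding T_def by simp
  have TK: "T m j \<le> K" for m j
    using integral_mult_psi_sq_le[OF s, of j] sum_nonneg[of "B m" "\<lambda>k. (coeff (\<lambda>x. s x * psi j x) k)\<^sup>2"]
    unfolding T_def K_def projection_error[OF eb] by simp
  have Tlim: "(\<lambda>m. T m j) \<longlonglongrightarrow> 0" for j
    unfolding T_def by (rule projection_error_tendsto_0[OF eb])
  have "\<exists>N. \<forall>m\<ge>N. norm (?f m - 0) < \<epsilon>" if e: "\<epsilon> > 0" for \<epsilon>
  proof -
    have "0 < \<epsilon> / (2 * K)" using e K by simp
    then obtain p where p: "\<And>n. (\<Sum>k\<in>B n - B p. 1 / (1 + lam k)\<^sup>2) \<le> \<epsilon> / (2 * K)"
      using lam_tail by blast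
    have "(\<lambda>m. \<Sum>j\<in>B p. T m j / (1 + lam j)\<^sup>2) \<longlonglongrightarrow> (\<Sum>j\<in>B p. 0 / (1 + lam j)\<^sup>2)"
      by (intro tendsto_intros Tlim) (use one_lam_pos in auto)
    then have "(\<lambda>m. \<Sum>j\<in>B p. T m j / (1 + lam j)\<^sup>2) \<longlonglongrightarrow> 0" by simp
    from LIMSEQ_D[OF this, of "\<epsilon> / 2"] e obtain N
      where N: "\<And>m. m \<ge> N \<Longrightarrow> norm ((\<Sum>j\<in>B p. T m j / (1 + lam j)\<^sup>2) - 0) < \<epsilon> / 2" by auto
    show ?thesis
    proof (intro exI allI impI)
      fix m assume m: "m \<ge> N"
      have "?f m = (\<Sum>j\<in>B m \<inter> B p. T m j / (1 + lam j)\<^sup>2) + (\<Sum>j\<in>B m - B p. T m j / (1 + lam j)\<^sup>2)"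
        unfolding T_def[symmetric] by (rule sum.Int_Diff) (rule finite_B)
      also have "(\<Sum>j\<in>B m \<inter> B p. T m j / (1 + lam j)\<^sup>2) \<le> (\<Sum>j\<in>B p. T m j / (1 + lam j)\<^sup>2)"
        by (intro sum_mono2) (auto simp: finite_B T0)
      also have "\<dots> < \<epsilon> / 2" using N[OF m] by auto
      also have "(\<Sum>j\<in>B m - B p. T m j / (1 + lam j)\<^sup>2) \<le> (\<Sum>j\<in>B m - B p. K * (1 / (1 + lam j)\<^sup>2))"
        by (intro sum_mono) (auto intro!: divide_right_mono TK)
      also have "\<dots> = K * (\<Sum>j\<in>B m - B p. 1 / (1 + lam j)\<^sup>2)" by (simp add: sum_distrib_left)
      also have "\<dots> \<le> K * (\<epsilon> / (2 * K))" using K by (intro mult_left_mono p) auto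
      also have "\<dots> = \<epsilon> / 2" using K by simp
      finally have "?f m < \<epsilon>" by simp
      moreover have "0 \<le> ?f m" by (auto intro!: sum_nonneg)
      ultimately show "norm (?f m - 0) < \<epsilon>" by simp
    qed
  qed
  then show ?thesis by (auto simp: LIMSEQ_iff)
qed

text \<open>Hilbert--Schmidt convergence, measured in \<open>H\<^sup>-\<^sup>2\<close>, of the operators that turn the noise
  coefficients into the right-hand side.\<close>

lemma noise_variance_le:
  assumes s: "ess_bounded Q s" and t: "ess_bounded Q t"
  shows "(\<Sum>j\<in>B m. (\<Sum>k\<in>B n. (noise_matrix s k j - (if k \<in> B m then noise_matrix t k j else 0))\<^sup>2) / (1 + lam j)\<^sup>2)
    \<le> Lam * (4 * (\<integral>x. (s x - t x)\<^sup>2 \<partial>Q))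
      + (\<Sum>j\<in>B m. (\<integral>x. (s x * psi j x - trig m (coeff (\<lambda>x. s x * psi j x)) x)\<^sup>2 \<partial>Q) / (1 + lam j)\<^sup>2)"
proof -
  define D where "D k j = (noise_matrix s k j - (if k \<in> B m then noise_matrix t k j else 0))\<^sup>2" for k j
  define T where "T j = (\<integral>x. (s x * psi j x - trig m (coeff (\<lambda>x. s x * psi j x)) x)\<^sup>2 \<partial>Q)" for j
  have st: "ess_bounded Q (\<lambda>x. s x - t x)" by (intro bdd_intros s t)
  have "(\<Sum>k\<in>B n. D k j) \<le> 4 * (\<integral>x. (s x - t x)\<^sup>2 \<partial>Q) + T j" for j
  proof -
    \<comment> \<open>Modes in \<open>B m\<close> carry the error of the coefficient; the others are
      noise that the truncation at \<open>m\<close> discards.\<close>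
    have "(\<Sum>k\<in>B n. D k j) = (\<Sum>k\<in>B n \<inter> B m. D k j) + (\<Sum>k\<in>B n - B m. D k j)"
      by (rule sum.Int_Diff) (rule finite_B)
    also have "(\<Sum>k\<in>B n \<inter> B m. D k j) = (\<Sum>k\<in>B n \<inter> B m. (noise_matrix (\<lambda>x. s x - t x) k j)\<^sup>2)"
      unfolding D_def by (intro sum.cong) (auto simp: noise_matrix_diff[OF s t])
    also have "\<dots> \<le> (\<Sum>k\<in>B m. (noise_matrix (\<lambda>x. s x - t x) k j)\<^sup>2)"
      by (intro sum_mono2) (auto simp: finite_B)
    also have "\<dots> \<le> 4 * (\<integral>x. (s x - t x)\<^sup>2 \<partial>Q)" by (rule noise_matrix_row[OF st])
    also have "(\<Sum>k\<in>B n - B m. D k j) = (\<Sum>k\<in>B n - B m. (coeff (\<lambda>x. s x * psi j x) k)\<^sup>2)"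
      unfolding D_def by (intro sum.cong) (auto simp: noise_matrix_eq_coeff)
    also have "\<dots> \<le> T j" unfolding T_def by (intro bessel_tail bdd_intros s)
    finally show ?thesis by simp
  qed
  then have "(\<Sum>j\<in>B m. (\<Sum>k\<in>B n. D k j) / (1 + lam j)\<^sup>2)
      \<le> (\<Sum>j\<in>B m. (4 * (\<integral>x. (s x - t x)\<^sup>2 \<partial>Q) + T j) / (1 + lam j)\<^sup>2)"
    by (intro sum_mono divide_right_mono) auto
  also have "\<dots> = (\<Sum>j\<in>B m. 4 * (\<integral>x. (s x - t x)\<^sup>2 \<partial>Q) / (1 + lam j)\<^sup>2) + (\<Sum>j\<in>B m. T j / (1 + lam j)\<^sup>2)"
    by (simp add: add_divide_distrib sum.distrib)
  also have "(\<Sum>j\<in>B m. 4 * (\<integral>x. (s x - t x)\<^sup>2 \<partial>Q) / (1 + lam j)\<^sup>2) \<le> Lam * (4 * (\<integral>x. (s x - t x)\<^sup>2 \<partial>Q))"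
    by (rule sum_weight_le) auto
  finally show ?thesis unfolding D_def T_def by simp
qed

end

section \<open>Convergence in probability and conditioning on the lower layers\<close>

context prob_space
begin

text \<open>Truncation at 1 describes convergence in probability by expectations that are finite
  even when those of \<open>X n\<close> are not.\<close>

definition null_in_prob :: "(nat \<Rightarrow> 'a \<Rightarrow> ennreal) \<Rightarrow> bool" where
  "null_in_prob X \<longleftrightarrow> (\<lambda>n. \<integral>\<^sup>+\<omega>. min 1 (X n \<omega>) \<partial>M) \<longlonglongrightarrow> 0"

text \<open>One-sided boundedness in probability, uniform in \<open>n\<close>. The exceptional set
  is any measurable set, so almost sure implications between families can be used without looking at
  the level sets of \<open>X n\<close>.\<close>

definition tight_family :: "(nat \<Rightarrow> 'a \<Rightarrow> real) \<Rightarrow> bool" where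
  "tight_family X \<longleftrightarrow> (\<forall>\<delta>>0. \<exists>R. \<forall>n. \<exists>A\<in>sets M. measure M A \<le> \<delta> \<and> (AE \<omega> in M. \<omega> \<notin> A \<longrightarrow> X n \<omega> \<le> R))"

lemma null_in_prob_AE_subseq:
  assumes [measurable]: "\<And>n. X n \<in> borel_measurable M" and "null_in_prob X"
  obtains r :: "nat \<Rightarrow> nat" where "strict_mono r" "AE \<omega> in M. (\<lambda>n. X (r n) \<omega>) \<longlonglongrightarrow> 0"
proof -
  define f where "f n \<omega> = enn2real (min 1 (X n \<omega>))" for n \<omega>
  have f_le: "0 \<le> f n \<omega>" "f n \<omega> \<le> 1" for n \<omega>
    unfolding f_def using enn2real_mono[of "min 1 (X n \<omega>)" 1] by auto
  have ef: "ennreal (f n \<omega>) = min 1 (X n \<omega>)" for n \<omega>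
    unfolding f_def by (rule ennreal_enn2real) (auto simp: min_less_iff_disj)
  have [measurable]: "f n \<in> borel_measurable M" for n unfolding f_def by measurable
  have int: "integrable M (f n)" for n
    by (rule integrable_const_bound[where B=1]) (auto simp: f_le)
  have "ennreal (\<integral>\<omega>. norm (f n \<omega>) \<partial>M) = (\<integral>\<^sup>+\<omega>. min 1 (X n \<omega>) \<partial>M)" for n
    by (subst nn_integral_eq_integral[symmetric]) (auto simp: int f_le ef intro!: AE_I2)
  then have "(\<lambda>n. ennreal (\<integral>\<omega>. norm (f n \<omega>) \<partial>M)) \<longlonglongrightarrow> ennreal 0"
    using assms(2) unfolding null_in_prob_def by simp
  then have "(\<lambda>n. \<integral>\<omega>. norm (f n \<omega>) \<partial>M) \<longlonglongrightarrow> 0"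
    by (subst (asm) tendsto_ennreal_iff) auto
  from tendsto_L1_AE_subseq[OF int this] obtain r :: "nat \<Rightarrow> nat"
    where r: "strict_mono r" "AE \<omega> in M. (\<lambda>n. f (r n) \<omega>) \<longlonglongrightarrow> 0" by blast
  have "AE \<omega> in M. (\<lambda>n. X (r n) \<omega>) \<longlonglongrightarrow> 0"
    using r(2)
  proof eventually_elim
    case (elim \<omega>)
    have "(\<lambda>n. ennreal (f (r n) \<omega>)) \<longlonglongrightarrow> ennreal 0"
      by (intro tendsto_ennrealI elim)
    \<comment> \<open>Convergence to zero makes the truncation at 1 eventually inactive.\<close>
    moreover have "eventually (\<lambda>n. f (r n) \<omega> < 1) sequentially"
      using order_tendstoD(2)[OF elim, of 1] by simp
    then have "eventually (\<lambda>n. ennreal (f (r n) \<omega>) = X (r n) \<omega>) sequentially"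
    proof eventually_elim
      case (elim n)
      then have "min 1 (X (r n) \<omega>) < 1"
        unfolding ef[symmetric] using ennreal_lessI[of 1] by (metis ennreal_1 zero_less_one)
      then show ?case unfolding ef by (auto simp: min_def split: if_splits)
    qed
    ultimately show ?case by (simp add: filterlim_cong)
  qed
  with r(1) show thesis by (rule that)
qed

lemma AE_null_imp_null_in_prob:
  assumes [measurable]: "\<And>n. X n \<in> borel_measurable M" and X: "AE \<omega> in M. (\<lambda>n. X n \<omega>) \<longlonglongrightarrow> 0"
  shows "null_in_prob X"
proof -
  have "(\<lambda>n. \<integral>\<^sup>+\<omega>. min 1 (X n \<omega>) \<partial>M) \<longlonglongrightarrow> (\<integral>\<^sup>+\<omega>. 0 \<partial>M)"
  proof (rule nn_integral_dominated_convergence[where w="\<lambda>_. 1"])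
    show "AE \<omega> in M. (\<lambda>n. min 1 (X n \<omega>)) \<longlonglongrightarrow> 0"
      using X
    proof eventually_elim
      case (elim \<omega>)
      have "(\<lambda>n. min 1 (X n \<omega>)) \<longlonglongrightarrow> min 1 0"
        by (intro tendsto_min tendsto_const elim)
      then show ?case by simp
    qed
  qed (auto simp: emeasure_space_1)
  then show ?thesis unfolding null_in_prob_def by simp
qed

text \<open>Otherwise the truncated expectations avoid a neighbourhood of 0 along some subsequence,
  which contradicts the further subsequence supplied by the hypothesis.\<close>

lemma null_in_prob_subseq_criterion:
  assumes [measurable]: "\<And>n. X n \<in> borel_measurable M"
    and sub: "\<And>s :: nat \<Rightarrow> nat. strict_mono s \<Longrightarrow>
      \<exists>r :: nat \<Rightarrow> nat. strict_mono r \<and> (AE \<omega> in M. (\<lambda>n. X (s (r n)) \<omega>) \<longlonglongrightarrow> 0)"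
  shows "null_in_prob X"
proof (rule ccontr)
  define e where "e n = (\<integral>\<^sup>+\<omega>. min 1 (X n \<omega>) \<partial>M)" for n
  assume "\<not> null_in_prob X"
  then have "\<not> e \<longlonglongrightarrow> 0" unfolding null_in_prob_def e_def .
  then obtain U where U: "open U" "0 \<in> U" and "\<not> eventually (\<lambda>n. e n \<in> U) sequentially"
    unfolding tendsto_def by blast
  then have "\<exists>\<^sub>\<infinity>n. e n \<notin> U"
    by (simp add: not_eventually cofinite_eq_sequentially)
  then have "infinite {n. e n \<notin> U}" by (simp add: INFM_iff_infinite)
  then obtain s :: "nat \<Rightarrow> nat" where s: "strict_mono s" "\<And>n. s n \<in> {n. e n \<notin> U}"
    using infinite_enumerate by blast
  obtain r :: "nat \<Rightarrow> nat" where r: "strict_mono r" "AE \<omega> in M. (\<lambda>n. X (s (r n)) \<omega>) \<longlonglongrightarrow> 0"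
    using sub[OF s(1)] by blast
  have "null_in_prob (\<lambda>n. X (s (r n)))"
    by (rule AE_null_imp_null_in_prob[OF _ r(2)]) simp
  then have "(\<lambda>n. e (s (r n))) \<longlonglongrightarrow> 0" unfolding null_in_prob_def e_def .
  then have "eventually (\<lambda>n. e (s (r n)) \<in> U) sequentially"
    using U by (rule topological_tendstoD)
  then show False using s(2) unfolding eventually_sequentially by auto
qed

lemma null_in_prob_subseq:
  "null_in_prob X \<Longrightarrow> strict_mono s \<Longrightarrow> null_in_prob (\<lambda>n. X (s n))"
  unfolding null_in_prob_def using LIMSEQ_subseq_LIMSEQ[of _ 0 s] by (auto simp: comp_def)

lemma tight_family_combine:
  assumes X: "tight_family X" and Y: "tight_family Y"
    and Z: "\<And>R S. \<exists>K. \<forall>n. AE \<omega> in M. X n \<omega> \<le> R \<longrightarrow> Y n \<omega> \<le> S \<longrightarrow> Z n \<omega> \<le> K"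
  shows "tight_family Z"
  unfolding tight_family_def
proof (intro allI impI)
  fix \<delta> :: real assume "\<delta> > 0"
  then have d: "\<delta> / 2 > 0" by simp
  obtain R where R: "\<forall>n. \<exists>A\<in>sets M. measure M A \<le> \<delta> / 2 \<and> (AE \<omega> in M. \<omega> \<notin> A \<longrightarrow> X n \<omega> \<le> R)"
    using X d unfolding tight_family_def by blast
  obtain S where S: "\<forall>n. \<exists>A\<in>sets M. measure M A \<le> \<delta> / 2 \<and> (AE \<omega> in M. \<omega> \<notin> A \<longrightarrow> Y n \<omega> \<le> S)"
    using Y d unfolding tight_family_def by blast
  obtain K where K: "\<forall>n. AE \<omega> in M. X n \<omega> \<le> R \<longrightarrow> Y n \<omega> \<le> S \<longrightarrow> Z n \<omega> \<le> K"
    using Z by blast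
  have "\<exists>A\<in>sets M. measure M A \<le> \<delta> \<and> (AE \<omega> in M. \<omega> \<notin> A \<longrightarrow> Z n \<omega> \<le> K)" for n
  proof -
    obtain A where A: "A \<in> sets M" "measure M A \<le> \<delta> / 2" "AE \<omega> in M. \<omega> \<notin> A \<longrightarrow> X n \<omega> \<le> R" using R by blast
    obtain A' where A': "A' \<in> sets M" "measure M A' \<le> \<delta> / 2" "AE \<omega> in M. \<omega> \<notin> A' \<longrightarrow> Y n \<omega> \<le> S" using S by blast
    have "measure M (A \<union> A') \<le> \<delta>"
      using measure_Un_le[OF A(1) A'(1)] A(2) A'(2) by linarith
    moreover have "AE \<omega> in M. \<omega> \<notin> A \<union> A' \<longrightarrow> Z n \<omega> \<le> K"
      using A(3) A'(3) K[rule_format, of n] by eventually_elim auto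
    ultimately show ?thesis using A(1) A'(1) by blast
  qed
  then show "\<exists>K. \<forall>n. \<exists>A\<in>sets M. measure M A \<le> \<delta> \<and> (AE \<omega> in M. \<omega> \<notin> A \<longrightarrow> Z n \<omega> \<le> K)" by blast
qed

lemma null_in_prob_mult_tight:
  assumes [measurable]: "\<And>n. X n \<in> borel_measurable M"
    and X: "null_in_prob X" and Y: "tight_family Y"
  shows "null_in_prob (\<lambda>n \<omega>. X n \<omega> * ennreal (Y n \<omega>))"
proof -
  define e where "e n = (\<integral>\<^sup>+\<omega>. min 1 (X n \<omega> * ennreal (Y n \<omega>)) \<partial>M)" for n
  have "\<forall>\<epsilon>>0. \<epsilon> < \<infinity> \<longrightarrow> eventually (\<lambda>n. e n \<le> \<epsilon>) sequentially"
  proof (intro allI impI)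
    fix \<epsilon> :: ennreal assume "\<epsilon> > 0" "\<epsilon> < \<infinity>"
    then obtain t where t: "\<epsilon> = ennreal t" "t > 0"
      by (cases \<epsilon>) (auto simp: less_top_ennreal)
    obtain R0 where R0: "\<forall>n. \<exists>A\<in>sets M. measure M A \<le> t / 2 \<and> (AE \<omega> in M. \<omega> \<notin> A \<longrightarrow> Y n \<omega> \<le> R0)"
      using Y t(2) unfolding tight_family_def by (meson half_gt_zero)
    \<comment> \<open>\<open>R \<ge> 1\<close> gives \<open>min 1 (R * X) \<le> R * min 1 X\<close>;
      the exceptional set and the remainder receive \<open>t / 2\<close> each.\<close>
    define R where "R = max 1 R0"
    have "0 < t / (2 * R)" using t(2) unfolding R_def by simp
    then have "eventually (\<lambda>n. (\<integral>\<^sup>+\<omega>. min 1 (X n \<omega>) \<partial>M) < ennreal (t / (2 * R))) sequentially"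
      using X unfolding null_in_prob_def by (intro order_tendstoD) auto
    then show "eventually (\<lambda>n. e n \<le> \<epsilon>) sequentially"
    proof eventually_elim
      case (elim n)
      obtain A where A [measurable]: "A \<in> sets M" and A': "measure M A \<le> t / 2"
        "AE \<omega> in M. \<omega> \<notin> A \<longrightarrow> Y n \<omega> \<le> R0" using R0 by blast
      have "e n \<le> (\<integral>\<^sup>+\<omega>. indicator A \<omega> + ennreal R * min 1 (X n \<omega>) \<partial>M)"
        unfolding e_def
      proof (rule nn_integral_mono_AE)
        show "AE \<omega> in M. min 1 (X n \<omega> * ennreal (Y n \<omega>)) \<le> indicator A \<omega> + ennreal R * min 1 (X n \<omega>)"
          using A'(2)
        proof eventually_elim
          case (elim \<omega>)
          show ?case
          proof (cases "\<omega> \<in> A")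
            case True
            then show ?thesis by (auto intro: order_trans[OF min.cobounded1])
          next
            case False
            then have YR: "ennreal (Y n \<omega>) \<le> ennreal R" using elim unfolding R_def by (intro ennreal_leI) auto
            have R1: "1 \<le> ennreal R" unfolding R_def by (auto simp: ennreal_ge_1)
            show ?thesis
            proof (cases "X n \<omega> \<le> 1")
              case True
              then have "min 1 (X n \<omega>) = X n \<omega>" by (simp add: min_def)
              moreover have "X n \<omega> * ennreal (Y n \<omega>) \<le> ennreal R * X n \<omega>"
                using mult_left_mono[OF YR, of "X n \<omega>"] by (simp add: mult.commute)
              ultimately show ?thesis using False by (auto intro: order_trans[OF min.cobounded2])
            next
              case False
              then have "min 1 (X n \<omega>) = 1" by (simp add: min_def)
              then show ?thesis using R1 \<open>\<omega> \<notin> A\<close> by (auto intro: order_trans[OF min.cobounded1])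
            qed
          qed
        qed
      qed
      also have "\<dots> = emeasure M A + ennreal R * (\<integral>\<^sup>+\<omega>. min 1 (X n \<omega>) \<partial>M)"
        by (simp add: nn_integral_add nn_integral_cmult)
      also have "\<dots> \<le> ennreal (t / 2) + ennreal R * ennreal (t / (2 * R))"
        using A'(1) elim by (intro add_mono mult_left_mono) (auto simp: emeasure_eq_measure intro: ennreal_leI)
      also have "\<dots> = ennreal (t / 2 + R * (t / (2 * R)))"
        using t(2) unfolding R_def by (subst ennreal_mult[symmetric]) (auto simp del: times_divide_eq_right)
      also have "t / 2 + R * (t / (2 * R)) = t" unfolding R_def by (simp add: field_simps)
      finally show ?case using t by simp
    qed
  qed
  then have le: "eventually (\<lambda>n. e n \<le> \<epsilon>) sequentially" if "0 < \<epsilon>" "\<epsilon> < \<infinity>" for \<epsilon>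
    using that by blast
  have "e \<longlonglongrightarrow> 0"
  proof (rule order_tendstoI)
    fix a :: ennreal assume "0 < a"
    then obtain y where y: "0 < y" "y < a" using dense by blast
    then have "y < \<infinity>" by (simp add: less_le_trans)
    from le[OF y(1) this] show "eventually (\<lambda>n. e n < a) sequentially"
      by eventually_elim (use y in \<open>auto intro: le_less_trans\<close>)
  qed simp
  then show ?thesis unfolding null_in_prob_def e_def .
qed

end

text \<open>The field \<open>fubini\<close> is the only consequence of the independence of \<open>F\<close> and \<open>G\<close> that is used: an
  expectation of a quantity built from both may be computed with a fresh copy of the noise.\<close>

locale independent_noise = prob_space M for M :: "'w measure" +
  fixes F G :: "'w measure" and xi :: "'k \<Rightarrow> 'w \<Rightarrow> real"
  assumes space_F: "space F = space M" and sets_F: "sets F \<subseteq> sets M"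
    and space_G: "space G = space M" and sets_G: "sets G \<subseteq> sets M"
    and xi_measurable: "\<And>k. xi k \<in> borel_measurable G"
    and fubini: "\<And>h. h \<in> borel_measurable (F \<Otimes>\<^sub>M G) \<Longrightarrow>
        (\<integral>\<^sup>+\<omega>. h (\<omega>, \<omega>) \<partial>M) = (\<integral>\<^sup>+\<omega>. (\<integral>\<^sup>+\<omega>'. h (\<omega>, \<omega>') \<partial>M) \<partial>M)"
    and gaussian_mgf: "\<And>S a. finite S \<Longrightarrow>
        (\<integral>\<^sup>+\<omega>. ennreal (exp (\<Sum>k\<in>S. a k * xi k \<omega>)) \<partial>M) = ennreal (exp ((\<Sum>k\<in>S. (a k)\<^sup>2) / 2))"
begin

lemma measurable_from_F: "f \<in> borel_measurable F \<Longrightarrow> f \<in> borel_measurable M"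
  using space_F sets_F by (auto simp: measurable_def)

lemma measurable_from_G: "f \<in> borel_measurable G \<Longrightarrow> f \<in> borel_measurable M"
  using space_G sets_G by (auto simp: measurable_def)

lemma id_measurable_F: "(\<lambda>\<omega>. \<omega>) \<in> measurable M F"
  using space_F sets_F by (auto simp: measurable_def intro: sets.Int_space_eq1)

lemma id_measurable_G: "(\<lambda>\<omega>. \<omega>) \<in> measurable M G"
  using space_G sets_G by (auto simp: measurable_def)

lemma xi_measurable_M [measurable]: "xi k \<in> borel_measurable M"
  by (rule measurable_from_G[OF xi_measurable])

lemma diagonal_measurable:
  assumes "h \<in> borel_measurable (F \<Otimes>\<^sub>M G)"
  shows "(\<lambda>\<omega>. h (\<omega>, \<omega>)) \<in> borel_measurable M"
  using measurable_compose[OF measurable_Pair[OF id_measurable_F id_measurable_G] assms] .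

lemma section_measurable:
  assumes "h \<in> borel_measurable (F \<Otimes>\<^sub>M G)" "\<omega> \<in> space M"
  shows "(\<lambda>\<omega>'. h (\<omega>, \<omega>')) \<in> borel_measurable M"
  using measurable_compose[OF measurable_Pair[OF measurable_const id_measurable_G] assms(1), of \<omega>] assms(2) space_F
  by simp

lemma inner_measurable:
  assumes "h \<in> borel_measurable (F \<Otimes>\<^sub>M G)"
  shows "(\<lambda>\<omega>. \<integral>\<^sup>+\<omega>'. h (\<omega>, \<omega>') \<partial>M) \<in> borel_measurable M"
proof -
  have "(\<lambda>p. h (fst p, snd p)) \<in> borel_measurable (M \<Otimes>\<^sub>M M)"
    by (rule measurable_compose[OF measurable_Pair assms])
      (rule measurable_compose[OF measurable_fst id_measurable_F] measurable_compose[OF measurable_snd id_measurable_G])+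
  then show ?thesis
    by (intro borel_measurable_nn_integral) (simp add: case_prod_beta')
qed

text \<open>The conditional expectations are only known to vanish almost surely. Truncating first
  and bounding the inner expectation of \<open>min 1 T\<close> by \<open>min 1\<close> of the inner
  expectation of \<open>T\<close> keeps everything bounded, so dominated convergence applies without
  integrability of \<open>T\<close>.\<close>

lemma null_in_prob_conditional:
  assumes T: "\<And>m. T m \<in> borel_measurable (F \<Otimes>\<^sub>M G)"
    and lim: "AE \<omega> in M. (\<lambda>m. \<integral>\<^sup>+\<omega>'. T m (\<omega>, \<omega>') \<partial>M) \<longlonglongrightarrow> 0"
  shows "null_in_prob (\<lambda>m \<omega>. T m (\<omega>, \<omega>))"
proof -
  have "null_in_prob (\<lambda>m \<omega>. \<integral>\<^sup>+\<omega>'. T m (\<omega>, \<omega>') \<partial>M)"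
    by (intro AE_null_imp_null_in_prob inner_measurable T lim)
  then have lim': "(\<lambda>m. \<integral>\<^sup>+\<omega>. min 1 (\<integral>\<^sup>+\<omega>'. T m (\<omega>, \<omega>') \<partial>M) \<partial>M) \<longlonglongrightarrow> 0"
    unfolding null_in_prob_def .
  have "(\<integral>\<^sup>+\<omega>. min 1 (T m (\<omega>, \<omega>)) \<partial>M) \<le> (\<integral>\<^sup>+\<omega>. min 1 (\<integral>\<^sup>+\<omega>'. T m (\<omega>, \<omega>') \<partial>M) \<partial>M)" for m
  proof -
    have "(\<integral>\<^sup>+\<omega>. min 1 (T m (\<omega>, \<omega>)) \<partial>M) = (\<integral>\<^sup>+\<omega>. (\<integral>\<^sup>+\<omega>'. min 1 (T m (\<omega>, \<omega>')) \<partial>M) \<partial>M)"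
      by (rule fubini) (use T in measurable)
    also have "\<dots> \<le> (\<integral>\<^sup>+\<omega>. min 1 (\<integral>\<^sup>+\<omega>'. T m (\<omega>, \<omega>') \<partial>M) \<partial>M)"
    proof (intro nn_integral_mono min.boundedI)
      fix \<omega>
      have "(\<integral>\<^sup>+\<omega>'. min 1 (T m (\<omega>, \<omega>')) \<partial>M) \<le> (\<integral>\<^sup>+\<omega>'. 1 \<partial>M)"
        by (intro nn_integral_mono) auto
      then show "(\<integral>\<^sup>+\<omega>'. min 1 (T m (\<omega>, \<omega>')) \<partial>M) \<le> 1" by (simp add: emeasure_space_1)
    qed (auto intro: nn_integral_mono)
    finally show ?thesis .
  qed
  then show ?thesis
    unfolding null_in_prob_def by (intro tendsto_sandwich[OF _ _ tendsto_const lim']) auto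
qed

lemma tight_family_conditional:
  assumes T: "\<And>n. T n \<in> borel_measurable (F \<Otimes>\<^sub>M G)"
    and X: "\<And>n. X n \<in> borel_measurable F" "tight_family X"
    and Z [measurable]: "\<And>n. Z n \<in> borel_measurable M"
    and ZT: "\<And>n. AE \<omega> in M. ennreal (Z n \<omega>) \<le> T n (\<omega>, \<omega>)"
    and K: "\<And>R. \<exists>K. \<forall>n. \<forall>\<omega>\<in>space M. X n \<omega> \<le> R \<longrightarrow> (\<integral>\<^sup>+\<omega>'. T n (\<omega>, \<omega>') \<partial>M) \<le> ennreal K"
  shows "tight_family Z"
  unfolding tight_family_def
proof (intro allI impI)
  fix \<delta> :: real assume d: "\<delta> > 0"
  obtain R where R: "\<forall>n. \<exists>A\<in>sets M. measure M A \<le> \<delta> / 2 \<and> (AE \<omega> in M. \<omega> \<notin> A \<longrightarrow> X n \<omega> \<le> R)"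
    using X(2) d unfolding tight_family_def by (meson half_gt_zero)
  obtain K0 where K0: "\<forall>n. \<forall>\<omega>\<in>space M. X n \<omega> \<le> R \<longrightarrow> (\<integral>\<^sup>+\<omega>'. T n (\<omega>, \<omega>') \<partial>M) \<le> ennreal K0"
    using K by blast
  define K1 where "K1 = max 1 K0"
  \<comment> \<open>The level at which Markov's inequality leaves probability
    \<open>\<delta> / 2\<close>.\<close>
  define S where "S = 2 * K1 / \<delta>"
  have S: "S > 0" unfolding S_def K1_def using d by simp
  have "\<exists>A\<in>sets M. measure M A \<le> \<delta> \<and> (AE \<omega> in M. \<omega> \<notin> A \<longrightarrow> Z n \<omega> \<le> S)" for n
  proof -
    obtain A where A [measurable]: "A \<in> sets M" and A': "measure M A \<le> \<delta> / 2"
      "AE \<omega> in M. \<omega> \<notin> A \<longrightarrow> X n \<omega> \<le> R" using R by blast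
    define h where "h p = (if X n (fst p) \<le> R then T n p else 0)" for p
    note [measurable] = T[of n] X(1)[of n]
    have h [measurable]: "h \<in> borel_measurable (F \<Otimes>\<^sub>M G)"
      unfolding h_def by measurable
    note [measurable] = diagonal_measurable[OF h]
    have "(\<integral>\<^sup>+\<omega>. h (\<omega>, \<omega>) \<partial>M) = (\<integral>\<^sup>+\<omega>. (\<integral>\<^sup>+\<omega>'. h (\<omega>, \<omega>') \<partial>M) \<partial>M)"
      by (rule fubini[OF h])
    also have "\<dots> \<le> (\<integral>\<^sup>+\<omega>. ennreal K1 \<partial>M)"
    proof (rule nn_integral_mono)
      fix \<omega> assume w: "\<omega> \<in> space M"
      show "(\<integral>\<^sup>+\<omega>'. h (\<omega>, \<omega>') \<partial>M) \<le> ennreal K1"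
      proof (cases "X n \<omega> \<le> R")
        case True
        then have "(\<integral>\<^sup>+\<omega>'. h (\<omega>, \<omega>') \<partial>M) \<le> ennreal K0" using K0 w unfolding h_def by simp
        also have "\<dots> \<le> ennreal K1" unfolding K1_def by (intro ennreal_leI) simp
        finally show ?thesis .
      qed (simp add: h_def)
    qed
    finally have hK: "(\<integral>\<^sup>+\<omega>. h (\<omega>, \<omega>) \<partial>M) \<le> ennreal K1" by (simp add: emeasure_space_1)
    define A2 where "A2 = {\<omega>\<in>space M. 1 \<le> ennreal (1 / S) * h (\<omega>, \<omega>)}"
    have [measurable]: "A2 \<in> sets M" unfolding A2_def by measurable
    have "emeasure M A2 \<le> ennreal (1 / S) * (\<integral>\<^sup>+\<omega>. h (\<omega>, \<omega>) * indicator (space M) \<omega> \<partial>M)"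
      unfolding A2_def by (rule nn_integral_Markov_inequality) auto
    also have "(\<integral>\<^sup>+\<omega>. h (\<omega>, \<omega>) * indicator (space M) \<omega> \<partial>M) = (\<integral>\<^sup>+\<omega>. h (\<omega>, \<omega>) \<partial>M)"
      by (intro nn_integral_cong) simp
    also have "ennreal (1 / S) * \<dots> \<le> ennreal (1 / S) * ennreal K1"
      by (intro mult_left_mono hK) simp
    also have "\<dots> = ennreal (1 / S * K1)"
      using S by (intro ennreal_mult[symmetric]) (auto simp: K1_def)
    also have "1 / S * K1 = \<delta> / 2" unfolding S_def K1_def using d by (simp add: field_simps)
    finally have A2: "measure M A2 \<le> \<delta> / 2" using d by (simp add: emeasure_eq_measure)
    have "AE \<omega> in M. \<omega> \<notin> A \<union> A2 \<longrightarrow> Z n \<omega> \<le> S"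
      using A'(2) ZT[of n] AE_space
    proof eventually_elim
      case (elim \<omega>)
      show ?case
      proof (intro impI)
        assume w: "\<omega> \<notin> A \<union> A2"
        with elim have "h (\<omega>, \<omega>) = T n (\<omega>, \<omega>)" unfolding h_def by auto
        moreover have "ennreal (1 / S) * h (\<omega>, \<omega>) < 1" using w elim unfolding A2_def by auto
        ultimately have "ennreal (1 / S) * ennreal (Z n \<omega>) < 1"
          using mult_left_mono[OF elim(2), of "ennreal (1 / S)"] by (auto intro: le_less_trans)
        then have "ennreal (1 / S * Z n \<omega>) < ennreal 1"
          using S by (subst ennreal_mult') auto
        then have "1 / S * Z n \<omega> < 1" by (metis ennreal_leI linorder_not_less)
        then show "Z n \<omega> \<le> S" using S by (simp add: field_simps)
      qed
    qed
    moreover have "measure M (A \<union> A2) \<le> \<delta>"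
      using measure_Un_le[of A M A2] A'(1) A2 by simp
    ultimately show ?thesis by (intro bexI[of _ "A \<union> A2"]) auto
  qed
  then show "\<exists>S. \<forall>n. \<exists>A\<in>sets M. measure M A \<le> \<delta> \<and> (AE \<omega> in M. \<omega> \<notin> A \<longrightarrow> Z n \<omega> \<le> S)" by blast
qed

section \<open>Gaussian moments\<close>

lemma gaussian_exp_abs:
  assumes "finite S"
  shows "(\<integral>\<^sup>+\<omega>. ennreal (exp (t * \<bar>\<Sum>k\<in>S. a k * xi k \<omega>\<bar>)) \<partial>M) \<le> ennreal (2 * exp (t\<^sup>2 * (\<Sum>k\<in>S. (a k)\<^sup>2) / 2))"
proof -
  define Y where "Y \<omega> = (\<Sum>k\<in>S. a k * xi k \<omega>)" for \<omega>
  have Y [measurable]: "Y \<in> borel_measurable M" unfolding Y_def by measurable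
  have m: "(\<integral>\<^sup>+\<omega>. ennreal (exp (c * Y \<omega>)) \<partial>M) = ennreal (exp (c\<^sup>2 * (\<Sum>k\<in>S. (a k)\<^sup>2) / 2))" for c
    using gaussian_mgf[OF assms, of "\<lambda>k. c * a k"]
    by (simp add: Y_def sum_distrib_left power_mult_distrib mult.assoc)
  have "(\<integral>\<^sup>+\<omega>. ennreal (exp (t * \<bar>Y \<omega>\<bar>)) \<partial>M) \<le> (\<integral>\<^sup>+\<omega>. ennreal (exp (t * Y \<omega>)) + ennreal (exp ((- t) * Y \<omega>)) \<partial>M)"
  proof (rule nn_integral_mono)
    fix \<omega>
    have "exp (t * \<bar>Y \<omega>\<bar>) \<le> exp (t * Y \<omega>) + exp (- t * Y \<omega>)"
      by (cases "Y \<omega> \<ge> 0") auto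
    from ennreal_leI[OF this]
    show "ennreal (exp (t * \<bar>Y \<omega>\<bar>)) \<le> ennreal (exp (t * Y \<omega>)) + ennreal (exp ((- t) * Y \<omega>))"
      by simp
  qed
  also have "\<dots> = (\<integral>\<^sup>+\<omega>. ennreal (exp (t * Y \<omega>)) \<partial>M) + (\<integral>\<^sup>+\<omega>. ennreal (exp ((- t) * Y \<omega>)) \<partial>M)"
    by (intro nn_integral_add) auto
  also have "\<dots> = ennreal (2 * exp (t\<^sup>2 * (\<Sum>k\<in>S. (a k)\<^sup>2) / 2))"
    unfolding m by (subst ennreal_plus[symmetric]) auto
  finally show ?thesis unfolding Y_def .
qed

text \<open>Derived from exponential moments: \<open>y\<^sup>2 \<le> 2 * exp y\<close> at
  \<open>y = \<bar>Y\<bar> / sqrt v\<close> gives \<open>4 * v * exp (1 / 2)\<close>, and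
  \<open>exp (1 / 2) \<le> 2\<close> explains the 8.\<close>

lemma gaussian_second_moment:
  assumes "finite S"
  shows "(\<integral>\<^sup>+\<omega>. ennreal ((\<Sum>k\<in>S. a k * xi k \<omega>)\<^sup>2) \<partial>M) \<le> ennreal (8 * (\<Sum>k\<in>S. (a k)\<^sup>2))"
proof (cases "(\<Sum>k\<in>S. (a k)\<^sup>2) = 0")
  case True
  then have "\<forall>k\<in>S. a k = 0" using assms by (subst (asm) sum_nonneg_eq_0_iff) auto
  then show ?thesis by simp
next
  case False
  define v where "v = (\<Sum>k\<in>S. (a k)\<^sup>2)"
  have v: "v > 0" using False sum_nonneg[of S "\<lambda>k. (a k)\<^sup>2"] unfolding v_def by auto
  define Y where "Y \<omega> = (\<Sum>k\<in>S. a k * xi k \<omega>)" for \<omega>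
  have Y [measurable]: "Y \<in> borel_measurable M" unfolding Y_def by measurable
  have "(\<integral>\<^sup>+\<omega>. ennreal ((Y \<omega>)\<^sup>2) \<partial>M) \<le> (\<integral>\<^sup>+\<omega>. ennreal (2 * v) * ennreal (exp (1 / sqrt v * \<bar>Y \<omega>\<bar>)) \<partial>M)"
  proof (rule nn_integral_mono)
    fix \<omega>
    define y where "y = 1 / sqrt v * \<bar>Y \<omega>\<bar>"
    have "1 + y + y\<^sup>2 / 2 \<le> exp y"
      by (rule exp_lower_Taylor_quadratic) (use v in \<open>simp add: y_def\<close>)
    moreover have "0 \<le> y" using v unfolding y_def by simp
    ultimately have "y\<^sup>2 \<le> 2 * exp y" by linarith
    then have "v * y\<^sup>2 \<le> v * (2 * exp y)" using v by (intro mult_left_mono) auto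
    moreover have "v * y\<^sup>2 = (Y \<omega>)\<^sup>2"
      unfolding y_def using v by (simp add: power_divide)
    ultimately have "(Y \<omega>)\<^sup>2 \<le> (2 * v) * exp y" by simp
    then show "ennreal ((Y \<omega>)\<^sup>2) \<le> ennreal (2 * v) * ennreal (exp (1 / sqrt v * \<bar>Y \<omega>\<bar>))"
      unfolding y_def[symmetric] using v by (subst ennreal_mult[symmetric]) (auto intro: ennreal_leI)
  qed
  also have "\<dots> = ennreal (2 * v) * (\<integral>\<^sup>+\<omega>. ennreal (exp (1 / sqrt v * \<bar>Y \<omega>\<bar>)) \<partial>M)"
    by (intro nn_integral_cmult) auto
  also have "\<dots> \<le> ennreal (2 * v) * ennreal (2 * exp ((1 / sqrt v)\<^sup>2 * v / 2))"
    unfolding Y_def v_def by (intro mult_left_mono gaussian_exp_abs assms) simp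
  also have "(1 / sqrt v)\<^sup>2 * v / 2 = 1 / 2" using v by (simp add: power_divide)
  also have "ennreal (2 * v) * ennreal (2 * exp (1 / 2)) = ennreal (2 * v * (2 * exp (1 / 2)))"
    using v by (intro ennreal_mult[symmetric]) auto
  also have "\<dots> \<le> ennreal (8 * v)"
    using exp_half_le2 v by (intro ennreal_leI) auto
  finally show ?thesis unfolding Y_def v_def .
qed

end

section \<open>Exponential moments\<close>

context galerkin_basis
begin

definition field :: "(nat \<Rightarrow> 'k \<Rightarrow> 'w \<Rightarrow> real) \<Rightarrow> nat \<Rightarrow> 'w \<Rightarrow> 'x \<Rightarrow> real" where
  "field c n \<omega> = trig n (\<lambda>k. c n k \<omega>)"

definition exp_moment :: "real \<Rightarrow> ('x \<Rightarrow> real) \<Rightarrow> real" where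
  "exp_moment a t = (\<integral>x. exp (a * \<bar>t x\<bar>) \<partial>Q)"

text \<open>The limit \<open>v\<close> is not assumed to be measurable in \<open>\<omega>\<close>, hence the measurable version \<open>d\<close> of the error.\<close>

definition approximates ::
  "'w measure \<Rightarrow> 'w measure \<Rightarrow> (nat \<Rightarrow> 'k \<Rightarrow> 'w \<Rightarrow> real) \<Rightarrow> ('w \<Rightarrow> 'x \<Rightarrow> real) \<Rightarrow> bool" where
  "approximates M F c v \<longleftrightarrow>
     (\<forall>n k. c n k \<in> borel_measurable F) \<and> (AE \<omega> in M. ess_bounded Q (v \<omega>)) \<and>
     (\<forall>a. prob_space.tight_family M (\<lambda>n \<omega>. exp_moment a (field c n \<omega>))) \<and>
     (\<exists>d. (\<forall>n. d n \<in> borel_measurable M) \<and>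
        (AE \<omega> in M. \<forall>n. d n \<omega> = (\<integral>x. (field c n \<omega> x - v \<omega> x)\<^sup>2 \<partial>Q)) \<and>
        prob_space.null_in_prob M (\<lambda>n \<omega>. ennreal (d n \<omega>)))"

lemma ess_bounded_field [intro, simp]: "ess_bounded Q (field c n \<omega>)"
  unfolding field_def by simp

lemma ess_bounded_exp:
  "ess_bounded Q t \<Longrightarrow> ess_bounded Q (\<lambda>x. exp (a * \<bar>t x\<bar>))"
  by (rule ess_bounded_compose[where h = "\<lambda>s. exp (a * \<bar>s\<bar>)"]) (auto intro!: continuous_intros)

lemma field_measurable:
  assumes "\<And>n k. c n k \<in> borel_measurable N"
  shows "(\<lambda>p. field c n (fst p) (snd p)) \<in> borel_measurable (N \<Otimes>\<^sub>M Q)"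
proof -
  note [measurable] = assms
  show ?thesis unfolding field_def trig_def by measurable
qed

lemma exp_moment_measurable:
  assumes "\<And>n k. c n k \<in> borel_measurable N"
  shows "(\<lambda>\<omega>. exp_moment a (field c n \<omega>)) \<in> borel_measurable N"
proof -
  note [measurable] = field_measurable[OF assms]
  have "(\<lambda>\<omega>. \<integral>x. exp (a * \<bar>field c n (fst (\<omega>, x)) (snd (\<omega>, x))\<bar>) \<partial>Q) \<in> borel_measurable N"
    by (rule Q.borel_measurable_lebesgue_integral) (simp add: case_prod_beta')
  then show ?thesis unfolding exp_moment_def by simp
qed

lemma exp_moment_ge_1:
  assumes t: "ess_bounded Q t" and a: "0 \<le> a"
  shows "1 \<le> exp_moment a t"
proof -
  have "(\<integral>x. 1 \<partial>Q) \<le> exp_moment a t"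
    unfolding exp_moment_def using a
    by (intro integral_mono Q.ess_bounded_integrable ess_bounded_exp t ess_bounded_const) auto
  then show ?thesis by (simp add: Q.prob_space)
qed

lemma exp_moment_mono:
  assumes t: "ess_bounded Q t" and a: "a \<le> a'"
  shows "exp_moment a t \<le> exp_moment a' t"
  unfolding exp_moment_def using a
  by (intro integral_mono Q.ess_bounded_integrable ess_bounded_exp t) (auto intro: mult_right_mono)

lemma integral_power_le_exp_moment:
  assumes t: "ess_bounded Q t" and h: "ess_bounded Q h" and b: "0 \<le> b" and K: "0 \<le> K"
    and le: "\<And>x. \<bar>h x\<bar> \<le> K * exp (b * \<bar>t x\<bar>)"
    and p: "real p * b \<le> a"
  shows "(\<integral>x. \<bar>h x\<bar> ^ p \<partial>Q) \<le> K ^ p * exp_moment a t"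
proof -
  have "(\<integral>x. \<bar>h x\<bar> ^ p \<partial>Q) \<le> (\<integral>x. K ^ p * exp (a * \<bar>t x\<bar>) \<partial>Q)"
  proof (intro integral_mono Q.ess_bounded_integrable bdd_intros h ess_bounded_exp t)
    fix x
    have "\<bar>h x\<bar> ^ p \<le> (K * exp (b * \<bar>t x\<bar>)) ^ p"
      by (intro power_mono le) simp
    also have "\<dots> = K ^ p * exp (real p * b * \<bar>t x\<bar>)"
      by (simp add: power_mult_distrib exp_of_nat_mult[symmetric] mult.assoc)
    also have "\<dots> \<le> K ^ p * exp (a * \<bar>t x\<bar>)"
      using p K by (intro mult_left_mono) (auto intro: mult_right_mono)
    finally show "\<bar>h x\<bar> ^ p \<le> K ^ p * exp (a * \<bar>t x\<bar>)" .
  qed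
  then show ?thesis unfolding exp_moment_def by simp
qed

text \<open>The bounded function \<open>v\<close> contributes a constant factor, and Cauchy-Schwarz
  separates the difference from the exponential of \<open>t\<close>, which doubles the rate. The
  squared form keeps square roots out of the later limits.\<close>

lemma integral_locally_lipschitz:
  assumes t: "ess_bounded Q t" and v: "ess_bounded Q v" "AE x in Q. \<bar>v x\<bar> \<le> U"
    and h: "ess_bounded Q h" and K: "0 \<le> K" and a: "0 \<le> a"
    and le: "AE x in Q. \<bar>h x\<bar> \<le> K * \<bar>t x - v x\<bar> * exp (a * (\<bar>t x\<bar> + \<bar>v x\<bar>))"
  shows "(\<integral>x. \<bar>h x\<bar> \<partial>Q)\<^sup>2 \<le> (K * exp (a * U))\<^sup>2 * ((\<integral>x. (t x - v x)\<^sup>2 \<partial>Q) * exp_moment (2 * a) t)"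
proof -
  have "(\<integral>x. \<bar>h x\<bar> \<partial>Q) \<le> (\<integral>x. (K * exp (a * U)) * (\<bar>t x - v x\<bar> * exp (a * \<bar>t x\<bar>)) \<partial>Q)"
  proof (intro integral_mono_AE Q.ess_bounded_integrable bdd_intros h ess_bounded_exp t v)
    show "AE x in Q. \<bar>h x\<bar> \<le> (K * exp (a * U)) * (\<bar>t x - v x\<bar> * exp (a * \<bar>t x\<bar>))"
      using v(2) le
    proof eventually_elim
      case (elim x)
      have "exp (a * (\<bar>t x\<bar> + \<bar>v x\<bar>)) \<le> exp (a * \<bar>t x\<bar>) * exp (a * U)"
        unfolding exp_add[symmetric] distrib_left using elim(1) a by (auto intro: mult_left_mono)
      then have "K * \<bar>t x - v x\<bar> * exp (a * (\<bar>t x\<bar> + \<bar>v x\<bar>)) \<le> K * \<bar>t x - v x\<bar> * (exp (a * \<bar>t x\<bar>) * exp (a * U))"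
        using K by (intro mult_left_mono) auto
      with elim(2) show ?case by (simp add: mult_ac)
    qed
  qed
  then have "(\<integral>x. \<bar>h x\<bar> \<partial>Q)\<^sup>2 \<le> ((K * exp (a * U)) * (\<integral>x. \<bar>t x - v x\<bar> * exp (a * \<bar>t x\<bar>) \<partial>Q))\<^sup>2"
    by (intro power_mono) auto
  also have "\<dots> = (K * exp (a * U))\<^sup>2 * (\<integral>x. \<bar>t x - v x\<bar> * exp (a * \<bar>t x\<bar>) \<partial>Q)\<^sup>2"
    by (rule power_mult_distrib)
  also have "\<dots> \<le> (K * exp (a * U))\<^sup>2 * ((\<integral>x. \<bar>t x - v x\<bar>\<^sup>2 \<partial>Q) * (\<integral>x. (exp (a * \<bar>t x\<bar>))\<^sup>2 \<partial>Q))"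
    by (intro mult_left_mono Q.integral_Cauchy_Schwarz bdd_intros ess_bounded_exp t v) simp
  also have "(\<integral>x. (exp (a * \<bar>t x\<bar>))\<^sup>2 \<partial>Q) = exp_moment (2 * a) t"
    unfolding exp_moment_def by (simp add: exp_double[symmetric] mult.assoc)
  finally show ?thesis by simp
qed

lemma abs_exp_diff_le:
  fixes p q :: real
  assumes "0 \<le> p" "0 \<le> q"
  shows "\<bar>exp p - exp q\<bar> \<le> \<bar>p - q\<bar> * exp (p + q)"
proof -
  have *: "exp y - exp x \<le> (y - x) * exp (x + y)" if "0 \<le> x" "x \<le> y" for x y :: real
  proof -
    have "1 + (x - y) \<le> exp (x - y)" by (rule exp_ge_add_one_self)
    then have "exp y * (1 + (x - y)) \<le> exp y * exp (x - y)" by (intro mult_left_mono) auto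
    then have "exp y - exp x \<le> (y - x) * exp y" by (simp add: exp_diff algebra_simps)
    also have "\<dots> \<le> (y - x) * exp (x + y)" using that by (intro mult_left_mono) auto
    finally show ?thesis .
  qed
  show ?thesis
    using *[of p q] *[of q p] assms by (cases "p \<le> q") (auto simp: add.commute)
qed

text \<open>Near a bounded function the exponential moment is at most a constant plus a multiple of
  the error times a moment of twice the rate. When that product tends to zero along a subsequence,
  the moment is bounded along it; this is how boundedness in probability becomes almost sure
  boundedness.\<close>

lemma exp_moment_close:
  assumes t: "ess_bounded Q t" and v: "ess_bounded Q v" "AE x in Q. \<bar>v x\<bar> \<le> U" and a: "0 \<le> a"
  shows "exp_moment a t \<le> exp (a * U) + 1 + (a * exp (a * U))\<^sup>2 * ((\<integral>x. (t x - v x)\<^sup>2 \<partial>Q) * exp_moment (2 * a) t)"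
proof -
  define h where "h x = exp (a * \<bar>t x\<bar>) - exp (a * \<bar>v x\<bar>)" for x
  have h: "ess_bounded Q h" unfolding h_def by (intro bdd_intros ess_bounded_exp t v)
  have "(\<integral>x. \<bar>h x\<bar> \<partial>Q)\<^sup>2 \<le> (a * exp (a * U))\<^sup>2 * ((\<integral>x. (t x - v x)\<^sup>2 \<partial>Q) * exp_moment (2 * a) t)"
  proof (rule integral_locally_lipschitz[OF t v h a a])
    show "AE x in Q. \<bar>h x\<bar> \<le> a * \<bar>t x - v x\<bar> * exp (a * (\<bar>t x\<bar> + \<bar>v x\<bar>))"
    proof (rule AE_I2)
      fix x
      have "\<bar>h x\<bar> \<le> \<bar>a * \<bar>t x\<bar> - a * \<bar>v x\<bar>\<bar> * exp (a * \<bar>t x\<bar> + a * \<bar>v x\<bar>)"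
        unfolding h_def using a by (intro abs_exp_diff_le) auto
      also have "\<bar>a * \<bar>t x\<bar> - a * \<bar>v x\<bar>\<bar> \<le> a * \<bar>t x - v x\<bar>"
        using a by (auto simp: right_diff_distrib[symmetric] abs_mult intro: mult_left_mono)
      finally show "\<bar>h x\<bar> \<le> a * \<bar>t x - v x\<bar> * exp (a * (\<bar>t x\<bar> + \<bar>v x\<bar>))"
        by (simp add: distrib_left mult_right_mono)
    qed
  qed
  \<comment> \<open>Removes the square of the previous estimate without a square root.\<close>
  moreover have "y \<le> 1 + y\<^sup>2" for y :: real
    using power2_sum_le[of 1 y] sum_squares_bound[of 1 y] by (cases "y \<le> 1") (auto simp: power2_eq_square intro: add_increasing2)
  ultimately have 1: "(\<integral>x. \<bar>h x\<bar> \<partial>Q) \<le> 1 + (a * exp (a * U))\<^sup>2 * ((\<integral>x. (t x - v x)\<^sup>2 \<partial>Q) * exp_moment (2 * a) t)"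
    by (meson add_left_mono order_trans)
  have "exp_moment a t \<le> (\<integral>x. exp (a * U) + \<bar>h x\<bar> \<partial>Q)"
    unfolding exp_moment_def
  proof (intro integral_mono_AE Q.ess_bounded_integrable bdd_intros h ess_bounded_exp t)
    show "AE x in Q. exp (a * \<bar>t x\<bar>) \<le> exp (a * U) + \<bar>h x\<bar>"
      using v(2)
    proof eventually_elim
      case (elim x)
      then have "exp (a * \<bar>v x\<bar>) \<le> exp (a * U)" using a by (auto intro: mult_left_mono)
      then show ?case unfolding h_def by linarith
    qed
  qed
  also have "\<dots> = exp (a * U) + (\<integral>x. \<bar>h x\<bar> \<partial>Q)"
    by (subst Bochner_Integration.integral_add)
      (auto intro!: Q.ess_bounded_integrable bdd_intros h simp: Q.prob_space)
  finally show ?thesis using 1 by linarith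
qed

end

text \<open>\<open>kV\<close> and \<open>kS\<close> stand for \<open>\<kappa>\<^sup>2\<close> and
  the power \<open>\<nu>\<close> of \<open>\<kappa>\<close>. One pair \<open>K\<close>,
  \<open>b\<close> bounds growth and local Lipschitz constants of both and the reciprocal of
  \<open>kV\<close>, so that all moments have a common rate.\<close>

locale layer = galerkin_basis Q B psi lam z0 Lam CK + independent_noise M F G xi
  for Q :: "'x measure" and B :: "nat \<Rightarrow> 'k set" and psi :: "'k \<Rightarrow> 'x \<Rightarrow> real" and lam :: "'k \<Rightarrow> real"
    and z0 :: 'k and Lam CK :: real
    and M :: "'w measure" and F G :: "'w measure" and xi :: "'k \<Rightarrow> 'w \<Rightarrow> real" +
  fixes kV kS :: "real \<Rightarrow> real" and K b :: real
  assumes K_ge: "1 \<le> K" and b_pos: "0 < b"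
    and kV_pos: "\<And>t. kV t > 0" and kV_cont: "continuous_on UNIV kV" and kS_cont: "continuous_on UNIV kS"
    and kV_le: "\<And>t. kV t \<le> K * exp (b * \<bar>t\<bar>)" and inv_kV_le: "\<And>t. 1 / kV t \<le> K * exp (b * \<bar>t\<bar>)"
    and kS_le: "\<And>t. \<bar>kS t\<bar> \<le> K * exp (b * \<bar>t\<bar>)"
    and kV_lipschitz: "\<And>s t. \<bar>kV s - kV t\<bar> \<le> K * \<bar>s - t\<bar> * exp (b * (\<bar>s\<bar> + \<bar>t\<bar>))"
    and kS_lipschitz: "\<And>s t. \<bar>kS s - kS t\<bar> \<le> K * \<bar>s - t\<bar> * exp (b * (\<bar>s\<bar> + \<bar>t\<bar>))"
begin

lemma kV_measurable [measurable]: "kV \<in> borel_measurable borel"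
  using kV_cont by (rule borel_measurable_continuous_onI)

lemma kS_measurable [measurable]: "kS \<in> borel_measurable borel"
  using kS_cont by (rule borel_measurable_continuous_onI)

lemma ess_bounded_kV: "ess_bounded Q t \<Longrightarrow> ess_bounded Q (\<lambda>x. kV (t x))"
  by (rule ess_bounded_compose[OF _ kV_cont])

lemma ess_bounded_kS: "ess_bounded Q t \<Longrightarrow> ess_bounded Q (\<lambda>x. kS (t x))"
  by (rule ess_bounded_compose[OF _ kS_cont])

lemma ess_bounded_inv_kV: "ess_bounded Q t \<Longrightarrow> ess_bounded Q (\<lambda>x. 1 / kV (t x))"
  using kV_pos by (intro ess_bounded_compose[where h = "\<lambda>t. 1 / kV t"] continuous_intros kV_cont)
    (auto simp: less_imp_neq[symmetric])

text \<open>\<open>K\<^sup>2\<close> covers the factor \<open>K\<close> from \<open>1 / V\<close>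
  and the factor \<open>K\<^sup>2\<close> from \<open>V\<^sup>2\<close>; the maximum provides
  \<open>1 \<le> A\<close>.\<close>

definition admissible_bound :: "real \<Rightarrow> real" where
  "admissible_bound R = K\<^sup>2 * max 1 R"

lemma admissible_bound_ge: "1 \<le> admissible_bound R"
proof -
  have "1 * 1 \<le> K\<^sup>2 * max 1 R" using K_ge by (intro mult_mono) auto
  then show ?thesis unfolding admissible_bound_def by simp
qed

lemma admissible_kV:
  assumes t: "ess_bounded Q t" and R: "exp_moment (28 * b) t \<le> R"
  shows "admissible (admissible_bound R) (\<lambda>x. kV (t x))"
proof -
  have K0: "0 \<le> K" "0 \<le> b" using K_ge b_pos by auto
  have e0: "0 \<le> exp_moment (28 * b) t" unfolding exp_moment_def by simp
  have "(\<integral>x. \<bar>1 / kV (t x)\<bar> ^ 1 \<partial>Q) \<le> K ^ 1 * exp_moment (28 * b) t"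
    using inv_kV_le kV_pos K0
    by (intro integral_power_le_exp_moment[OF t, where b=b] ess_bounded_inv_kV t) (auto simp: less_imp_le)
  also have "\<dots> \<le> K\<^sup>2 * max 1 R"
    using K_ge R e0 by (intro mult_mono) (auto simp: power2_eq_square)
  finally have 1: "(\<integral>x. 1 / kV (t x) \<partial>Q) \<le> admissible_bound R"
    using kV_pos unfolding admissible_bound_def by (simp add: less_imp_le)
  have "(\<integral>x. \<bar>kV (t x)\<bar> ^ 2 \<partial>Q) \<le> K ^ 2 * exp_moment (28 * b) t"
    using kV_le kV_pos K0
    by (intro integral_power_le_exp_moment[OF t, where b=b] ess_bounded_kV t) (auto simp: less_imp_le)
  also have "\<dots> \<le> K\<^sup>2 * max 1 R" using K0 R by (intro mult_left_mono) auto
  finally have 2: "(\<integral>x. (kV (t x))\<^sup>2 \<partial>Q) \<le> admissible_bound R"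
    unfolding admissible_bound_def by simp
  show ?thesis
    unfolding admissible_def using 1 2 kV_pos admissible_bound_ge ess_bounded_kV[OF t] ess_bounded_inv_kV[OF t] by simp
qed

lemma integral_kS_power:
  assumes t: "ess_bounded Q t" and p: "even p" "p \<le> 28"
  shows "(\<integral>x. kS (t x) ^ p \<partial>Q) \<le> K ^ p * exp_moment (28 * b) t"
proof -
  have "(\<integral>x. \<bar>kS (t x)\<bar> ^ p \<partial>Q) \<le> K ^ p * exp_moment (28 * b) t"
    using kS_le K_ge b_pos p
    by (intro integral_power_le_exp_moment[OF t, where b=b] ess_bounded_kS t) auto
  then show ?thesis using p(1) by (simp add: power_even_abs)
qed

lemma integral_one_minus_kV_power:
  assumes t: "ess_bounded Q t"
  shows "(\<integral>x. (1 - kV (t x)) ^ 14 \<partial>Q) \<le> (2 * K) ^ 14 * exp_moment (28 * b) t"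
proof -
  have "\<bar>1 - kV s\<bar> \<le> (2 * K) * exp (b * \<bar>s\<bar>)" for s
  proof -
    have "1 * 1 \<le> K * exp (b * \<bar>s\<bar>)" using K_ge b_pos by (intro mult_mono) auto
    then show ?thesis using kV_le[of s] kV_pos[of s] by (auto simp: abs_le_iff)
  qed
  then have "(\<integral>x. \<bar>1 - kV (t x)\<bar> ^ 14 \<partial>Q) \<le> (2 * K) ^ 14 * exp_moment (28 * b) t"
    using K_ge b_pos
    by (intro integral_power_le_exp_moment[OF t, where b=b] bdd_intros ess_bounded_kV t) auto
  then show ?thesis by (simp add: power_even_abs)
qed

lemma kV_close:
  assumes t: "ess_bounded Q t" and v: "ess_bounded Q v" "AE x in Q. \<bar>v x\<bar> \<le> U"
  shows "(\<integral>x. \<bar>kV (t x) - kV (v x)\<bar> \<partial>Q)\<^sup>2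
    \<le> (K * exp (b * U))\<^sup>2 * ((\<integral>x. (t x - v x)\<^sup>2 \<partial>Q) * exp_moment (28 * b) t)"
proof -
  have "(\<integral>x. \<bar>kV (t x) - kV (v x)\<bar> \<partial>Q)\<^sup>2
    \<le> (K * exp (b * U))\<^sup>2 * ((\<integral>x. (t x - v x)\<^sup>2 \<partial>Q) * exp_moment (2 * b) t)"
    using K_ge b_pos kV_lipschitz
    by (intro integral_locally_lipschitz[OF t v] bdd_intros ess_bounded_kV t v) auto
  also have "\<dots> \<le> (K * exp (b * U))\<^sup>2 * ((\<integral>x. (t x - v x)\<^sup>2 \<partial>Q) * exp_moment (28 * b) t)"
    using b_pos by (intro mult_left_mono exp_moment_mono t) auto
  finally show ?thesis .
qed

text \<open>One factor of the square is estimated by the Lipschitz bound and the other by growth.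
  This makes the square itself locally Lipschitz and brings it under
  \<open>integral_locally_lipschitz\<close>, which is why its integral appears squared once
  more.\<close>

lemma kS_close:
  assumes t: "ess_bounded Q t" and v: "ess_bounded Q v" "AE x in Q. \<bar>v x\<bar> \<le> U"
  shows "(\<integral>x. (kS (v x) - kS (t x))\<^sup>2 \<partial>Q)\<^sup>2
    \<le> (2 * K\<^sup>2 * exp (2 * b * U))\<^sup>2 * ((\<integral>x. (t x - v x)\<^sup>2 \<partial>Q) * exp_moment (28 * b) t)"
proof -
  have K0: "0 \<le> K" "0 \<le> b" using K_ge b_pos by auto
  have le: "\<bar>(kS s - kS r)\<^sup>2\<bar> \<le> 2 * K\<^sup>2 * \<bar>r - s\<bar> * exp (2 * b * (\<bar>r\<bar> + \<bar>s\<bar>))" for r s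
  proof -
    have 1: "\<bar>kS s - kS r\<bar> \<le> K * \<bar>r - s\<bar> * exp (b * (\<bar>r\<bar> + \<bar>s\<bar>))"
      using kS_lipschitz[of r s] by (simp add: abs_minus_commute)
    have "\<bar>kS s - kS r\<bar> \<le> K * exp (b * \<bar>s\<bar>) + K * exp (b * \<bar>r\<bar>)"
      using kS_le[of s] kS_le[of r] by linarith
    also have "\<dots> \<le> K * exp (b * (\<bar>r\<bar> + \<bar>s\<bar>)) + K * exp (b * (\<bar>r\<bar> + \<bar>s\<bar>))"
      using K0 by (intro add_mono mult_left_mono) (auto intro: mult_left_mono)
    finally have 2: "\<bar>kS s - kS r\<bar> \<le> 2 * K * exp (b * (\<bar>r\<bar> + \<bar>s\<bar>))" by simp
    have "\<bar>(kS s - kS r)\<^sup>2\<bar> = \<bar>kS s - kS r\<bar> * \<bar>kS s - kS r\<bar>" by (simp add: power2_eq_square)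
    also have "\<dots> \<le> (K * \<bar>r - s\<bar> * exp (b * (\<bar>r\<bar> + \<bar>s\<bar>))) * (2 * K * exp (b * (\<bar>r\<bar> + \<bar>s\<bar>)))"
      using K0 by (intro mult_mono 1 2) auto
    also have "\<dots> = 2 * K\<^sup>2 * \<bar>r - s\<bar> * exp (2 * b * (\<bar>r\<bar> + \<bar>s\<bar>))"
      by (simp add: power2_eq_square mult.assoc exp_double[of "b * (\<bar>r\<bar> + \<bar>s\<bar>)"])
    finally show ?thesis .
  qed
  have "(\<integral>x. \<bar>(kS (v x) - kS (t x))\<^sup>2\<bar> \<partial>Q)\<^sup>2
    \<le> (2 * K\<^sup>2 * exp ((2 * b) * U))\<^sup>2 * ((\<integral>x. (t x - v x)\<^sup>2 \<partial>Q) * exp_moment (2 * (2 * b)) t)"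
    using K0 le by (intro integral_locally_lipschitz[OF t v] bdd_intros ess_bounded_kS t v) auto
  also have "\<dots> \<le> (2 * K\<^sup>2 * exp (2 * b * U))\<^sup>2 * ((\<integral>x. (t x - v x)\<^sup>2 \<partial>Q) * exp_moment (28 * b) t)"
    using b_pos by (intro mult_left_mono exp_moment_mono t) auto
  finally show ?thesis by simp
qed

end

section \<open>One layer: tightness\<close>

context galerkin_basis
begin

lemma CK_nonneg: "0 \<le> CK"
  using kernel_bound[of "\<lambda>_. 0" undefined undefined] ess_bounded_const[of Q 0] by simp

lemma integral_param_measurable:
  fixes h :: "'w \<times> 'x \<Rightarrow> real"
  assumes "h \<in> borel_measurable (N \<Otimes>\<^sub>M Q)"
  shows "(\<lambda>\<omega>. \<integral>x. h (\<omega>, x) \<partial>Q) \<in> borel_measurable N"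
  by (rule Q.borel_measurable_lebesgue_integral) (use assms in \<open>simp add: case_prod_beta'\<close>)

lemma galerkin_unique:
  assumes V: "admissible A V" and "galerkin_eq n V f c" "galerkin_eq n V f d" and k: "k \<in> B n"
  shows "c k = d k"
proof -
  have V': "ess_bounded Q V" "1 \<le> A" using V unfolding admissible_def by auto
  have "galerkin_eq n V (\<lambda>_. 0) (\<lambda>k. c k - d k)"
    unfolding galerkin_eq_def
  proof
    fix j assume j: "j \<in> B n"
    have "coeff (\<lambda>x. V x * trig n (\<lambda>k. c k - d k) x) j
        = coeff (\<lambda>x. V x * trig n c x) j - coeff (\<lambda>x. V x * trig n d x) j"
      by (subst coeff_diff[symmetric]) (auto intro!: bdd_intros V' simp: trig_diff algebra_simps)
    then show "lam j * (c j - d j) + coeff (\<lambda>x. V x * trig n (\<lambda>k. c k - d k) x) j = 0"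
      using assms(2,3)[unfolded galerkin_eq_def, rule_format, OF j] by (simp add: algebra_simps)
  qed
  then have gal: "galerkin_eq n V (\<lambda>_. 0) (\<lambda>k. c k - d k)" .
  obtain C where "0 \<le> C" and C: "\<And>n V f c. admissible A V \<Longrightarrow> galerkin_eq n V f c \<Longrightarrow>
       (\<Sum>k\<in>B n. (c k)\<^sup>2) \<le> C * (\<Sum>k\<in>B n. (f k)\<^sup>2 / (1 + lam k)\<^sup>2)"
    using galerkin_estimate[OF V'(2)] by blast
  have "(\<Sum>k\<in>B n. (c k - d k)\<^sup>2) \<le> 0"
    using C[OF V gal] by simp
  then have "(\<Sum>k\<in>B n. (c k - d k)\<^sup>2) = 0"
    by (intro antisym sum_nonneg) auto
  then show ?thesis using k by (subst (asm) sum_nonneg_eq_0_iff) (auto simp: finite_B)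
qed

end

context layer
begin

text \<open>The expected squared \<open>H\<^sup>-\<^sup>2\<close> norm for a frozen matrix
  \<open>a\<close>. Linearity in \<open>j\<close> reduces it to second moments, so no covariance
  between test modes appears.\<close>

lemma conditional_residual:
  assumes "finite J" "finite S"
  shows "(\<integral>\<^sup>+\<omega>. ennreal (\<Sum>j\<in>J. (\<Sum>k\<in>S. a k j * xi k \<omega>)\<^sup>2 / (1 + lam j)\<^sup>2) \<partial>M)
    \<le> ennreal (8 * (\<Sum>j\<in>J. (\<Sum>k\<in>S. (a k j)\<^sup>2) / (1 + lam j)\<^sup>2))"
proof -
  have "(\<integral>\<^sup>+\<omega>. ennreal (\<Sum>j\<in>J. (\<Sum>k\<in>S. a k j * xi k \<omega>)\<^sup>2 / (1 + lam j)\<^sup>2) \<partial>M)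
      = (\<integral>\<^sup>+\<omega>. (\<Sum>j\<in>J. ennreal (1 / (1 + lam j)\<^sup>2) * ennreal ((\<Sum>k\<in>S. a k j * xi k \<omega>)\<^sup>2)) \<partial>M)"
    by (subst sum_ennreal[symmetric]) (auto simp: ennreal_mult[symmetric])
  also have "\<dots> = (\<Sum>j\<in>J. ennreal (1 / (1 + lam j)\<^sup>2) * (\<integral>\<^sup>+\<omega>. ennreal ((\<Sum>k\<in>S. a k j * xi k \<omega>)\<^sup>2) \<partial>M))"
    by (subst nn_integral_sum) (auto intro!: sum.cong nn_integral_cmult)
  also have "\<dots> \<le> (\<Sum>j\<in>J. ennreal (1 / (1 + lam j)\<^sup>2) * ennreal (8 * (\<Sum>k\<in>S. (a k j)\<^sup>2)))"
    by (intro sum_mono mult_left_mono gaussian_second_moment assms) simp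
  also have "\<dots> = (\<Sum>j\<in>J. ennreal (1 / (1 + lam j)\<^sup>2 * (8 * (\<Sum>k\<in>S. (a k j)\<^sup>2))))"
    by (intro sum.cong refl ennreal_mult[symmetric] mult_nonneg_nonneg sum_nonneg) auto
  also have "\<dots> = ennreal (\<Sum>j\<in>J. 1 / (1 + lam j)\<^sup>2 * (8 * (\<Sum>k\<in>S. (a k j)\<^sup>2)))"
    by (intro sum_ennreal mult_nonneg_nonneg sum_nonneg) auto
  also have "(\<Sum>j\<in>J. 1 / (1 + lam j)\<^sup>2 * (8 * (\<Sum>k\<in>S. (a k j)\<^sup>2))) = 8 * (\<Sum>j\<in>J. (\<Sum>k\<in>S. (a k j)\<^sup>2) / (1 + lam j)\<^sup>2)"
    unfolding sum_distrib_left[of 8 _ J] by (intro sum.cong refl) simp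
  finally show ?thesis .
qed

end

text \<open>\<open>c\<close> and \<open>v\<close> describe the layer below, \<open>g\<close> and
  \<open>u\<close> the new one. \<open>g\<close> and \<open>u\<close> satisfy their equations only
  almost surely and are not assumed measurable in \<open>\<omega>\<close>; \<open>F'\<close>
  contains the information of the lower layers and of the new noise.\<close>

locale layer_step = layer Q B psi lam z0 Lam CK M F G xi kV kS K b
  for Q :: "'x measure" and B :: "nat \<Rightarrow> 'k set" and psi :: "'k \<Rightarrow> 'x \<Rightarrow> real" and lam :: "'k \<Rightarrow> real"
    and z0 :: 'k and Lam CK :: real
    and M :: "'w measure" and F G :: "'w measure" and xi :: "'k \<Rightarrow> 'w \<Rightarrow> real"
    and kV kS :: "real \<Rightarrow> real" and K b :: real +
  fixes F' :: "'w measure" and c g :: "nat \<Rightarrow> 'k \<Rightarrow> 'w \<Rightarrow> real" and v u :: "'w \<Rightarrow> 'x \<Rightarrow> real"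
  assumes space_F': "space F' = space M" and F_le: "sets F \<subseteq> sets F'" and G_le: "sets G \<subseteq> sets F'"
    and F'_le: "sets F' \<subseteq> sets M"
    and approx: "approximates M F c v"
    and u_bdd: "AE \<omega> in M. ess_bounded Q (u \<omega>)"
    and galerkin_g: "AE \<omega> in M. \<forall>n. galerkin_eq n (\<lambda>x. kV (field c n \<omega> x))
        (\<lambda>j. \<Sum>k\<in>B n. noise_matrix (\<lambda>x. kS (field c n \<omega> x)) k j * xi k \<omega>) (\<lambda>k. g n k \<omega>)"
    and weak_u: "AE \<omega> in M. \<forall>j. (\<lambda>n. \<Sum>k\<in>B n. noise_matrix (\<lambda>x. kS (v \<omega> x)) k j * xi k \<omega>)
        \<longlonglongrightarrow> lam j * coeff (u \<omega>) j + coeff (\<lambda>x. kV (v \<omega> x) * u \<omega> x) j"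
begin

lemma c_measurable: "c n k \<in> borel_measurable F"
  using approx unfolding approximates_def by blast

lemma v_bdd: "AE \<omega> in M. ess_bounded Q (v \<omega>)"
  using approx unfolding approximates_def by blast

lemma tight_c: "tight_family (\<lambda>n \<omega>. exp_moment a (field c n \<omega>))"
  using approx unfolding approximates_def by blast

lemma F'_measurable_F: "f \<in> borel_measurable F \<Longrightarrow> f \<in> borel_measurable F'"
  using space_F space_F' F_le by (auto simp: measurable_def)

lemma F'_measurable_G: "f \<in> borel_measurable G \<Longrightarrow> f \<in> borel_measurable F'"
  using space_G space_F' G_le by (auto simp: measurable_def)

lemma M_measurable_F': "f \<in> borel_measurable F' \<Longrightarrow> f \<in> borel_measurable M"
  using space_F' F'_le by (auto simp: measurable_def)

lemma field_c_measurable [measurable]: "(\<lambda>p. field c n (fst p) (snd p)) \<in> borel_measurable (F \<Otimes>\<^sub>M Q)"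
  by (rule field_measurable[OF c_measurable])

definition Vn :: "nat \<Rightarrow> 'w \<Rightarrow> 'x \<Rightarrow> real" where "Vn n \<omega> x = kV (field c n \<omega> x)"

definition Sn :: "nat \<Rightarrow> 'w \<Rightarrow> 'x \<Rightarrow> real" where "Sn n \<omega> x = kS (field c n \<omega> x)"

definition Xn :: "nat \<Rightarrow> 'w \<Rightarrow> real" where "Xn n \<omega> = exp_moment (28 * b) (field c n \<omega>)"

definition noise_n :: "nat \<Rightarrow> 'k \<Rightarrow> 'k \<Rightarrow> 'w \<Rightarrow> real" where
  "noise_n n k j \<omega> = noise_matrix (Sn n \<omega>) k j"

text \<open>Two samples: \<open>\<omega>\<close> drives the coefficient, \<open>\<omega>'\<close>
  the noise. The diagonal is the actual right-hand side, and freezing \<open>\<omega>\<close> leaves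
  linear forms in the Gaussian variables.\<close>

definition rhs_n :: "nat \<Rightarrow> 'w \<Rightarrow> 'w \<Rightarrow> 'k \<Rightarrow> real" where
  "rhs_n n \<omega> \<omega>' j = (\<Sum>k\<in>B n. noise_n n k j \<omega> * xi k \<omega>')"

lemma ess_bounded_Vn: "ess_bounded Q (Vn n \<omega>)"
  unfolding Vn_def by (intro ess_bounded_kV) simp

lemma ess_bounded_Sn: "ess_bounded Q (Sn n \<omega>)"
  unfolding Sn_def by (intro ess_bounded_kS) simp

lemma Xn_measurable [measurable]: "Xn n \<in> borel_measurable F"
  unfolding Xn_def by (rule exp_moment_measurable[OF c_measurable])

lemma Xn_ge: "1 \<le> Xn n \<omega>"
  unfolding Xn_def using b_pos by (intro exp_moment_ge_1) auto

lemma tight_Xn: "tight_family Xn"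
  unfolding Xn_def by (rule tight_c)

lemma admissible_Vn: "Xn n \<omega> \<le> R \<Longrightarrow> admissible (admissible_bound R) (Vn n \<omega>)"
  unfolding Vn_def Xn_def by (intro admissible_kV) auto

lemma noise_n_measurable [measurable]: "noise_n n k j \<in> borel_measurable F"
proof -
  have "(\<lambda>p. kS (field c n (fst p) (snd p)) * psi k (snd p) * psi j (snd p)) \<in> borel_measurable (F \<Otimes>\<^sub>M Q)"
    by measurable
  from integral_param_measurable[OF this] show ?thesis
    unfolding noise_n_def noise_matrix_def Sn_def by simp
qed

lemma galerkin_matrix_measurable: "(\<lambda>\<omega>. galerkin_matrix (Vn n \<omega>) j i) \<in> borel_measurable F"
proof -
  have "(\<lambda>p. kV (field c n (fst p) (snd p)) * psi i (snd p) * psi j (snd p)) \<in> borel_measurable (F \<Otimes>\<^sub>M Q)"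
    by measurable
  from integral_param_measurable[OF this] show ?thesis
    unfolding galerkin_matrix_def Vn_def by simp
qed

lemma rhs_n_measurable: "(\<lambda>p. rhs_n n (fst p) (snd p) j) \<in> borel_measurable (F \<Otimes>\<^sub>M G)"
proof -
  note [measurable] = xi_measurable
  show ?thesis unfolding rhs_n_def by measurable
qed

text \<open>An \<open>F'\<close>-measurable version of the Galerkin solution that solves the system
  for every sample; uniqueness makes it agree with \<open>g\<close> almost surely.\<close>

definition sol :: "nat \<Rightarrow> 'k \<Rightarrow> 'w \<Rightarrow> real" where
  "sol n = (SOME d. (\<forall>k. d k \<in> borel_measurable F') \<and> (\<forall>\<omega>\<in>space F'. \<forall>j\<in>B n.
      (\<Sum>i\<in>B n. galerkin_matrix (Vn n \<omega>) j i * d i \<omega>) = rhs_n n \<omega> \<omega> j))"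

lemma sol:
  shows sol_measurable: "sol n k \<in> borel_measurable F'"
    and sol_galerkin: "\<omega> \<in> space M \<Longrightarrow> galerkin_eq n (Vn n \<omega>) (rhs_n n \<omega> \<omega>) (\<lambda>k. sol n k \<omega>)"
proof -
  have "\<exists>d. (\<forall>k. d k \<in> borel_measurable F') \<and> (\<forall>\<omega>\<in>space F'. \<forall>j\<in>B n.
      (\<Sum>i\<in>B n. galerkin_matrix (Vn n \<omega>) j i * d i \<omega>) = rhs_n n \<omega> \<omega> j)"
  proof (rule solve_linear_system_measurable)
    show "(\<lambda>\<omega>. rhs_n n \<omega> \<omega> j) \<in> borel_measurable F'" for j
    proof -
      note [measurable] = F'_measurable_F[OF noise_n_measurable] F'_measurable_G[OF xi_measurable]
      show ?thesis unfolding rhs_n_def by measurable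
    qed
    \<comment> \<open>Only positivity matters here, so the sample-dependent
      \<open>Xn n \<omega>\<close> may serve as its own bound \<open>R\<close>.\<close>
    show "0 < (\<Sum>j\<in>B n. c j * (\<Sum>i\<in>B n. galerkin_matrix (Vn n \<omega>) j i * c i))"
      if "k \<in> B n" "c k \<noteq> 0" for c k \<omega>
      by (rule galerkin_matrix_pos_def[where c = c and k = k and n = n, OF admissible_Vn[OF order_refl] that])
  qed (auto simp: finite_B intro: F'_measurable_F galerkin_matrix_measurable)
  from someI_ex[OF this, folded sol_def]
  have *: "\<forall>k. sol n k \<in> borel_measurable F'"
    "\<forall>\<omega>\<in>space F'. \<forall>j\<in>B n. (\<Sum>i\<in>B n. galerkin_matrix (Vn n \<omega>) j i * sol n i \<omega>) = rhs_n n \<omega> \<omega> j"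
    by auto
  show "sol n k \<in> borel_measurable F'" using * by simp
  show "galerkin_eq n (Vn n \<omega>) (rhs_n n \<omega> \<omega>) (\<lambda>k. sol n k \<omega>)" if "\<omega> \<in> space M"
    unfolding galerkin_eq_def
    using * that galerkin_matrix_mult[OF ess_bounded_Vn, where c = "\<lambda>k. sol n k \<omega>"] space_F' by auto
qed

lemma g_eq_sol: "AE \<omega> in M. \<forall>n. \<forall>k\<in>B n. g n k \<omega> = sol n k \<omega>"
  using galerkin_g AE_space
proof eventually_elim
  case (elim \<omega>)
  show ?case
  proof (intro allI ballI)
    fix n k assume k: "k \<in> B n"
    have "galerkin_eq n (Vn n \<omega>) (rhs_n n \<omega> \<omega>) (\<lambda>k. g n k \<omega>)"
      using elim unfolding Vn_def[abs_def] rhs_n_def[abs_def] noise_n_def Sn_def[abs_def] by simp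
    from galerkin_unique[OF admissible_Vn[OF order_refl] this sol_galerkin[OF elim(2)] k]
    show "g n k \<omega> = sol n k \<omega>" .
  qed
qed

lemma field_sol_measurable [measurable]: "(\<lambda>p. field sol n (fst p) (snd p)) \<in> borel_measurable (M \<Otimes>\<^sub>M Q)"
  by (rule field_measurable[OF M_measurable_F'[OF sol_measurable]])

text \<open>On \<open>Xn n \<omega> \<le> R\<close> Bessel's inequality bounds the squared noise
  weights of each test mode and the weights in \<open>j\<close> sum to at most \<open>Lam\<close>,
  which bounds the conditional expectation uniformly in \<open>n\<close>.\<close>

lemma tight_residual: "tight_family (\<lambda>n \<omega>. \<Sum>j\<in>B n. (rhs_n n \<omega> \<omega> j)\<^sup>2 / (1 + lam j)\<^sup>2)"
proof -
  define T where "T n p = ennreal (\<Sum>j\<in>B n. (rhs_n n (fst p) (snd p) j)\<^sup>2 / (1 + lam j)\<^sup>2)" for n p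
  note [measurable] = rhs_n_measurable
  have T: "T n \<in> borel_measurable (F \<Otimes>\<^sub>M G)" for n unfolding T_def by measurable
  show ?thesis
  proof (rule tight_family_conditional[OF T Xn_measurable tight_Xn])
    show "(\<lambda>\<omega>. \<Sum>j\<in>B n. (rhs_n n \<omega> \<omega> j)\<^sup>2 / (1 + lam j)\<^sup>2) \<in> borel_measurable M" for n
    proof -
      note [measurable] = diagonal_measurable[OF rhs_n_measurable, simplified]
      show ?thesis by measurable
    qed
    show "AE \<omega> in M. ennreal (\<Sum>j\<in>B n. (rhs_n n \<omega> \<omega> j)\<^sup>2 / (1 + lam j)\<^sup>2) \<le> T n (\<omega>, \<omega>)" for n
      unfolding T_def by simp
    show "\<exists>K'. \<forall>n. \<forall>\<omega>\<in>space M. Xn n \<omega> \<le> R \<longrightarrow> (\<integral>\<^sup>+\<omega>'. T n (\<omega>, \<omega>') \<partial>M) \<le> ennreal K'" for R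
    proof (intro exI allI ballI impI)
      fix n \<omega> assume X: "Xn n \<omega> \<le> R"
      have "(\<Sum>k\<in>B n. (noise_n n k j \<omega>)\<^sup>2) \<le> 4 * (K\<^sup>2 * R)" for j
      proof -
        have "(\<Sum>k\<in>B n. (noise_n n k j \<omega>)\<^sup>2) \<le> 4 * (\<integral>x. (Sn n \<omega> x)\<^sup>2 \<partial>Q)"
          unfolding noise_n_def by (rule noise_matrix_row[OF ess_bounded_Sn])
        also have "(\<integral>x. (Sn n \<omega> x)\<^sup>2 \<partial>Q) \<le> K\<^sup>2 * Xn n \<omega>"
          unfolding Sn_def Xn_def by (intro integral_kS_power) auto
        also have "\<dots> \<le> K\<^sup>2 * R" using X by (intro mult_left_mono) auto
        finally show ?thesis by simp
      qed
      moreover have "0 \<le> R" using X Xn_ge[of n \<omega>] by linarith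
      ultimately have "(\<Sum>j\<in>B n. (\<Sum>k\<in>B n. (noise_n n k j \<omega>)\<^sup>2) / (1 + lam j)\<^sup>2) \<le> Lam * (4 * (K\<^sup>2 * R))"
        by (intro sum_weight_le) auto
      then have *: "8 * (\<Sum>j\<in>B n. (\<Sum>k\<in>B n. (noise_n n k j \<omega>)\<^sup>2) / (1 + lam j)\<^sup>2) \<le> 8 * (Lam * (4 * (K\<^sup>2 * R)))"
        by (rule mult_left_mono) simp
      show "(\<integral>\<^sup>+\<omega>'. T n (\<omega>, \<omega>') \<partial>M) \<le> ennreal (8 * (Lam * (4 * (K\<^sup>2 * R))))"
        unfolding T_def rhs_n_def fst_conv snd_conv
        by (rule order_trans[OF conditional_residual ennreal_leI[OF *]]) (rule finite_B)+
    qed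
  qed
qed

lemma tight_sol: "tight_family (\<lambda>n \<omega>. \<Sum>k\<in>B n. (sol n k \<omega>)\<^sup>2)"
proof (rule tight_family_combine[OF tight_Xn tight_residual])
  fix R S
  obtain C where C: "C \<ge> 0" "\<And>n V f c. admissible (admissible_bound R) V \<Longrightarrow> galerkin_eq n V f c \<Longrightarrow>
       (\<Sum>k\<in>B n. (c k)\<^sup>2) \<le> C * (\<Sum>k\<in>B n. (f k)\<^sup>2 / (1 + lam k)\<^sup>2)"
    using galerkin_estimate[OF admissible_bound_ge] by blast
  have "AE \<omega> in M. Xn n \<omega> \<le> R \<longrightarrow> (\<Sum>j\<in>B n. (rhs_n n \<omega> \<omega> j)\<^sup>2 / (1 + lam j)\<^sup>2) \<le> S \<longrightarrow>
      (\<Sum>k\<in>B n. (sol n k \<omega>)\<^sup>2) \<le> C * S" for n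
  proof (rule AE_I2, intro impI)
    fix \<omega> assume w: "\<omega> \<in> space M" and X: "Xn n \<omega> \<le> R" and S: "(\<Sum>j\<in>B n. (rhs_n n \<omega> \<omega> j)\<^sup>2 / (1 + lam j)\<^sup>2) \<le> S"
    have "(\<Sum>k\<in>B n. (sol n k \<omega>)\<^sup>2) \<le> C * (\<Sum>j\<in>B n. (rhs_n n \<omega> \<omega> j)\<^sup>2 / (1 + lam j)\<^sup>2)"
      by (rule C(2)[OF admissible_Vn[OF X] sol_galerkin[OF w]])
    also have "\<dots> \<le> C * S" using S C(1) by (rule mult_left_mono)
    finally show "(\<Sum>k\<in>B n. (sol n k \<omega>)\<^sup>2) \<le> C * S" .
  qed
  then show "\<exists>K'. \<forall>n. AE \<omega> in M. Xn n \<omega> \<le> R \<longrightarrow> (\<Sum>j\<in>B n. (rhs_n n \<omega> \<omega> j)\<^sup>2 / (1 + lam j)\<^sup>2) \<le> S \<longrightarrow>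
      (\<Sum>k\<in>B n. (sol n k \<omega>)\<^sup>2) \<le> K'" by blast
qed

text \<open>The operator \<open>(1 - \<Delta>)\<^sup>-\<^sup>1\<close> applied to the right-hand
  side.\<close>

definition gauss_part :: "nat \<Rightarrow> 'w \<Rightarrow> 'w \<Rightarrow> 'x \<Rightarrow> real" where
  "gauss_part n \<omega> \<omega>' x = (\<Sum>j\<in>B n. psi j x * rhs_n n \<omega> \<omega>' j / (1 + lam j))"

text \<open>Exchanging the sums exhibits, for fixed \<open>x\<close>, a linear form in the noise;
  the sum of its squared weights is the variance in \<open>green_noise_variance\<close>.\<close>

lemma gauss_part_eq:
  "gauss_part n \<omega> \<omega>' x = (\<Sum>k\<in>B n. (\<Sum>j\<in>B n. psi j x * noise_n n k j \<omega> / (1 + lam j)) * xi k \<omega>')"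
proof -
  have "gauss_part n \<omega> \<omega>' x = (\<Sum>j\<in>B n. \<Sum>k\<in>B n. psi j x * noise_n n k j \<omega> / (1 + lam j) * xi k \<omega>')"
    unfolding gauss_part_def rhs_n_def by (simp add: sum_distrib_left sum_divide_distrib mult_ac)
  also have "\<dots> = (\<Sum>k\<in>B n. \<Sum>j\<in>B n. psi j x * noise_n n k j \<omega> / (1 + lam j) * xi k \<omega>')"
    by (rule sum.swap)
  finally show ?thesis by (simp add: sum_distrib_right)
qed

lemma gauss_part_trig: "gauss_part n \<omega> \<omega>' = trig n (\<lambda>j. rhs_n n \<omega> \<omega>' j / (1 + lam j))"
  unfolding gauss_part_def trig_def by (auto simp: mult_ac)

lemma tight_gauss_part: "tight_family (\<lambda>n \<omega>. exp_moment a (gauss_part n \<omega> \<omega>))"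
proof -
  define T where "T n p = (\<integral>\<^sup>+x. ennreal (exp (a * \<bar>gauss_part n (fst p) (snd p) x\<bar>)) \<partial>Q)" for n p
  have gm: "(\<lambda>q. gauss_part n (fst (fst q)) (snd (fst q)) (snd q)) \<in> borel_measurable ((F \<Otimes>\<^sub>M G) \<Otimes>\<^sub>M Q)" for n
  proof -
    note [measurable] = xi_measurable
    show ?thesis unfolding gauss_part_eq by measurable
  qed
  have gM [measurable]: "(\<lambda>q. gauss_part n (fst (fst q)) (snd (fst q)) (snd q)) \<in> borel_measurable ((M \<Otimes>\<^sub>M M) \<Otimes>\<^sub>M Q)" for n
  proof -
    note [measurable] = measurable_from_F[OF noise_n_measurable]
    show ?thesis unfolding gauss_part_eq by measurable
  qed
  have T: "T n \<in> borel_measurable (F \<Otimes>\<^sub>M G)" for n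
  proof -
    have "(\<lambda>q. ennreal (exp (a * \<bar>gauss_part n (fst (fst q)) (snd (fst q)) (snd q)\<bar>))) \<in> borel_measurable ((F \<Otimes>\<^sub>M G) \<Otimes>\<^sub>M Q)"
      using gm by measurable
    then show ?thesis
      unfolding T_def by (intro Q.borel_measurable_nn_integral) (simp add: case_prod_beta')
  qed
  interpret MQ: pair_sigma_finite M Q ..
  show ?thesis
  proof (rule tight_family_conditional[OF T Xn_measurable tight_Xn])
    show "(\<lambda>\<omega>. exp_moment a (gauss_part n \<omega> \<omega>)) \<in> borel_measurable M" for n
    proof -
      note [measurable] = measurable_from_F[OF noise_n_measurable]
      have "(\<lambda>p. exp (a * \<bar>gauss_part n (fst p) (fst p) (snd p)\<bar>)) \<in> borel_measurable (M \<Otimes>\<^sub>M Q)"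
        unfolding gauss_part_eq by measurable
      from integral_param_measurable[OF this] show ?thesis unfolding exp_moment_def by simp
    qed
    show "AE \<omega> in M. ennreal (exp_moment a (gauss_part n \<omega> \<omega>)) \<le> T n (\<omega>, \<omega>)" for n
    proof (rule AE_I2)
      fix \<omega>
      have "T n (\<omega>, \<omega>) = ennreal (exp_moment a (gauss_part n \<omega> \<omega>))"
        unfolding T_def exp_moment_def fst_conv snd_conv
        by (intro nn_integral_eq_integral Q.ess_bounded_integrable ess_bounded_exp) (auto simp: gauss_part_trig)
      then show "ennreal (exp_moment a (gauss_part n \<omega> \<omega>)) \<le> T n (\<omega>, \<omega>)" by simp
    qed
    show "\<exists>K'. \<forall>n. \<forall>\<omega>\<in>space M. Xn n \<omega> \<le> R \<longrightarrow> (\<integral>\<^sup>+\<omega>'. T n (\<omega>, \<omega>') \<partial>M) \<le> ennreal K'" for R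
    proof (intro exI allI ballI impI)
      fix n \<omega> assume w: "\<omega> \<in> space M" and X: "Xn n \<omega> \<le> R"
      define s where "s = CK * (1 + K ^ 14 * R)"
      have var: "(\<Sum>k\<in>B n. (\<Sum>j\<in>B n. psi j x * noise_n n k j \<omega> / (1 + lam j))\<^sup>2) \<le> s" for x
      proof -
        have "(\<Sum>k\<in>B n. (\<Sum>j\<in>B n. psi j x * noise_n n k j \<omega> / (1 + lam j))\<^sup>2) \<le> CK * (1 + (\<integral>y. Sn n \<omega> y ^ 14 \<partial>Q))"
          unfolding noise_n_def by (rule green_noise_variance[OF ess_bounded_Sn])
        also have "(\<integral>y. Sn n \<omega> y ^ 14 \<partial>Q) \<le> K ^ 14 * Xn n \<omega>"
          unfolding Sn_def Xn_def by (intro integral_kS_power) auto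
        also have "\<dots> \<le> K ^ 14 * R" using X K_ge by (intro mult_left_mono) auto
        finally show ?thesis unfolding s_def using CK_nonneg by (simp add: mult_left_mono)
      qed
      have [measurable]: "(\<lambda>q. gauss_part n \<omega> (fst q) (snd q)) \<in> borel_measurable (M \<Otimes>\<^sub>M Q)"
        unfolding gauss_part_eq by measurable
      \<comment> \<open>Fubini in the point and the fresh noise: the Gaussian bound is needed at
        each point separately, never for a supremum over \<open>x\<close>.\<close>
      have "(\<integral>\<^sup>+\<omega>'. T n (\<omega>, \<omega>') \<partial>M) = (\<integral>\<^sup>+x. (\<integral>\<^sup>+\<omega>'. ennreal (exp (a * \<bar>gauss_part n \<omega> \<omega>' x\<bar>)) \<partial>M) \<partial>Q)"
        unfolding T_def fst_conv snd_conv
        by (rule MQ.Fubini'[symmetric]) (simp add: case_prod_beta')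
      also have "\<dots> \<le> (\<integral>\<^sup>+x. ennreal (2 * exp (a\<^sup>2 * s / 2)) \<partial>Q)"
      proof (rule nn_integral_mono)
        fix x
        have "(\<integral>\<^sup>+\<omega>'. ennreal (exp (a * \<bar>gauss_part n \<omega> \<omega>' x\<bar>)) \<partial>M)
            \<le> ennreal (2 * exp (a\<^sup>2 * (\<Sum>k\<in>B n. (\<Sum>j\<in>B n. psi j x * noise_n n k j \<omega> / (1 + lam j))\<^sup>2) / 2))"
          unfolding gauss_part_eq by (intro gaussian_exp_abs finite_B)
        also have "\<dots> \<le> ennreal (2 * exp (a\<^sup>2 * s / 2))"
          using var[of x] by (intro ennreal_leI) (auto intro!: mult_left_mono)
        finally show "(\<integral>\<^sup>+\<omega>'. ennreal (exp (a * \<bar>gauss_part n \<omega> \<omega>' x\<bar>)) \<partial>M) \<le> ennreal (2 * exp (a\<^sup>2 * s / 2))" .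
      qed
      also have "\<dots> = ennreal (2 * exp (a\<^sup>2 * s / 2))" by (simp add: Q.emeasure_space_1)
      finally show "(\<integral>\<^sup>+\<omega>'. T n (\<omega>, \<omega>') \<partial>M) \<le> ennreal (2 * exp (a\<^sup>2 * (CK * (1 + K ^ 14 * R)) / 2))"
        unfolding s_def .
    qed
  qed
qed

lemma tight_exp_moment_sol: "tight_family (\<lambda>n \<omega>. exp_moment a (field sol n \<omega>))"
proof -
  \<comment> \<open>A nonnegative rate is needed to multiply inequalities by it; the moment is
    monotone in the rate, so nothing is lost.\<close>
  define a' where "a' = max 0 a"
  have a': "0 \<le> a'" "a \<le> a'" unfolding a'_def by auto
  \<comment> \<open>\<open>tight_family_combine\<close> takes two families; the maximum packs the
    moment and the norm into one and leaves the second place to the Gaussian part.\<close>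
  define Y where "Y n \<omega> = max (Xn n \<omega>) (\<Sum>k\<in>B n. (sol n k \<omega>)\<^sup>2)" for n \<omega>
  have "tight_family Y"
  proof (rule tight_family_combine[OF tight_Xn tight_sol])
    fix R S
    have "AE \<omega> in M. Xn n \<omega> \<le> R \<longrightarrow> (\<Sum>k\<in>B n. (sol n k \<omega>)\<^sup>2) \<le> S \<longrightarrow> Y n \<omega> \<le> max R S" for n
      unfolding Y_def by auto
    then show "\<exists>K'. \<forall>n. AE \<omega> in M. Xn n \<omega> \<le> R \<longrightarrow> (\<Sum>k\<in>B n. (sol n k \<omega>)\<^sup>2) \<le> S \<longrightarrow> Y n \<omega> \<le> K'" by blast
  qed
  then show ?thesis
  proof (rule tight_family_combine[OF _ tight_gauss_part])
    fix R S
    \<comment> \<open>Uniform bound for the solution minus its Gaussian part, read off from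
      \<open>galerkin_minus_noise\<close> with norm and moment replaced by \<open>R\<close>.\<close>
    define w where "w = sqrt (R * (CK * (1 + (2 * K) ^ 14 * R)))"
    have "AE \<omega> in M. Y n \<omega> \<le> R \<longrightarrow> exp_moment a' (gauss_part n \<omega> \<omega>) \<le> S \<longrightarrow>
        exp_moment a (field sol n \<omega>) \<le> exp (a' * w) * S" for n
    proof (rule AE_I2, intro impI)
      fix \<omega> assume \<omega>: "\<omega> \<in> space M" and Y: "Y n \<omega> \<le> R" and S: "exp_moment a' (gauss_part n \<omega> \<omega>) \<le> S"
      have X: "Xn n \<omega> \<le> R" and sR: "(\<Sum>k\<in>B n. (sol n k \<omega>)\<^sup>2) \<le> R" using Y unfolding Y_def by auto
      have R0: "0 \<le> R" using X Xn_ge[of n \<omega>] by linarith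
      have K0: "0 \<le> (2 * K) ^ 14" using K_ge by simp
      have diff: "\<bar>field sol n \<omega> x - gauss_part n \<omega> \<omega> x\<bar> \<le> w" for x
      proof -
        have "(field sol n \<omega> x - gauss_part n \<omega> \<omega> x)\<^sup>2
            \<le> (\<Sum>k\<in>B n. (sol n k \<omega>)\<^sup>2) * (CK * (1 + (\<integral>y. (1 - Vn n \<omega> y) ^ 14 \<partial>Q)))"
          unfolding field_def gauss_part_def
          by (rule galerkin_minus_noise[OF ess_bounded_Vn sol_galerkin[OF \<omega>]])
        also have "\<dots> \<le> R * (CK * (1 + (2 * K) ^ 14 * R))"
        proof (rule mult_mono[OF sR _ R0])
          have "(\<integral>y. (1 - Vn n \<omega> y) ^ 14 \<partial>Q) \<le> (2 * K) ^ 14 * Xn n \<omega>"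
            unfolding Vn_def Xn_def by (rule integral_one_minus_kV_power) simp
          also have "\<dots> \<le> (2 * K) ^ 14 * R" using X K0 by (intro mult_left_mono) auto
          finally show "CK * (1 + (\<integral>y. (1 - Vn n \<omega> y) ^ 14 \<partial>Q)) \<le> CK * (1 + (2 * K) ^ 14 * R)"
            by (intro mult_left_mono CK_nonneg add_left_mono)
          show "0 \<le> CK * (1 + (\<integral>y. (1 - Vn n \<omega> y) ^ 14 \<partial>Q))"
            by (intro mult_nonneg_nonneg CK_nonneg add_nonneg_nonneg Bochner_Integration.integral_nonneg)
              (auto intro: zero_le_even_power)
        qed
        finally show ?thesis unfolding w_def by (rule real_le_rsqrt[of "\<bar>_\<bar>", unfolded power2_abs])
      qed
      have "exp_moment a (field sol n \<omega>) \<le> exp_moment a' (field sol n \<omega>)"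
        by (rule exp_moment_mono[OF _ a'(2)]) simp
      also have "\<dots> \<le> (\<integral>x. exp (a' * w) * exp (a' * \<bar>gauss_part n \<omega> \<omega> x\<bar>) \<partial>Q)"
        unfolding exp_moment_def
      proof (intro integral_mono Q.ess_bounded_integrable ess_bounded_exp bdd_intros)
        show "ess_bounded Q (field sol n \<omega>)" "ess_bounded Q (gauss_part n \<omega> \<omega>)"
          by (auto simp: gauss_part_trig)
        fix x
        have "\<bar>field sol n \<omega> x\<bar> \<le> w + \<bar>gauss_part n \<omega> \<omega> x\<bar>" using diff[of x] by linarith
        then have "a' * \<bar>field sol n \<omega> x\<bar> \<le> a' * (w + \<bar>gauss_part n \<omega> \<omega> x\<bar>)"
          using a'(1) by (rule mult_left_mono)
        then show "exp (a' * \<bar>field sol n \<omega> x\<bar>) \<le> exp (a' * w) * exp (a' * \<bar>gauss_part n \<omega> \<omega> x\<bar>)"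
          unfolding exp_add[symmetric] by (simp add: distrib_left)
      qed
      also have "\<dots> = exp (a' * w) * exp_moment a' (gauss_part n \<omega> \<omega>)" unfolding exp_moment_def by simp
      also have "\<dots> \<le> exp (a' * w) * S" using S by (intro mult_left_mono) auto
      finally show "exp_moment a (field sol n \<omega>) \<le> exp (a' * w) * S" .
    qed
    then show "\<exists>K'. \<forall>n. AE \<omega> in M. Y n \<omega> \<le> R \<longrightarrow> exp_moment a' (gauss_part n \<omega> \<omega>) \<le> S \<longrightarrow>
        exp_moment a (field sol n \<omega>) \<le> K'" by blast
  qed
qed

end

section \<open>One layer: convergence\<close>

context layer_step
begin

definition err :: "nat \<Rightarrow> 'w \<Rightarrow> real" where
  "err n \<omega> = (\<integral>x. (field c n \<omega> x - v \<omega> x)\<^sup>2 \<partial>Q)"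

lemma err_nonneg: "0 \<le> err n \<omega>" unfolding err_def by simp

text \<open>The error tends to zero in probability and the moment of rate \<open>56 * b\<close> is
  tight, so their product tends to zero in probability too. Along a subsequence both limits are
  almost sure, and \<open>exp_moment_close\<close> at rate \<open>28 * b\<close> bounds
  \<open>Xn\<close>.\<close>

lemma input_subseq:
  assumes s: "strict_mono (s :: nat \<Rightarrow> nat)"
  obtains r :: "nat \<Rightarrow> nat" where "strict_mono r"
    "AE \<omega> in M. (\<lambda>m. err (s (r m)) \<omega>) \<longlonglongrightarrow> 0 \<and> (\<exists>C. \<forall>m. Xn (s (r m)) \<omega> \<le> C)"
proof -
  obtain d where d [measurable]: "\<And>n. d n \<in> borel_measurable M"
    and d_eq: "AE \<omega> in M. \<forall>n. d n \<omega> = err n \<omega>"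
    and d_null: "null_in_prob (\<lambda>n \<omega>. ennreal (d n \<omega>))"
    using approx unfolding approximates_def err_def by blast
  define E where "E n \<omega> = exp_moment (56 * b) (field c n \<omega>)" for n \<omega>
  have E [measurable]: "E n \<in> borel_measurable M" for n
    unfolding E_def by (intro measurable_from_F exp_moment_measurable c_measurable)
  have E0: "0 \<le> E n \<omega>" for n \<omega> unfolding E_def exp_moment_def by simp
  obtain r1 :: "nat \<Rightarrow> nat" where r1: "strict_mono r1"
    "AE \<omega> in M. (\<lambda>m. ennreal (d (s (r1 m)) \<omega>)) \<longlonglongrightarrow> 0"
    by (rule null_in_prob_AE_subseq[OF _ null_in_prob_subseq[OF d_null s]]) simp_all
  have sr1: "strict_mono (\<lambda>m. s (r1 m))" using s r1(1) by (simp add: strict_mono_def)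
  have "null_in_prob (\<lambda>n \<omega>. ennreal (d n \<omega>) * ennreal (E n \<omega>))"
    unfolding E_def by (intro null_in_prob_mult_tight d_null tight_c) simp
  then have "null_in_prob (\<lambda>m \<omega>. ennreal (d (s (r1 m)) \<omega>) * ennreal (E (s (r1 m)) \<omega>))"
    by (rule null_in_prob_subseq[OF _ sr1])
  then obtain r2 :: "nat \<Rightarrow> nat" where r2: "strict_mono r2"
    "AE \<omega> in M. (\<lambda>m. ennreal (d (s (r1 (r2 m))) \<omega>) * ennreal (E (s (r1 (r2 m))) \<omega>)) \<longlonglongrightarrow> 0"
    by (rule null_in_prob_AE_subseq[rotated]) simp_all
  define r where "r m = r1 (r2 m)" for m
  have "AE \<omega> in M. (\<lambda>m. err (s (r m)) \<omega>) \<longlonglongrightarrow> 0 \<and> (\<exists>C. \<forall>m. Xn (s (r m)) \<omega> \<le> C)"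
    using r1(2) r2(2) d_eq v_bdd
  proof eventually_elim
    case (elim \<omega>)
    have "(\<lambda>m. ennreal (err (s (r1 m)) \<omega>)) \<longlonglongrightarrow> ennreal 0" using elim(1,3) by simp
    then have "(\<lambda>m. err (s (r1 m)) \<omega>) \<longlonglongrightarrow> 0"
      by (subst (asm) tendsto_ennreal_iff) (auto simp: err_nonneg)
    from LIMSEQ_subseq_LIMSEQ[OF this r2(1)] have 1: "(\<lambda>m. err (s (r m)) \<omega>) \<longlonglongrightarrow> 0"
      by (simp add: comp_def r_def)
    have "(\<lambda>m. ennreal (err (s (r m)) \<omega> * E (s (r m)) \<omega>)) \<longlonglongrightarrow> ennreal 0"
      using elim(2,3) by (simp add: r_def ennreal_mult err_nonneg E0)
    then have "(\<lambda>m. err (s (r m)) \<omega> * E (s (r m)) \<omega>) \<longlonglongrightarrow> 0"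
      by (subst (asm) tendsto_ennreal_iff) (auto simp: err_nonneg E0)
    then have "Bseq (\<lambda>m. err (s (r m)) \<omega> * E (s (r m)) \<omega>)"
      by (intro convergent_imp_Bseq convergentI)
    then obtain C where C: "\<And>m. norm (err (s (r m)) \<omega> * E (s (r m)) \<omega>) \<le> C"
      unfolding Bseq_def by blast
    obtain U where U: "AE x in Q. \<bar>v \<omega> x\<bar> \<le> U" using elim(4) unfolding ess_bounded_def by blast
    have "Xn (s (r m)) \<omega> \<le> exp ((28 * b) * U) + 1 + ((28 * b) * exp ((28 * b) * U))\<^sup>2 * C" for m
    proof -
      have "Xn (s (r m)) \<omega> \<le> exp ((28 * b) * U) + 1 + ((28 * b) * exp ((28 * b) * U))\<^sup>2 *
          (err (s (r m)) \<omega> * exp_moment (2 * (28 * b)) (field c (s (r m)) \<omega>))"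
        unfolding Xn_def err_def using b_pos by (intro exp_moment_close[OF _ elim(4) U]) auto
      also have "\<dots> \<le> exp ((28 * b) * U) + 1 + ((28 * b) * exp ((28 * b) * U))\<^sup>2 * C"
        using C[of m] by (intro add_left_mono mult_left_mono) (auto simp: E_def)
      finally show ?thesis .
    qed
    then show ?case using 1 by blast
  qed
  moreover have "strict_mono r" using r1(1) r2(1) unfolding r_def by (simp add: strict_mono_def)
  ultimately show thesis by (intro that) auto
qed

definition err_sol :: "nat \<Rightarrow> 'w \<Rightarrow> real" where
  "err_sol n \<omega> = (\<integral>x. (field sol n \<omega> x - u \<omega> x)\<^sup>2 \<partial>Q)"

lemma LIMSEQ_sq_bound:
  fixes a y :: "nat \<Rightarrow> real"
  assumes "\<And>m. (a m)\<^sup>2 \<le> C * y m" "y \<longlonglongrightarrow> 0"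
  shows "a \<longlonglongrightarrow> 0"
proof -
  have lim: "(\<lambda>m. C * y m) \<longlonglongrightarrow> 0" using tendsto_mult_left[OF assms(2), of C] by simp
  have "(\<lambda>m. (a m)\<^sup>2) \<longlonglongrightarrow> 0"
    by (rule tendsto_sandwich[OF always_eventually always_eventually tendsto_const lim]) (use assms(1) in auto)
  then have "(\<lambda>m. sqrt ((a m)\<^sup>2)) \<longlonglongrightarrow> sqrt 0" by (intro tendsto_real_sqrt)
  then show ?thesis by (simp add: tendsto_rabs_zero_iff)
qed

text \<open>Along a subsequence the coefficients converge and their moments stay bounded almost
  surely, so one stability constant serves each sample. The conditional expectation of the noise
  residual vanishes by \<open>noise_variance_le\<close>, and a second subsequence makes the residual
  itself vanish almost surely. \<open>galerkin_error\<close> then applies sample by sample.\<close>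

lemma output_subseq:
  assumes s: "strict_mono (s :: nat \<Rightarrow> nat)"
  obtains r :: "nat \<Rightarrow> nat" where "strict_mono r" "AE \<omega> in M. (\<lambda>m. err_sol (s (r m)) \<omega>) \<longlonglongrightarrow> 0"
proof -
  obtain r1 :: "nat \<Rightarrow> nat" where r1: "strict_mono r1"
    and r1_AE: "AE \<omega> in M. (\<lambda>m. err (s (r1 m)) \<omega>) \<longlonglongrightarrow> 0 \<and> (\<exists>C. \<forall>m. Xn (s (r1 m)) \<omega> \<le> C)"
    by (rule input_subseq[OF s])
  define q where "q m = s (r1 m)" for m
  have q: "strict_mono q" using s r1 unfolding q_def strict_mono_def by auto
  define S where "S \<omega> x = kS (v \<omega> x)" for \<omega> x
  define V where "V \<omega> x = kV (v \<omega> x)" for \<omega> x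
  \<comment> \<open>\<open>noise_matrix (S \<omega>) k j\<close> may fail to be measurable because
    \<open>v\<close> may; as a limit of measurable matrices \<open>\<alpha>\<close> is
    \<open>F\<close>-measurable, and it equals that matrix almost surely.\<close>
  define \<alpha> where "\<alpha> k j \<omega> = lim (\<lambda>m. noise_n (q m) k j \<omega>)" for k j \<omega>
  have \<alpha> [measurable]: "\<alpha> k j \<in> borel_measurable F" for k j
    unfolding \<alpha>_def by (intro borel_measurable_lim_metric noise_n_measurable)
  have conv: "AE \<omega> in M. ess_bounded Q (S \<omega>) \<and> ess_bounded Q (V \<omega>)
      \<and> (\<lambda>m. \<integral>x. (S \<omega> x - Sn (q m) \<omega> x)\<^sup>2 \<partial>Q) \<longlonglongrightarrow> 0
      \<and> (\<lambda>m. \<integral>x. \<bar>Vn (q m) \<omega> x - V \<omega> x\<bar> \<partial>Q) \<longlonglongrightarrow> 0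
      \<and> (\<exists>C. \<forall>m. Xn (q m) \<omega> \<le> C) \<and> (\<forall>k j. \<alpha> k j \<omega> = noise_matrix (S \<omega>) k j)"
    using r1_AE v_bdd
  proof eventually_elim
    case (elim \<omega>)
    have e: "(\<lambda>m. err (q m) \<omega>) \<longlonglongrightarrow> 0" using elim(1) unfolding q_def by simp
    obtain C where C: "\<And>m. Xn (q m) \<omega> \<le> C" using elim(1) unfolding q_def by blast
    obtain U where U: "AE x in Q. \<bar>v \<omega> x\<bar> \<le> U" using elim(2) unfolding ess_bounded_def by blast
    have eX: "err (q m) \<omega> * Xn (q m) \<omega> \<le> C * err (q m) \<omega>" for m
      using mult_left_mono[OF C[of m] err_nonneg[of "q m" \<omega>]] by (simp add: mult.commute)
    have Cl: "(\<lambda>m. C * err (q m) \<omega>) \<longlonglongrightarrow> 0" using tendsto_mult_left[OF e, of C] by simp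
    have 1: "ess_bounded Q (S \<omega>)" unfolding S_def by (rule ess_bounded_kS[OF elim(2)])
    have 2: "ess_bounded Q (V \<omega>)" unfolding V_def by (rule ess_bounded_kV[OF elim(2)])
    have 3: "(\<lambda>m. \<integral>x. (S \<omega> x - Sn (q m) \<omega> x)\<^sup>2 \<partial>Q) \<longlonglongrightarrow> 0"
    proof (rule LIMSEQ_sq_bound[OF _ Cl])
      fix m
      have "(\<integral>x. (S \<omega> x - Sn (q m) \<omega> x)\<^sup>2 \<partial>Q)\<^sup>2 \<le> (2 * K\<^sup>2 * exp (2 * b * U))\<^sup>2 * (err (q m) \<omega> * Xn (q m) \<omega>)"
        unfolding S_def Sn_def err_def Xn_def by (rule kS_close[OF _ elim(2) U]) simp
      also have "\<dots> \<le> (2 * K\<^sup>2 * exp (2 * b * U))\<^sup>2 * (C * err (q m) \<omega>)"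
        by (intro mult_left_mono eX) simp
      finally show "(\<integral>x. (S \<omega> x - Sn (q m) \<omega> x)\<^sup>2 \<partial>Q)\<^sup>2 \<le> (2 * K\<^sup>2 * exp (2 * b * U))\<^sup>2 * (C * err (q m) \<omega>)" .
    qed
    have 4: "(\<lambda>m. \<integral>x. \<bar>Vn (q m) \<omega> x - V \<omega> x\<bar> \<partial>Q) \<longlonglongrightarrow> 0"
    proof (rule LIMSEQ_sq_bound[OF _ Cl])
      fix m
      have "(\<integral>x. \<bar>Vn (q m) \<omega> x - V \<omega> x\<bar> \<partial>Q)\<^sup>2 \<le> (K * exp (b * U))\<^sup>2 * (err (q m) \<omega> * Xn (q m) \<omega>)"
        unfolding V_def Vn_def err_def Xn_def by (rule kV_close[OF _ elim(2) U]) simp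
      also have "\<dots> \<le> (K * exp (b * U))\<^sup>2 * (C * err (q m) \<omega>)"
        by (intro mult_left_mono eX) simp
      finally show "(\<integral>x. \<bar>Vn (q m) \<omega> x - V \<omega> x\<bar> \<partial>Q)\<^sup>2 \<le> (K * exp (b * U))\<^sup>2 * (C * err (q m) \<omega>)" .
    qed
    have "\<alpha> k j \<omega> = noise_matrix (S \<omega>) k j" for k j
    proof -
      have "(\<lambda>m. noise_matrix (S \<omega>) k j - noise_n (q m) k j \<omega>) \<longlonglongrightarrow> 0"
      proof (rule LIMSEQ_sq_bound[OF _ 3])
        fix m
        show "(noise_matrix (S \<omega>) k j - noise_n (q m) k j \<omega>)\<^sup>2 \<le> 4 * (\<integral>x. (S \<omega> x - Sn (q m) \<omega> x)\<^sup>2 \<partial>Q)"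
          unfolding noise_n_def noise_matrix_diff[OF 1 ess_bounded_Sn]
          by (intro noise_matrix_sq_le bdd_intros 1 ess_bounded_Sn)
      qed
      from tendsto_diff[OF tendsto_const this, of "noise_matrix (S \<omega>) k j"]
      have "(\<lambda>m. noise_n (q m) k j \<omega>) \<longlonglongrightarrow> noise_matrix (S \<omega>) k j" by simp
      then show ?thesis unfolding \<alpha>_def by (rule limI)
    qed
    then show ?case using 1 2 3 4 C by blast
  qed
  \<comment> \<open>Weights of the noise modes in the limiting functional minus those in the
    Galerkin system, which sees no modes outside \<open>B (q m)\<close>.\<close>
  define D where "D m k j \<omega> = \<alpha> k j \<omega> - (if k \<in> B (q m) then noise_n (q m) k j \<omega> else 0)" for m k j \<omega>
  have D [measurable]: "D m k j \<in> borel_measurable F" for m k j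
    unfolding D_def by (cases "k \<in> B (q m)") auto
  define R where "R m n p = ennreal (\<Sum>j\<in>B (q m). (\<Sum>k\<in>B n. D m k j (fst p) * xi k (snd p))\<^sup>2 / (1 + lam j)\<^sup>2)" for m n p
  \<comment> \<open>Off the diagonal nothing is known about convergence in \<open>n\<close>. The
    lower limit is measurable in any case, Fatou's lemma bounds its inner expectation, and on the
    diagonal \<open>weak_u\<close> makes it a genuine limit almost surely.\<close>
  define T where "T m p = liminf (\<lambda>n. R m n p)" for m p
  have Rm: "R m n \<in> borel_measurable (F \<Otimes>\<^sub>M G)" for m n
  proof -
    note [measurable] = xi_measurable
    show ?thesis unfolding R_def by measurable
  qed
  have T: "T m \<in> borel_measurable (F \<Otimes>\<^sub>M G)" for m
    unfolding T_def by (intro borel_measurable_liminf Rm)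
  have "AE \<omega> in M. (\<lambda>m. \<integral>\<^sup>+\<omega>'. T m (\<omega>, \<omega>') \<partial>M) \<longlonglongrightarrow> 0"
    using conv AE_space
  proof eventually_elim
    case (elim \<omega>)
    note S = elim(1)[THEN conjunct1]
    define tail where "tail m = (\<Sum>j\<in>B m. (\<integral>x. (S \<omega> x * psi j x - trig m (coeff (\<lambda>x. S \<omega> x * psi j x)) x)\<^sup>2 \<partial>Q) / (1 + lam j)\<^sup>2)" for m
    define Bd where "Bd m = 8 * (Lam * (4 * (\<integral>x. (S \<omega> x - Sn (q m) \<omega> x)\<^sup>2 \<partial>Q)) + tail (q m))" for m
    have "(\<lambda>m. tail (q m)) \<longlonglongrightarrow> 0"
      using LIMSEQ_subseq_LIMSEQ[OF noise_tail_tendsto_0[OF S] q] unfolding tail_def by (simp add: comp_def)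
    then have "Bd \<longlonglongrightarrow> 8 * (Lam * (4 * 0) + 0)"
      unfolding Bd_def using elim by (intro tendsto_intros) auto
    then have "(\<lambda>m. ennreal (Bd m)) \<longlonglongrightarrow> ennreal 0" by (intro tendsto_ennrealI) simp
    then have Bd: "(\<lambda>m. ennreal (Bd m)) \<longlonglongrightarrow> 0" by simp
    have "(\<integral>\<^sup>+\<omega>'. T m (\<omega>, \<omega>') \<partial>M) \<le> ennreal (Bd m)" for m
    proof -
      have "(\<integral>\<^sup>+\<omega>'. T m (\<omega>, \<omega>') \<partial>M) \<le> liminf (\<lambda>n. \<integral>\<^sup>+\<omega>'. R m n (\<omega>, \<omega>') \<partial>M)"
        unfolding T_def by (intro nn_integral_liminf section_measurable Rm elim)
      also have "\<dots> \<le> limsup (\<lambda>n. \<integral>\<^sup>+\<omega>'. R m n (\<omega>, \<omega>') \<partial>M)"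
        by (rule Liminf_le_Limsup) simp
      also have "\<dots> \<le> ennreal (Bd m)"
      proof (rule Limsup_bounded, rule always_eventually, rule allI)
        fix n
        have "(\<integral>\<^sup>+\<omega>'. R m n (\<omega>, \<omega>') \<partial>M) \<le> ennreal (8 * (\<Sum>j\<in>B (q m). (\<Sum>k\<in>B n. (D m k j \<omega>)\<^sup>2) / (1 + lam j)\<^sup>2))"
          unfolding R_def fst_conv snd_conv by (rule conditional_residual) (rule finite_B)+
        also have "(\<Sum>j\<in>B (q m). (\<Sum>k\<in>B n. (D m k j \<omega>)\<^sup>2) / (1 + lam j)\<^sup>2)
          = (\<Sum>j\<in>B (q m). (\<Sum>k\<in>B n. (noise_matrix (S \<omega>) k j -
              (if k \<in> B (q m) then noise_matrix (Sn (q m) \<omega>) k j else 0))\<^sup>2) / (1 + lam j)\<^sup>2)"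
          unfolding D_def noise_n_def using elim by simp
        also have "ennreal (8 * \<dots>) \<le> ennreal (Bd m)"
          unfolding Bd_def tail_def
          by (intro ennreal_leI mult_left_mono noise_variance_le S ess_bounded_Sn) simp
        finally show "(\<integral>\<^sup>+\<omega>'. R m n (\<omega>, \<omega>') \<partial>M) \<le> ennreal (Bd m)" .
      qed
      finally show ?thesis .
    qed
    then show ?case
      by (intro tendsto_sandwich[OF always_eventually always_eventually tendsto_const Bd] allI) simp_all
  qed
  then have "null_in_prob (\<lambda>m \<omega>. T m (\<omega>, \<omega>))" by (rule null_in_prob_conditional[OF T])
  then obtain r2 :: "nat \<Rightarrow> nat" where r2: "strict_mono r2" "AE \<omega> in M. (\<lambda>m. T (r2 m) (\<omega>, \<omega>)) \<longlonglongrightarrow> 0"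
    by (rule null_in_prob_AE_subseq[rotated]) (simp_all add: diagonal_measurable T)
  have "AE \<omega> in M. (\<lambda>m. err_sol (q (r2 m)) \<omega>) \<longlonglongrightarrow> 0"
    using r2(2) conv weak_u u_bdd AE_space
  proof eventually_elim
    case (elim \<omega>)
    define L where "L j = lam j * coeff (u \<omega>) j + coeff (\<lambda>x. V \<omega> x * u \<omega> x) j" for j
    define res where "res m = (\<Sum>j\<in>B (q m). (L j - rhs_n (q m) \<omega> \<omega> j)\<^sup>2 / (1 + lam j)\<^sup>2)" for m
    have Llim: "(\<lambda>n. \<Sum>k\<in>B n. \<alpha> k j \<omega> * xi k \<omega>) \<longlonglongrightarrow> L j" for j
      using elim(2,3) unfolding L_def V_def S_def by simp
    have T_eq: "T m (\<omega>, \<omega>) = ennreal (res m)" for m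
    proof -
      have "(\<lambda>n. \<Sum>k\<in>B n. D m k j \<omega> * xi k \<omega>) \<longlonglongrightarrow> L j - rhs_n (q m) \<omega> \<omega> j" for j
      proof -
        have "eventually (\<lambda>n. (\<Sum>k\<in>B n. D m k j \<omega> * xi k \<omega>) = (\<Sum>k\<in>B n. \<alpha> k j \<omega> * xi k \<omega>) - rhs_n (q m) \<omega> \<omega> j) sequentially"
          using eventually_ge_at_top[of "q m"]
        proof eventually_elim
          case (elim n)
          have "rhs_n (q m) \<omega> \<omega> j = (\<Sum>k\<in>B n. (if k \<in> B (q m) then noise_n (q m) k j \<omega> else 0) * xi k \<omega>)"
            unfolding rhs_n_def using B_mono[OF elim]
            by (intro sum.mono_neutral_cong_left) (auto simp: finite_B)
          then show ?case unfolding D_def by (simp add: left_diff_distrib sum_subtractf)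
        qed
        moreover have "(\<lambda>n. (\<Sum>k\<in>B n. \<alpha> k j \<omega> * xi k \<omega>) - rhs_n (q m) \<omega> \<omega> j) \<longlonglongrightarrow> L j - rhs_n (q m) \<omega> \<omega> j"
          by (intro tendsto_intros Llim)
        ultimately show ?thesis by (subst filterlim_cong[OF refl refl])
      qed
      then have "(\<lambda>n. R m n (\<omega>, \<omega>)) \<longlonglongrightarrow> ennreal (res m)"
        unfolding R_def fst_conv snd_conv res_def by (intro tendsto_intros) (use one_lam_pos in auto)
      then show ?thesis unfolding T_def by (intro lim_imp_Liminf) auto
    qed
    have "0 \<le> res m" for m unfolding res_def by (auto intro!: sum_nonneg)
    moreover have "(\<lambda>m. ennreal (res (r2 m))) \<longlonglongrightarrow> ennreal 0" using elim(1) unfolding T_eq by simp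
    ultimately have res: "(\<lambda>m. res (r2 m)) \<longlonglongrightarrow> 0" by (subst (asm) tendsto_ennreal_iff) auto
    obtain X where X: "\<And>m. Xn (q m) \<omega> \<le> X" using elim(2) by blast
    obtain U where U: "AE x in Q. \<bar>u \<omega> x\<bar> \<le> U" using elim(4) unfolding ess_bounded_def by blast
    define A where "A = admissible_bound X"
    obtain C where C: "C \<ge> 0" "\<And>n V f c. admissible A V \<Longrightarrow> galerkin_eq n V f c \<Longrightarrow>
       (\<Sum>k\<in>B n. (c k)\<^sup>2) \<le> C * (\<Sum>k\<in>B n. (f k)\<^sup>2 / (1 + lam k)\<^sup>2)"
      unfolding A_def using galerkin_estimate[OF admissible_bound_ge] by blast
    define P where "P n = (\<integral>x. (u \<omega> x - trig n (coeff (u \<omega>)) x)\<^sup>2 \<partial>Q)" for n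
    have P: "P \<longlonglongrightarrow> 0" unfolding P_def by (rule projection_error_tendsto_0[OF elim(4)])
    define N1 where "N1 m = (\<integral>x. \<bar>Vn (q m) \<omega> x - V \<omega> x\<bar> \<partial>Q)" for m
    have N1: "N1 \<longlonglongrightarrow> 0" using elim(2) unfolding N1_def by simp
    \<comment> \<open>Twice the bound of \<open>galerkin_error\<close> plus twice the projection
      error, as in \<open>integral_diff_trig_sq\<close>.\<close>
    define bd where "bd m = 2 * (3 * C * (res m + 4 * Lam * U\<^sup>2 * (N1 m)\<^sup>2 + 4 * Lam * A * P (q m))) + 2 * P (q m)" for m
    have le: "err_sol (q m) \<omega> \<le> bd m" for m
    proof -
      have "(\<Sum>k\<in>B (q m). (coeff (u \<omega>) k - sol (q m) k \<omega>)\<^sup>2) \<le> 3 * C * (res m + 4 * Lam * U\<^sup>2 * (N1 m)\<^sup>2 + 4 * Lam * A * P (q m))"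
        unfolding res_def N1_def P_def
        by (rule galerkin_error[OF C(2,1) admissible_Vn[OF X, folded A_def] _ elim(4) U _ sol_galerkin[OF elim(5)]])
          (use elim(2) L_def in auto)
      moreover have "err_sol (q m) \<omega> = (\<integral>x. (u \<omega> x - trig (q m) (\<lambda>k. sol (q m) k \<omega>) x)\<^sup>2 \<partial>Q)"
        unfolding err_sol_def field_def by (simp add: power2_commute)
      ultimately show ?thesis
        using integral_diff_trig_sq[OF elim(4), of "q m" "\<lambda>k. sol (q m) k \<omega>"] unfolding bd_def P_def by linarith
    qed
    have "(\<lambda>m. bd (r2 m)) \<longlonglongrightarrow> 2 * (3 * C * (0 + 4 * Lam * U\<^sup>2 * 0\<^sup>2 + 4 * Lam * A * 0)) + 2 * 0"
    proof -
      have "strict_mono (\<lambda>m. q (r2 m))" using q r2(1) unfolding strict_mono_def by auto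
      from LIMSEQ_subseq_LIMSEQ[OF P this] have "(\<lambda>m. P (q (r2 m))) \<longlonglongrightarrow> 0" by (simp add: comp_def)
      moreover from LIMSEQ_subseq_LIMSEQ[OF N1 r2(1)] have "(\<lambda>m. N1 (r2 m)) \<longlonglongrightarrow> 0" by (simp add: comp_def)
      ultimately show ?thesis unfolding bd_def by (intro tendsto_intros res)
    qed
    then have "(\<lambda>m. bd (r2 m)) \<longlonglongrightarrow> 0" by simp
    from tendsto_sandwich[OF always_eventually always_eventually tendsto_const this]
    show ?case by (simp add: err_sol_def le[unfolded err_sol_def])
  qed
  moreover have "strict_mono (\<lambda>m. r1 (r2 m))" using r1 r2(1) by (simp add: strict_mono_def)
  ultimately show thesis by (intro that[of "\<lambda>m. r1 (r2 m)"]) (auto simp: q_def)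
qed

text \<open>The integrals on the left do not contain \<open>u\<close> and are measurable in the
  sample, so their limit is a measurable version of the error. The cross term vanishes by
  Cauchy-Schwarz.\<close>

lemma err_sol_limit:
  assumes u: "ess_bounded Q (u \<omega>)" and lim: "(\<lambda>m. err_sol (q m) \<omega>) \<longlonglongrightarrow> 0"
  shows "(\<lambda>m. \<integral>x. (field sol n \<omega> x - field sol (q m) \<omega> x)\<^sup>2 \<partial>Q) \<longlonglongrightarrow> err_sol n \<omega>"
proof -
  define A where "A x = field sol n \<omega> x - u \<omega> x" for x
  define E where "E m x = u \<omega> x - field sol (q m) \<omega> x" for m x
  have bA: "ess_bounded Q A" and bE: "ess_bounded Q (E m)" for m
    unfolding A_def E_def by (intro bdd_intros u ess_bounded_field)+
  have E2: "(\<integral>x. (E m x)\<^sup>2 \<partial>Q) = err_sol (q m) \<omega>" for m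
    unfolding E_def err_sol_def by (simp add: power2_commute)
  have AE: "(\<lambda>m. \<integral>x. A x * E m x \<partial>Q) \<longlonglongrightarrow> 0"
    by (rule LIMSEQ_sq_bound[OF _ lim]) (use Q.integral_Cauchy_Schwarz[OF bA bE] E2 in auto)
  have "(\<integral>x. (field sol n \<omega> x - field sol (q m) \<omega> x)\<^sup>2 \<partial>Q)
      = err_sol n \<omega> + 2 * (\<integral>x. A x * E m x \<partial>Q) + err_sol (q m) \<omega>" for m
  proof -
    have "(\<integral>x. (field sol n \<omega> x - field sol (q m) \<omega> x)\<^sup>2 \<partial>Q)
        = (\<integral>x. (A x)\<^sup>2 + 2 * (A x * E m x) + (E m x)\<^sup>2 \<partial>Q)"
      unfolding A_def E_def by (intro Bochner_Integration.integral_cong) (auto simp: power2_eq_square algebra_simps)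
    also have "\<dots> = (\<integral>x. (A x)\<^sup>2 \<partial>Q) + 2 * (\<integral>x. A x * E m x \<partial>Q) + (\<integral>x. (E m x)\<^sup>2 \<partial>Q)"
      by (subst Bochner_Integration.integral_add;
        (intro Bochner_Integration.integrable_add Q.ess_bounded_integrable bdd_intros bA bE)?)+ simp
    finally show ?thesis unfolding E2 by (simp add: A_def err_sol_def)
  qed
  moreover have "(\<lambda>m. err_sol n \<omega> + 2 * (\<integral>x. A x * E m x \<partial>Q) + err_sol (q m) \<omega>) \<longlonglongrightarrow> err_sol n \<omega> + 2 * 0 + 0"
    by (intro tendsto_intros AE lim)
  ultimately show ?thesis by simp
qed

theorem layer_approximates: "approximates M F' sol u"
proof -
  \<comment> \<open>One fixed almost surely convergent subsequence, taken from the full sequence,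
    serves to define \<open>e\<close>; convergence in probability is shown afterwards from all
    subsequences.\<close>
  obtain q :: "nat \<Rightarrow> nat" where q: "AE \<omega> in M. (\<lambda>m. err_sol (q m) \<omega>) \<longlonglongrightarrow> 0"
    by (rule output_subseq[of "\<lambda>n. n"]) (auto simp: strict_mono_def)
  define e where "e n \<omega> = lim (\<lambda>m. \<integral>x. (field sol n \<omega> x - field sol (q m) \<omega> x)\<^sup>2 \<partial>Q)" for n \<omega>
  have e [measurable]: "e n \<in> borel_measurable M" for n
    unfolding e_def
  proof (rule borel_measurable_lim_metric)
    fix m
    have "(\<lambda>p. (field sol n (fst p) (snd p) - field sol (q m) (fst p) (snd p))\<^sup>2) \<in> borel_measurable (M \<Otimes>\<^sub>M Q)"
      by measurable
    from integral_param_measurable[OF this]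
    show "(\<lambda>\<omega>. \<integral>x. (field sol n \<omega> x - field sol (q m) \<omega> x)\<^sup>2 \<partial>Q) \<in> borel_measurable M" by simp
  qed
  have e_eq: "AE \<omega> in M. \<forall>n. e n \<omega> = err_sol n \<omega>"
    using q u_bdd
  proof eventually_elim
    case (elim \<omega>)
    show ?case unfolding e_def using err_sol_limit[OF elim(2,1)] by (auto intro: limI)
  qed
  have "null_in_prob (\<lambda>n \<omega>. ennreal (e n \<omega>))"
  proof (rule null_in_prob_subseq_criterion)
    fix s :: "nat \<Rightarrow> nat" assume s: "strict_mono s"
    obtain r :: "nat \<Rightarrow> nat" where r: "strict_mono r" "AE \<omega> in M. (\<lambda>m. err_sol (s (r m)) \<omega>) \<longlonglongrightarrow> 0"
      by (rule output_subseq[OF s])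
    have "AE \<omega> in M. (\<lambda>m. ennreal (e (s (r m)) \<omega>)) \<longlonglongrightarrow> 0"
      using r(2) e_eq
    proof eventually_elim
      case (elim \<omega>)
      then have "(\<lambda>m. ennreal (e (s (r m)) \<omega>)) \<longlonglongrightarrow> ennreal 0" by (intro tendsto_ennrealI) simp
      then show ?case by simp
    qed
    then show "\<exists>r :: nat \<Rightarrow> nat. strict_mono r \<and> (AE \<omega> in M. (\<lambda>n. ennreal (e (s (r n)) \<omega>)) \<longlonglongrightarrow> 0)"
      using r(1) by blast
  qed simp
  then show ?thesis
    unfolding approximates_def
    using sol_measurable u_bdd tight_exp_moment_sol e e_eq[unfolded err_sol_def] by blast
qed

end

section \<open>The trigonometric basis of the torus\<close>

text \<open>Lebesgue measure is the image of a product measure over the basis, so the integral of a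
  product of one-variable functions factorises.\<close>

lemma lborel_integral_prod:
  fixes g :: "'a::euclidean_space \<Rightarrow> real \<Rightarrow> complex"
  assumes g: "\<And>b. b \<in> Basis \<Longrightarrow> integrable lborel (g b)"
  shows "(\<integral>x. (\<Prod>b\<in>Basis. g b (x \<bullet> b)) \<partial>lborel) = (\<Prod>b\<in>Basis. \<integral>t. g b t \<partial>lborel)"
proof -
  interpret product_sigma_finite "\<lambda>_. lborel :: real measure" ..
  have [measurable]: "g b \<in> borel_measurable borel" if "b \<in> Basis" for b
    using borel_measurable_integrable[OF g[OF that]] by simp
  have "(\<integral>x. (\<Prod>b\<in>Basis. g b (x \<bullet> b)) \<partial>(lborel :: 'a measure))
      = (\<integral>f. (\<Prod>b\<in>Basis. g b ((\<Sum>b'\<in>Basis. f b' *\<^sub>R b') \<bullet> b)) \<partial>(\<Pi>\<^sub>M b\<in>(Basis :: 'a set). lborel))"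
    by (subst lborel_eq, subst integral_distr) (auto intro!: borel_measurable_prod)
  also have "\<dots> = (\<integral>f. (\<Prod>b\<in>Basis. g b (f b)) \<partial>(\<Pi>\<^sub>M b\<in>(Basis :: 'a set). lborel))"
    by (intro Bochner_Integration.integral_cong prod.cong) auto
  also have "\<dots> = (\<Prod>b\<in>Basis. \<integral>t. g b t \<partial>lborel)"
    by (rule product_integral_prod) (auto intro: g)
  finally show ?thesis .
qed

lemma integral_cis_unit_interval:
  fixes m :: int
  shows "(\<integral>t. indicator {0..1} t *\<^sub>R cis (2 * pi * (m * t)) \<partial>lborel) = (if m = 0 then 1 else 0)"
proof (cases "m = 0")
  case True
  have "(\<integral>t. indicator {0..1::real} t *\<^sub>R (1 :: complex) \<partial>lborel) = 1"
    by simp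
  then show ?thesis using True by simp
next
  case False
  define F where "F t = cis (2 * pi * (m * t)) / (\<i> * of_real (2 * pi * m))" for t :: real
  have d: "((\<lambda>t. cis (2 * pi * (m * t))) has_vector_derivative (\<i> * of_real (2 * pi * m)) * cis (2 * pi * (m * t))) (at t within A)" for t :: real and A
  proof -
    have "((\<lambda>z. exp (\<i> * of_real (2 * pi * m) * z)) has_field_derivative
        (\<i> * of_real (2 * pi * m)) * exp (\<i> * of_real (2 * pi * m) * of_real t)) (at (of_real t))"
      by (auto intro!: derivative_eq_intros)
    from has_vector_derivative_real_field[OF this, of A] show ?thesis
      unfolding cis_conv_exp by (simp add: mult.assoc)
  qed
  have "(\<integral>t. indicator {0..1} t *\<^sub>R cis (2 * pi * (m * t)) \<partial>lborel) = F 1 - F 0"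
  proof (rule integral_FTC_atLeastAtMost)
    fix t :: real
    show "(F has_vector_derivative cis (2 * pi * (m * t))) (at t within {0..1})"
      unfolding F_def using False
      by (auto intro!: derivative_eq_intros d)
  qed (auto intro!: continuous_intros)
  also have "cis (2 * pi * m) = 1" by (simp add: cis.ctr complex_eq_iff)
  then have "F 1 - F 0 = 0" unfolding F_def by simp
  finally show ?thesis using False by simp
qed

text \<open>The closed cube contains opposite faces twice, but they form a null set.\<close>

definition torus :: "(real^'d) measure" where
  "torus = restrict_space lborel cube"

definition phase :: "int^'d \<Rightarrow> real^'d \<Rightarrow> real" where
  "phase k x = 2 * pi * (\<Sum>j\<in>UNIV. real_of_int (k $ j) * x $ j)"

text \<open>Real form of the Fourier basis: with the convention of \<open>noise_coeff\<close>, the truncated noise is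
  \<open>\<Sum>k. \<xi> k * hartley k\<close>.\<close>

definition hartley :: "int^'d \<Rightarrow> real^'d \<Rightarrow> real" where
  "hartley k x = cos (phase k x) - sin (phase k x)"

definition eigenvalue :: "int^'d \<Rightarrow> real" where
  "eigenvalue k = 4 * pi\<^sup>2 * (\<Sum>j\<in>UNIV. (real_of_int (k $ j))\<^sup>2)"

lemma cube_sets [measurable]: "cube \<in> sets borel"
  unfolding cube_def by simp

lemma space_torus: "space torus = cube"
  unfolding torus_def by (simp add: space_restrict_space)

lemma prob_space_torus: "prob_space (torus :: (real^'d) measure)"
proof
  show "emeasure (torus :: (real^'d) measure) (space torus) = 1"
    unfolding torus_def space_torus[unfolded torus_def]
    by (subst emeasure_restrict_space) (auto simp: cube_def emeasure_lborel_cbox_eq space_restrict_space)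
qed

interpretation torus: prob_space "torus :: (real^'d) measure"
  by (rule prob_space_torus)

lemma borel_measurable_torus: "f \<in> borel_measurable borel \<Longrightarrow> f \<in> borel_measurable torus"
  unfolding torus_def by (intro measurable_restrict_space1) simp

lemma integral_torus:
  fixes f :: "real^'d \<Rightarrow> 'b::{banach, second_countable_topology}"
  shows "integral\<^sup>L torus f = (LINT x:cube|lborel. f x)"
  unfolding torus_def set_lebesgue_integral_def by (rule integral_restrict_space) simp

lemma AE_torus: "(AE x in torus. P x) \<longleftrightarrow> (AE x in lborel. x \<in> cube \<longrightarrow> P x)"
  unfolding torus_def by (rule AE_restrict_space_iff) simp

lemma Basis_vec_real: "(Basis :: (real^'d) set) = range (\<lambda>i. axis i 1)"
  by (auto simp: Basis_vec_def)

lemma mem_cube: "x \<in> cube \<longleftrightarrow> (\<forall>j. 0 \<le> x $ j \<and> x $ j \<le> 1)"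
proof -
  have "x \<in> cube \<longleftrightarrow> (\<forall>i\<in>Basis. 0 \<le> x \<bullet> i \<and> x \<bullet> i \<le> 1)"
    unfolding cube_def mem_box by (intro ball_cong) auto
  then show ?thesis unfolding Basis_vec_real by (simp add: inner_axis)
qed

lemma fourier_phase: "fourier k x = cis (phase k x)"
  unfolding fourier_def phase_def ..

lemma phase_add: "phase (k + l) x = phase k x + phase l x"
  unfolding phase_def by (simp add: algebra_simps sum.distrib)

lemma phase_diff: "phase (k - l) x = phase k x - phase l x"
  unfolding phase_def by (simp add: algebra_simps sum_subtractf)

lemma phase_minus: "phase (- k) x = - phase k x"
  unfolding phase_def by (simp add: sum_negf)

lemma phase_continuous [continuous_intros]: "continuous_on A (phase k)"
  unfolding phase_def by (intro continuous_intros)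

lemma phase_measurable [measurable]: "phase k \<in> borel_measurable borel"
  by (intro borel_measurable_continuous_onI phase_continuous)

lemma hartley_continuous [continuous_intros]: "continuous_on A (hartley k)"
  unfolding hartley_def[abs_def] by (intro continuous_intros)

lemma hartley_measurable [measurable]: "hartley k \<in> borel_measurable borel"
  by (intro borel_measurable_continuous_onI hartley_continuous)

lemma hartley_bound: "\<bar>hartley k x\<bar> \<le> 2"
  unfolding hartley_def using abs_cos_le_one[of "phase k x"] abs_sin_le_one[of "phase k x"] by linarith

lemma integral_fourier:
  "(\<integral>x. cis (phase k x) \<partial>torus) = (if k = (0 :: int^'d) then 1 else 0)"
proof -
  \<comment> \<open>\<open>lborel_integral_prod\<close> is indexed by basis vectors; the description
    operator recovers the coordinate from \<open>axis i 1\<close>.\<close>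
  define g where "g b t = indicator {0..1} t *\<^sub>R cis (2 * pi * (real_of_int (k $ (THE i. b = axis i 1)) * t))"
    for b :: "real^'d" and t :: real
  have the: "(THE i. axis j (1::real) = (axis i 1 :: real^'d)) = j" for j
    by (rule the_equality) (auto simp: axis_eq_axis)
  have inj: "inj (\<lambda>i. axis i 1 :: real^'d)" by (auto intro!: injI simp: axis_eq_axis)
  have gj: "g (axis j 1) t = indicator {0..1} t *\<^sub>R cis (2 * pi * (real_of_int (k $ j) * t))" for j t
    unfolding g_def the ..
  have "indicator cube x *\<^sub>R cis (phase k x) = (\<Prod>b\<in>Basis. g b (x \<bullet> b))" for x :: "real^'d"
  proof -
    have "(\<Prod>b\<in>Basis. g b (x \<bullet> b)) = (\<Prod>j\<in>UNIV. g (axis j 1) (x $ j))"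
      unfolding Basis_vec_real by (subst prod.reindex[OF inj]) (simp add: inner_axis)
    also have "\<dots> = (\<Prod>j\<in>UNIV. of_real (indicator {0..1} (x $ j)) * cis (2 * pi * (real_of_int (k $ j) * x $ j)))"
      unfolding gj scaleR_conv_of_real ..
    also have "\<dots> = (\<Prod>j\<in>UNIV. of_real (indicator {0..1} (x $ j))) * (\<Prod>j\<in>UNIV. cis (2 * pi * (real_of_int (k $ j) * x $ j)))"
      by (rule prod.distrib)
    also have "(\<Prod>j\<in>UNIV. cis (2 * pi * (real_of_int (k $ j) * x $ j))) = cis (phase k x)"
      unfolding phase_def sum_distrib_left cis_conv_exp by (simp add: exp_sum[symmetric] sum_distrib_left)
    also have "(\<Prod>j\<in>UNIV. complex_of_real (indicator {0..1} (x $ j))) = of_real (indicator cube x)"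
    proof (cases "x \<in> cube")
      case True
      then have "\<forall>j. x $ j \<in> {0..1}" by (simp add: mem_cube)
      then show ?thesis using True by simp
    next
      case False
      then obtain j where "x $ j \<notin> {0..1}"
        by (auto simp: mem_cube)
      then have "(\<Prod>j\<in>UNIV. complex_of_real (indicator {0..1} (x $ j))) = 0"
        by (intro prod_zero bexI[of _ j]) auto
      then show ?thesis using False by simp
    qed
    finally show ?thesis by (simp add: scaleR_conv_of_real)
  qed
  then have "(\<integral>x. cis (phase k x) \<partial>torus) = (\<integral>x. (\<Prod>b\<in>Basis. g b (x \<bullet> b)) \<partial>lborel)"
    unfolding integral_torus set_lebesgue_integral_def by simp
  also have "\<dots> = (\<Prod>b\<in>Basis. \<integral>t. g b t \<partial>lborel)"
  proof (rule lborel_integral_prod)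
    fix b :: "real^'d" assume "b \<in> Basis"
    show "integrable lborel (g b)"
      unfolding g_def by (rule borel_integrable_compact) (auto intro!: continuous_intros)
  qed
  also have "\<dots> = (\<Prod>j\<in>UNIV. \<integral>t. g (axis j 1) t \<partial>lborel)"
    unfolding Basis_vec_real by (subst prod.reindex[OF inj]) simp
  also have "\<dots> = (\<Prod>j\<in>UNIV. if k $ j = 0 then 1 else 0)"
    unfolding gj integral_cis_unit_interval ..
  also have "\<dots> = (if k = 0 then 1 else 0)"
    by (auto simp: vec_eq_iff)
  finally show ?thesis .
qed

lemma integrable_cis_phase: "integrable torus (\<lambda>x. cis (phase k x))"
  by (rule torus.integrable_const_bound[where B=1])
    (auto intro!: borel_measurable_torus borel_measurable_continuous_onI continuous_intros)

lemma integral_cos_phase: "(\<integral>x. cos (phase k x) \<partial>torus) = (if k = 0 then 1 else 0)"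
proof -
  have "(\<integral>x. cos (phase k x) \<partial>torus) = Re (\<integral>x. cis (phase k x) \<partial>torus)"
    by (subst integral_Re[OF integrable_cis_phase, symmetric]) simp
  then show ?thesis unfolding integral_fourier by simp
qed

lemma integral_sin_phase: "(\<integral>x. sin (phase k x) \<partial>torus) = 0"
proof -
  have "(\<integral>x. sin (phase k x) \<partial>torus) = Im (\<integral>x. cis (phase k x) \<partial>torus)"
    by (subst integral_Im[OF integrable_cis_phase, symmetric]) simp
  then show ?thesis unfolding integral_fourier by simp
qed

text \<open>Linearising the product yields orthonormality, since the sine always integrates to zero
  and the cosine does so unless \<open>k = l\<close>. It is also the reason why trigonometric
  polynomials form an algebra.\<close>

lemma hartley_mult: "hartley k x * hartley l x = cos (phase (k - l) x) - sin (phase (k + l) x)"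
  unfolding hartley_def phase_add phase_diff by (simp add: cos_diff sin_add algebra_simps)

lemma hartley_orthonormal: "(\<integral>x. hartley k x * hartley l x \<partial>torus) = (if k = l then 1 else 0)"
proof -
  have "integrable torus (\<lambda>x. cos (phase k x))" "integrable torus (\<lambda>x. sin (phase k x))" for k :: "int^'a"
    by (rule torus.integrable_const_bound[where B=1]; auto intro!: borel_measurable_torus)+
  then show ?thesis
    unfolding hartley_mult by (simp add: integral_cos_phase integral_sin_phase)
qed

lemma ess_bounded_hartley: "ess_bounded torus (hartley k)"
  by (rule ess_boundedI[where C=2]) (auto intro: borel_measurable_torus simp: hartley_bound)

section \<open>Frequency boxes, eigenvalues and shells\<close>

lemma finite_freq_box: "finite (freq_box n :: (int^'d) set)"
  and card_freq_box: "card (freq_box n :: (int^'d) set) = (2 * n + 1) ^ CARD('d)"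
proof -
  define P where "P = PiE (UNIV :: 'd set) (\<lambda>_. {- int n..int n})"
  have bij: "bij_betw (\<lambda>k. ($) k) (freq_box n :: (int^'d) set) P"
    unfolding P_def freq_box_def
    by (rule bij_betwI[where g = "\<lambda>f. \<chi> i. f i"]) (auto simp: PiE_iff abs_le_iff vec_eq_iff minus_le_iff)
  have P: "finite P" "card P = (2 * n + 1) ^ CARD('d)"
    unfolding P_def by (auto simp: card_PiE intro!: finite_PiE) (simp add: nat_add_distrib nat_mult_distrib)
  show "finite (freq_box n :: (int^'d) set)" using bij_betw_finite[OF bij] P by simp
  show "card (freq_box n :: (int^'d) set) = (2 * n + 1) ^ CARD('d)" using bij_betw_same_card[OF bij] P by simp
qed

lemma freq_box_mono: "m \<le> n \<Longrightarrow> freq_box m \<subseteq> freq_box n"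
  unfolding freq_box_def by (auto intro: order_trans)

lemma zero_in_freq_box: "0 \<in> freq_box n"
  unfolding freq_box_def by simp

lemma freq_box_cover: "\<exists>n. (k :: int^'d) \<in> freq_box n"
proof -
  have "\<bar>k $ j\<bar> \<le> int (nat (\<Sum>j\<in>UNIV. \<bar>k $ j\<bar>))" for j
    using member_le_sum[of j UNIV "\<lambda>j. \<bar>k $ j\<bar>"] by (simp add: sum_nonneg)
  then show ?thesis unfolding freq_box_def by blast
qed

lemma eigenvalue_nonneg: "0 \<le> eigenvalue k"
  unfolding eigenvalue_def by (auto intro!: mult_nonneg_nonneg sum_nonneg)

lemma eigenvalue_ge:
  fixes k :: "int^'d"
  assumes "int m \<le> \<bar>k $ j\<bar>"
  shows "16 * (real m)\<^sup>2 \<le> eigenvalue k"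
proof -
  have "real m \<le> \<bar>real_of_int (k $ j)\<bar>" using assms by linarith
  then have "(real m)\<^sup>2 \<le> (real_of_int (k $ j))\<^sup>2" by (metis abs_ge_zero of_nat_0_le_iff power2_abs power_mono)
  also have "\<dots> \<le> (\<Sum>j\<in>UNIV. (real_of_int (k $ j))\<^sup>2)" by (intro member_le_sum) auto
  finally have 1: "(real m)\<^sup>2 \<le> (\<Sum>j\<in>UNIV. (real_of_int (k $ j))\<^sup>2)" .
  \<comment> \<open>The resulting factor 16 is exactly what \<open>shell_eigenvalue\<close> needs to
    pass from \<open>16 ^ m\<close> to \<open>16 ^ Suc m\<close>.\<close>
  have "2 * 2 \<le> pi * pi" using pi_ge_two by (intro mult_mono) auto
  then have "16 \<le> 4 * pi\<^sup>2" by (simp add: power2_eq_square)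
  then show ?thesis unfolding eigenvalue_def using 1 by (intro mult_mono) auto
qed

lemma eigenvalue_ge_1:
  assumes "k \<noteq> 0"
  shows "1 \<le> eigenvalue k"
proof -
  obtain j where "k $ j \<noteq> 0" using assms by (auto simp: vec_eq_iff)
  then have "int 1 \<le> \<bar>k $ j\<bar>" by simp
  from eigenvalue_ge[OF this] show ?thesis by simp
qed

lemma eigenvalue_0: "eigenvalue 0 = 0"
  unfolding eigenvalue_def by simp

text \<open>With base 4, \<open>1 + eigenvalue k\<close> is at least \<open>16 ^ l\<close> on shell
  \<open>l\<close> and, in dimension at most three, the shell has at most \<open>27 * 64 ^ l\<close>
  frequencies.\<close>

definition shell :: "nat \<Rightarrow> (int^'d) set" where
  "shell l = (if l = 0 then freq_box 1 else freq_box (4 ^ l) - freq_box (4 ^ (l - 1)))"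

lemma shell_disjoint: "l \<noteq> l' \<Longrightarrow> shell l \<inter> shell l' = {}"
proof -
  have *: "shell l \<inter> shell l' = {}" if "l < l'" for l l'
  proof -
    have "shell l \<subseteq> freq_box (4 ^ l)" unfolding shell_def by auto
    also have "\<dots> \<subseteq> freq_box (4 ^ (l' - 1))"
      using that by (intro freq_box_mono power_increasing) auto
    finally show ?thesis using that unfolding shell_def by auto
  qed
  show "l \<noteq> l' \<Longrightarrow> shell l \<inter> shell l' = {}" using *[of l l'] *[of l' l] by (cases "l < l'") auto
qed

lemma freq_box_subset_shells: "(freq_box n :: (int^'d) set) \<subseteq> (\<Union>l\<le>n. shell l)"
proof -
  have "(freq_box (4 ^ n) :: (int^'d) set) \<subseteq> (\<Union>l\<le>n. shell l)"
  proof (induction n)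
    case 0
    then show ?case by (simp add: shell_def)
  next
    case (Suc n)
    have "(freq_box (4 ^ Suc n) :: (int^'d) set) \<subseteq> freq_box (4 ^ n) \<union> shell (Suc n)" by (auto simp: shell_def simp del: power_Suc)
    also have "\<dots> \<subseteq> (\<Union>l\<le>n. shell l) \<union> shell (Suc n)" by (rule Un_mono[OF Suc order_refl])
    also have "\<dots> = (\<Union>l\<le>Suc n. shell l)" by (auto simp: atMost_Suc)
    finally show ?case .
  qed
  \<comment> \<open>A crude bound is enough: the shells up to the index \<open>n\<close> itself
    already cover \<open>freq_box n\<close>.\<close>
  moreover have "n \<le> 4 ^ n" using less_exp[of n] power_mono[of 2 "4 :: nat" n] by linarith
  ultimately show ?thesis by (rule order_trans[OF freq_box_mono, rotated])
qed

lemma finite_shell: "finite (shell l)"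
  unfolding shell_def using finite_freq_box by auto

lemma shell_eigenvalue:
  assumes "k \<in> shell l"
  shows "16 ^ l \<le> 1 + eigenvalue k"
proof (cases l)
  case 0
  then show ?thesis using eigenvalue_nonneg[of k] by simp
next
  case (Suc m)
  then obtain j where "\<not> \<bar>k $ j\<bar> \<le> int (4 ^ m)" using assms unfolding shell_def freq_box_def by auto
  then have "int (4 ^ m) \<le> \<bar>k $ j\<bar>" by simp
  from eigenvalue_ge[OF this] have "16 * ((4 ^ m) :: real)\<^sup>2 \<le> eigenvalue k" by simp
  moreover have "((4 ^ m) :: real)\<^sup>2 = 16 ^ m" by (simp add: power2_eq_square power_mult_distrib[symmetric])
  ultimately show ?thesis using Suc by simp
qed

lemma card_shell:
  assumes "CARD('d) \<in> {1, 2, 3}"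
  shows "real (card (shell l :: (int^'d) set)) \<le> 27 * 64 ^ l"
proof -
  have "card (shell l :: (int^'d) set) \<le> card (freq_box (4 ^ l) :: (int^'d) set)"
    by (intro card_mono finite_freq_box) (auto simp: shell_def)
  also have "\<dots> = (2 * 4 ^ l + 1) ^ CARD('d)" by (rule card_freq_box)
  also have "\<dots> \<le> (2 * 4 ^ l + 1) ^ 3" using assms by (intro power_increasing) auto
  also have "\<dots> \<le> (3 * 4 ^ l) ^ 3" by (intro power_mono) auto
  also have "\<dots> = 27 * (4 ^ l) ^ 3" by (simp add: power_mult_distrib)
  also have "(4 ^ l) ^ 3 = ((4 :: nat) ^ 3) ^ l" by (simp only: power_mult[symmetric] mult.commute)
  also have "(4 :: nat) ^ 3 = 64" by simp
  finally have "real (card (shell l :: (int^'d) set)) \<le> real (27 * 64 ^ l)" by (rule of_nat_mono)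
  then show ?thesis by simp
qed

text \<open>Counting against size: \<open>64 ^ l / 16 ^ l\<close> grows like \<open>4 ^ l\<close>,
  while \<open>64 ^ l / 256 ^ l\<close> decays like \<open>(1 / 4) ^ l\<close>. The first bounds the
  shell of the Green's function in supremum, the second in \<open>L\<^sup>2\<close>.\<close>

lemma sum_shell_le:
  fixes S :: "(int^'d) set"
  assumes "CARD('d) \<in> {1, 2, 3}" and "S \<subseteq> shell l"
  shows "(\<Sum>k\<in>S. 1 / (1 + eigenvalue k)) \<le> 27 * 4 ^ l"
    and "(\<Sum>k\<in>S. 1 / (1 + eigenvalue k)\<^sup>2) \<le> 27 * (1 / 4) ^ l"
proof -
  have S: "real (card S) \<le> 27 * 64 ^ l"
    using card_mono[OF finite_shell assms(2)] card_shell[OF assms(1), of l] by linarith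
  have e: "16 ^ l \<le> 1 + eigenvalue k" if "k \<in> S" for k
    using shell_eigenvalue assms(2) that by auto
  have p: "(0::real) < 16 ^ l" by simp
  have "(\<Sum>k\<in>S. 1 / (1 + eigenvalue k)) \<le> (\<Sum>k\<in>S. 1 / 16 ^ l)"
    by (intro sum_mono divide_left_mono e mult_pos_pos p) (auto intro: less_le_trans[OF p e])
  also have "\<dots> = card S / 16 ^ l" by simp
  also have "\<dots> \<le> 27 * 64 ^ l / 16 ^ l" by (intro divide_right_mono S) simp
  also have "(64 :: real) ^ l = 4 ^ l * 16 ^ l" by (simp add: power_mult_distrib[symmetric])
  also have "27 * (4 ^ l * 16 ^ l) / 16 ^ l = (27 * 4 ^ l :: real)" by simp
  finally show "(\<Sum>k\<in>S. 1 / (1 + eigenvalue k)) \<le> 27 * 4 ^ l" .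
  have "(\<Sum>k\<in>S. 1 / (1 + eigenvalue k)\<^sup>2) \<le> (\<Sum>k\<in>S. 1 / (16 ^ l)\<^sup>2)"
    by (intro sum_mono divide_left_mono power_mono e mult_pos_pos zero_less_power p) (auto intro: less_le_trans[OF p e])
  also have "\<dots> = card S / (16 ^ l)\<^sup>2" by simp
  also have "\<dots> \<le> 27 * 64 ^ l / (16 ^ l)\<^sup>2" by (intro divide_right_mono S) simp
  also have "(16 ^ l)\<^sup>2 = (256 :: real) ^ l" by (simp add: power2_eq_square power_mult_distrib[symmetric])
  also have "(256 :: real) ^ l = 4 ^ l * 64 ^ l" by (simp add: power_mult_distrib[symmetric])
  also have "27 * 64 ^ l / (4 ^ l * 64 ^ l) = 27 * (1 / 4 :: real) ^ l" by (simp add: power_one_over)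
  finally show "(\<Sum>k\<in>S. 1 / (1 + eigenvalue k)\<^sup>2) \<le> 27 * (1 / 4) ^ l" .
qed

lemma sum_freq_box_shells:
  "(\<Sum>k\<in>freq_box n. f k) = (\<Sum>l\<le>n. \<Sum>k\<in>freq_box n \<inter> shell l. f k)"
proof -
  have "freq_box n = (\<Union>l\<le>n. freq_box n \<inter> shell l)" using freq_box_subset_shells[of n] by auto
  then have "(\<Sum>k\<in>freq_box n. f k) = (\<Sum>k\<in>(\<Union>l\<le>n. freq_box n \<inter> shell l). f k)"
    by (rule sum.cong) (rule refl)
  also have "\<dots> = (\<Sum>l\<le>n. \<Sum>k\<in>freq_box n \<inter> shell l. f k)"
    using shell_disjoint by (intro sum.UNION_disjoint) (auto simp: finite_freq_box)
  finally show ?thesis .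
qed

lemma geometric_sum_le:
  fixes r :: real
  assumes "0 \<le> r" "r < 1"
  shows "(\<Sum>l\<le>n. r ^ l) \<le> 1 / (1 - r)"
proof -
  have "(\<Sum>l\<le>n. r ^ l) \<le> (\<Sum>l. r ^ l)"
    using assms by (intro sum_le_suminf summable_geometric) auto
  also have "\<dots> = 1 / (1 - r)" using assms by (intro suminf_geometric) auto
  finally show ?thesis .
qed

lemma sum_eigenvalue_le:
  assumes "CARD('d) \<in> {1, 2, 3}"
  shows "(\<Sum>k\<in>(freq_box n :: (int^'d) set). 1 / (1 + eigenvalue k)\<^sup>2) \<le> 36"
proof -
  have "(\<Sum>k\<in>(freq_box n :: (int^'d) set). 1 / (1 + eigenvalue k)\<^sup>2) \<le> (\<Sum>l\<le>n. 27 * (1 / 4) ^ l)"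
    unfolding sum_freq_box_shells by (intro sum_mono sum_shell_le(2) assms) auto
  also have "\<dots> = 27 * (\<Sum>l\<le>n. (1 / 4) ^ l)" by (simp add: sum_distrib_left)
  also have "\<dots> \<le> 27 * (1 / (1 - 1 / 4))" by (intro mult_left_mono geometric_sum_le) auto
  finally show ?thesis by simp
qed

lemma integral_sum_hartley_sq:
  assumes "finite S"
  shows "(\<integral>y. (\<Sum>k\<in>S. c k * hartley k y)\<^sup>2 \<partial>torus) = (\<Sum>k\<in>S. (c k)\<^sup>2)"
proof -
  have "(\<integral>y. (\<Sum>k\<in>S. c k * hartley k y)\<^sup>2 \<partial>torus)
      = (\<integral>y. (\<Sum>k\<in>S. \<Sum>l\<in>S. c k * c l * (hartley k y * hartley l y)) \<partial>torus)"
    unfolding power2_eq_square sum_product by (simp add: mult_ac)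
  also have "\<dots> = (\<Sum>k\<in>S. \<Sum>l\<in>S. c k * c l * (\<integral>y. hartley k y * hartley l y \<partial>torus))"
    by (subst Bochner_Integration.integral_sum;
      (intro torus.ess_bounded_integrable ess_bounded_intros ess_bounded_hartley sum.cong refl
        Bochner_Integration.integral_sum[THEN trans])?)+ simp
  also have "\<dots> = (\<Sum>k\<in>S. (c k)\<^sup>2)"
    unfolding hartley_orthonormal using assms
    by (simp add: if_distrib power2_eq_square cong: if_cong)
  finally show ?thesis .
qed

section \<open>The Green's function and completeness\<close>

text \<open>The square of the kernel is at most \<open>108\<^sup>2 * 16 ^ l\<close>, and its
  integral is at most \<open>108 * (1 / 4) ^ l\<close>. Splitting the weight at
  \<open>T = 2 ^ l\<close> leaves \<open>2 ^ l * (1 / 4) ^ l\<close> from small values of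
  \<open>g\<close> and \<open>16 ^ l / T ^ 6 = (1 / 4) ^ l\<close> from large ones. The sixth power
  of \<open>T\<close> beats \<open>16 ^ l\<close>, whence the seventh power of
  \<open>g\<close>.\<close>

lemma green_shell_bound:
  fixes x :: "real^'d"
  assumes d: "CARD('d) \<in> {1, 2, 3}" and S: "S \<subseteq> shell l"
    and g: "ess_bounded torus g" "\<And>y. 0 \<le> g y"
  shows "(\<integral>y. (\<Sum>j\<in>S. hartley j x / (1 + eigenvalue j) * hartley j y)\<^sup>2 * g y \<partial>torus)
    \<le> 11664 * (1 / 2) ^ l * (1 + (\<integral>y. g y ^ 7 \<partial>torus))"
proof -
  define K where "K y = (\<Sum>j\<in>S. hartley j x / (1 + eigenvalue j) * hartley j y)" for y
  define T where "T = (2 :: real) ^ l"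
  define I where "I = (\<integral>y. g y ^ 7 \<partial>torus)"
  have finS: "finite S" using S finite_shell by (rule finite_subset)
  have T: "T > 0" unfolding T_def by simp
  have I: "0 \<le> I" unfolding I_def using g(2) by (intro Bochner_Integration.integral_nonneg) auto
  have eK: "ess_bounded torus K"
    unfolding K_def by (intro ess_bounded_intros ess_bounded_hartley)
  have e1: "0 < 1 + eigenvalue j" for j :: "int^'d" using eigenvalue_nonneg[of j] by linarith
  have sup: "(K y)\<^sup>2 \<le> 11664 * 16 ^ l" for y
  proof -
    have "\<bar>K y\<bar> \<le> (\<Sum>j\<in>S. 4 * (1 / (1 + eigenvalue j)))"
      unfolding K_def
    proof (rule order_trans[OF sum_abs], intro sum_mono)
      fix j
      have "\<bar>hartley j x\<bar> * \<bar>hartley j y\<bar> \<le> 2 * 2" by (intro mult_mono hartley_bound) auto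
      then have "\<bar>hartley j x\<bar> * \<bar>hartley j y\<bar> / (1 + eigenvalue j) \<le> 4 / (1 + eigenvalue j)"
        using e1[of j] by (intro divide_right_mono) auto
      then show "\<bar>hartley j x / (1 + eigenvalue j) * hartley j y\<bar> \<le> 4 * (1 / (1 + eigenvalue j))"
        using e1[of j] by (simp add: abs_mult)
    qed
    also have "\<dots> = 4 * (\<Sum>j\<in>S. 1 / (1 + eigenvalue j))" by (simp add: sum_distrib_left)
    also have "\<dots> \<le> 4 * (27 * 4 ^ l)" by (intro mult_left_mono sum_shell_le(1) d S) auto
    finally have "\<bar>K y\<bar>\<^sup>2 \<le> (4 * (27 * 4 ^ l))\<^sup>2" by (intro power_mono) auto
    moreover have "((4 :: real) ^ l)\<^sup>2 = 16 ^ l" by (simp add: power2_eq_square power_mult_distrib[symmetric])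
    ultimately show ?thesis by (simp add: power_mult_distrib)
  qed
  have L2: "(\<integral>y. (K y)\<^sup>2 \<partial>torus) \<le> 108 * (1 / 4) ^ l"
  proof -
    have "(\<integral>y. (K y)\<^sup>2 \<partial>torus) = (\<Sum>j\<in>S. (hartley j x / (1 + eigenvalue j))\<^sup>2)"
      unfolding K_def by (rule integral_sum_hartley_sq[OF finS])
    also have "\<dots> \<le> (\<Sum>j\<in>S. 4 * (1 / (1 + eigenvalue j)\<^sup>2))"
    proof (rule sum_mono)
      fix j
      have "(hartley j x)\<^sup>2 \<le> 4" using power_mono[OF hartley_bound[of j x], of 2] by simp
      then show "(hartley j x / (1 + eigenvalue j))\<^sup>2 \<le> 4 * (1 / (1 + eigenvalue j)\<^sup>2)"
        by (simp add: power_divide divide_right_mono)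
    qed
    also have "\<dots> = 4 * (\<Sum>j\<in>S. 1 / (1 + eigenvalue j)\<^sup>2)" by (simp add: sum_distrib_left)
    also have "\<dots> \<le> 4 * (27 * (1 / 4) ^ l)" by (intro mult_left_mono sum_shell_le(2) d S) auto
    finally show ?thesis by simp
  qed
  have g_le: "g y \<le> T + g y ^ 7 / T ^ 6" for y
  proof (cases "g y \<le> T")
    case True
    then show ?thesis using g(2)[of y] T by (simp add: add_increasing2)
  next
    case False
    then have "T ^ 6 \<le> g y ^ 6" using T by (intro power_mono) auto
    then have "g y * T ^ 6 \<le> g y * g y ^ 6" using g(2)[of y] by (intro mult_left_mono)
    then have "g y \<le> g y ^ 7 / T ^ 6" using T by (simp add: field_simps eval_nat_numeral)
    then show ?thesis using T by linarith
  qed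
  have "(\<integral>y. (K y)\<^sup>2 * g y \<partial>torus) \<le> (\<integral>y. T * (K y)\<^sup>2 + 11664 * 16 ^ l / T ^ 6 * g y ^ 7 \<partial>torus)"
  proof (intro integral_mono torus.ess_bounded_integrable ess_bounded_intros eK g)
    fix y
    have "(K y)\<^sup>2 * g y \<le> (K y)\<^sup>2 * (T + g y ^ 7 / T ^ 6)" by (intro mult_left_mono g_le) simp
    also have "\<dots> = T * (K y)\<^sup>2 + (K y)\<^sup>2 * (g y ^ 7 / T ^ 6)" by (simp add: algebra_simps)
    also have "\<dots> \<le> T * (K y)\<^sup>2 + 11664 * 16 ^ l * (g y ^ 7 / T ^ 6)"
      using T g(2)[of y] by (intro add_left_mono mult_right_mono sup) auto
    finally show "(K y)\<^sup>2 * g y \<le> T * (K y)\<^sup>2 + 11664 * 16 ^ l / T ^ 6 * g y ^ 7" by simp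
  qed
  also have "\<dots> = T * (\<integral>y. (K y)\<^sup>2 \<partial>torus) + 11664 * 16 ^ l / T ^ 6 * I"
    unfolding I_def
    by (subst Bochner_Integration.integral_add)
      (intro torus.ess_bounded_integrable ess_bounded_intros eK g | simp)+
  also have "\<dots> \<le> T * (108 * (1 / 4) ^ l) + 11664 * 16 ^ l / T ^ 6 * I"
    using T by (intro add_right_mono mult_left_mono L2) auto
  also have "T * (108 * (1 / 4) ^ l) = 108 * (1 / 2) ^ l"
    unfolding T_def by (simp add: power_mult_distrib[symmetric])
  also have "11664 * 16 ^ l / T ^ 6 = 11664 * (1 / 4) ^ l"
  proof -
    have "T ^ 6 = (2 ^ 6) ^ l" unfolding T_def by (simp only: power_mult[symmetric] mult.commute)
    then have "T ^ 6 = 4 ^ l * 16 ^ l" by (simp add: power_mult_distrib[symmetric])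
    then show ?thesis by (simp add: power_one_over)
  qed
  also have "108 * (1 / 2) ^ l + 11664 * (1 / 4) ^ l * I \<le> 11664 * (1 / 2) ^ l + 11664 * (1 / 2) ^ l * I"
    using I by (intro add_mono mult_right_mono mult_left_mono power_mono) auto
  finally show ?thesis unfolding K_def I_def by (simp add: distrib_left)
qed

text \<open>In dimension three the Green's function \<open>\<approx> 1 / |x - y|\<close> is in \<open>L\<^sup>p\<close> only for \<open>p < 3\<close>; the dyadic
  decomposition with a level-dependent truncation of \<open>g\<close> replaces Hoelder's inequality.\<close>

lemma green_bound:
  fixes x :: "real^'d"
  assumes d: "CARD('d) \<in> {1, 2, 3}" and g: "ess_bounded torus g" "\<And>y. 0 \<le> g y"
  shows "(\<integral>y. (\<Sum>j\<in>freq_box n. hartley j x * hartley j y / (1 + eigenvalue j))\<^sup>2 * g y \<partial>torus)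
    \<le> 139968 * (1 + (\<integral>y. g y ^ 7 \<partial>torus))"
proof -
  define K where "K l y = (\<Sum>j\<in>freq_box n \<inter> shell l. hartley j x / (1 + eigenvalue j) * hartley j y)" for l y
  define I where "I = (\<integral>y. g y ^ 7 \<partial>torus)"
  have I: "0 \<le> I" unfolding I_def using g(2) by (intro Bochner_Integration.integral_nonneg) auto
  have eK: "ess_bounded torus (K l)" for l
    unfolding K_def by (intro ess_bounded_intros ess_bounded_hartley)
  have sum_K: "(\<Sum>j\<in>freq_box n. hartley j x * hartley j y / (1 + eigenvalue j)) = (\<Sum>l\<le>n. K l y)" for y
    unfolding K_def sum_freq_box_shells by simp
  \<comment> \<open>The weights \<open>(3 / 2) ^ l\<close> have inverses of total sum at most 3 and
    grow more slowly than the shell bounds \<open>(1 / 2) ^ l\<close> decay; the remaining geometric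
    series has ratio \<open>3 / 4\<close>.\<close>
  have sq: "(\<Sum>l\<le>n. K l y)\<^sup>2 \<le> 3 * (\<Sum>l\<le>n. (3 / 2) ^ l * (K l y)\<^sup>2)" for y
  proof -
    have "sqrt ((2 / 3) ^ l) * sqrt ((3 / 2) ^ l) = 1" for l
      unfolding real_sqrt_mult[symmetric] power_mult_distrib[symmetric] by simp
    then have "(\<Sum>l\<le>n. K l y) = (\<Sum>l\<le>n. sqrt ((2 / 3) ^ l) * (sqrt ((3 / 2) ^ l) * K l y))"
      unfolding mult.assoc[symmetric] by simp
    then have "(\<Sum>l\<le>n. K l y)\<^sup>2 \<le> (\<Sum>l\<le>n. (sqrt ((2 / 3) ^ l))\<^sup>2) * (\<Sum>l\<le>n. (sqrt ((3 / 2) ^ l) * K l y)\<^sup>2)"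
      by (simp only: Cauchy_Schwarz_ineq_sum)
    also have "\<dots> = (\<Sum>l\<le>n. (2 / 3) ^ l) * (\<Sum>l\<le>n. (3 / 2) ^ l * (K l y)\<^sup>2)"
      by (simp add: power_mult_distrib)
    also have "\<dots> \<le> (1 / (1 - 2 / 3)) * (\<Sum>l\<le>n. (3 / 2) ^ l * (K l y)\<^sup>2)"
      by (intro mult_right_mono geometric_sum_le sum_nonneg) auto
    finally show ?thesis by simp
  qed
  have "(\<integral>y. (\<Sum>l\<le>n. K l y)\<^sup>2 * g y \<partial>torus) \<le> (\<integral>y. (3 * (\<Sum>l\<le>n. (3 / 2) ^ l * (K l y)\<^sup>2)) * g y \<partial>torus)"
    by (intro integral_mono torus.ess_bounded_integrable ess_bounded_intros eK g mult_right_mono sq)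
  also have "\<dots> = (\<integral>y. (\<Sum>l\<le>n. 3 * (3 / 2) ^ l * ((K l y)\<^sup>2 * g y)) \<partial>torus)"
    by (simp add: sum_distrib_left sum_distrib_right mult_ac)
  also have "\<dots> = (\<Sum>l\<le>n. (\<integral>y. 3 * (3 / 2) ^ l * ((K l y)\<^sup>2 * g y) \<partial>torus))"
    by (intro Bochner_Integration.integral_sum torus.ess_bounded_integrable ess_bounded_intros eK g)
  also have "\<dots> = (\<Sum>l\<le>n. 3 * (3 / 2) ^ l * (\<integral>y. (K l y)\<^sup>2 * g y \<partial>torus))" by simp
  also have "\<dots> \<le> (\<Sum>l\<le>n. 3 * (3 / 2) ^ l * (11664 * (1 / 2) ^ l * (1 + I)))"
    unfolding K_def I_def by (intro sum_mono mult_left_mono green_shell_bound d g) auto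
  also have "\<dots> = (\<Sum>l\<le>n. 34992 * (1 + I) * (3 / 4) ^ l)"
  proof (intro sum.cong refl)
    fix l
    have e: "(3 / 2) ^ l * (1 / 2) ^ l = (3 / 4 :: real) ^ l" unfolding power_mult_distrib[symmetric] by simp
    have "3 * p * (11664 * q * r) = 34992 * r * (p * q)" for p q r :: real by simp
    then show "3 * (3 / 2) ^ l * (11664 * (1 / 2) ^ l * (1 + I)) = 34992 * (1 + I) * (3 / 4) ^ l"
      unfolding e[symmetric] .
  qed
  also have "\<dots> = 34992 * (1 + I) * (\<Sum>l\<le>n. (3 / 4) ^ l)" by (simp add: sum_distrib_left)
  also have "\<dots> \<le> 34992 * (1 + I) * (1 / (1 - 3 / 4))"
    using I by (intro mult_left_mono geometric_sum_le) auto
  finally show ?thesis unfolding sum_K I_def by simp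
qed

section \<open>Density of trigonometric polynomials\<close>

definition trig_polys :: "(real^'d \<Rightarrow> real) set" where
  "trig_polys = {t. \<exists>n c. \<forall>x. t x = (\<Sum>k\<in>freq_box n. c k * hartley k x)}"

lemma trig_polys_extend:
  fixes c :: "int^'d \<Rightarrow> real"
  assumes "m \<le> n"
  shows "(\<Sum>k\<in>freq_box m. c k * f k) = (\<Sum>k\<in>freq_box n. (if k \<in> freq_box m then c k else 0) * f k)"
  using freq_box_mono[OF assms]
  by (intro sum.mono_neutral_cong_left) (auto simp: finite_freq_box)

lemma trig_polys_add:
  assumes "s \<in> trig_polys" "t \<in> trig_polys"
  shows "(\<lambda>x. s x + t x) \<in> trig_polys"
proof -
  obtain m c where s: "\<And>x. s x = (\<Sum>k\<in>freq_box m. c k * hartley k x)" using assms(1) unfolding trig_polys_def by blast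
  obtain n d where t: "\<And>x. t x = (\<Sum>k\<in>freq_box n. d k * hartley k x)" using assms(2) unfolding trig_polys_def by blast
  have "s x + t x = (\<Sum>k\<in>freq_box (max m n).
      ((if k \<in> freq_box m then c k else 0) + (if k \<in> freq_box n then d k else 0)) * hartley k x)" for x
    unfolding s t trig_polys_extend[OF max.cobounded1[of m n]] trig_polys_extend[OF max.cobounded2[of n m]]
    by (simp only: sum.distrib distrib_right)
  then show ?thesis unfolding trig_polys_def
    by (intro CollectI exI[of _ "max m n"] exI[of _ "\<lambda>k. (if k \<in> freq_box m then c k else 0) + (if k \<in> freq_box n then d k else 0)"]) auto
qed

lemma trig_polys_hartley: "hartley k \<in> trig_polys"
proof -
  obtain n where n: "k \<in> freq_box n" using freq_box_cover by blast
  have "hartley k x = (\<Sum>l\<in>freq_box n. (if l = k then 1 else 0) * hartley l x)" for x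
    using n by (simp add: finite_freq_box if_distrib[of "\<lambda>t. t * _"] cong: if_cong)
  then show ?thesis unfolding trig_polys_def
    by (intro CollectI exI[of _ n] exI[of _ "\<lambda>l. if l = k then 1 else 0"]) auto
qed

lemma trig_polys_scale:
  assumes "s \<in> trig_polys"
  shows "(\<lambda>x. a * s x) \<in> trig_polys"
proof -
  obtain m c where s: "\<And>x. s x = (\<Sum>k\<in>freq_box m. c k * hartley k x)" using assms(1) unfolding trig_polys_def by blast
  have "a * s x = (\<Sum>k\<in>freq_box m. (a * c k) * hartley k x)" for x
    unfolding s by (simp add: sum_distrib_left mult.assoc)
  then show ?thesis unfolding trig_polys_def
    by (intro CollectI exI[of _ m] exI[of _ "\<lambda>k. a * c k"]) auto
qed

lemma trig_polys_const: "(\<lambda>x. a) \<in> trig_polys"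
  using trig_polys_scale[OF trig_polys_hartley[of 0], of a] by (simp add: hartley_def phase_def)

lemma trig_polys_sum:
  "(\<And>i. i \<in> S \<Longrightarrow> s i \<in> trig_polys) \<Longrightarrow> (\<lambda>x. \<Sum>i\<in>S. s i x) \<in> trig_polys"
  by (induction S rule: infinite_finite_induct) (auto intro: trig_polys_const trig_polys_add)

lemma cos_phase_hartley: "cos (phase k x) = (1 / 2) * hartley k x + (1 / 2) * hartley (- k) x"
  unfolding hartley_def phase_minus by (simp add: field_simps)

lemma sin_phase_hartley: "sin (phase k x) = (1 / 2) * hartley (- k) x + (- 1 / 2) * hartley k x"
  unfolding hartley_def phase_minus by (simp add: field_simps)

lemma trig_polys_cos: "(\<lambda>x. cos (phase k x)) \<in> trig_polys"
  unfolding cos_phase_hartley by (intro trig_polys_add trig_polys_scale trig_polys_hartley)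

lemma trig_polys_sin: "(\<lambda>x. sin (phase k x)) \<in> trig_polys"
  unfolding sin_phase_hartley by (intro trig_polys_add trig_polys_scale trig_polys_hartley)

lemma trig_polys_mult:
  assumes "s \<in> trig_polys" "t \<in> trig_polys"
  shows "(\<lambda>x. s x * t x) \<in> trig_polys"
proof -
  obtain m c where s: "\<And>x. s x = (\<Sum>k\<in>freq_box m. c k * hartley k x)" using assms(1) unfolding trig_polys_def by blast
  obtain n d where t: "\<And>x. t x = (\<Sum>k\<in>freq_box n. d k * hartley k x)" using assms(2) unfolding trig_polys_def by blast
  have "s x * t x = (\<Sum>k\<in>freq_box m. \<Sum>l\<in>freq_box n. (c k * d l) * (cos (phase (k - l) x) + (- 1) * sin (phase (k + l) x)))" for x
    unfolding s t sum_product by (simp add: hartley_mult[symmetric] mult_ac)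
  then show ?thesis
    by (simp only:) (intro trig_polys_sum trig_polys_scale trig_polys_add trig_polys_cos trig_polys_sin)
qed

definition circle_map :: "real^'d \<Rightarrow> complex^'d" where
  "circle_map x = (\<chi> j. cis (2 * pi * x $ j))"

lemma phase_axis: "phase (axis j 1) x = 2 * pi * x $ j"
proof -
  have "(\<Sum>i\<in>UNIV. real_of_int (axis j 1 $ i) * x $ i) = (\<Sum>i\<in>UNIV. if i = j then x $ j else 0)"
    by (intro sum.cong) (auto simp: axis_def)
  then show ?thesis unfolding phase_def by simp
qed

text \<open>Linear functionals of the circle coordinates are combinations of first-order cosines and
  sines; sums and products stay in the algebra of trigonometric polynomials.\<close>

lemma real_polynomial_circle_map:
  fixes p :: "complex^'d \<Rightarrow> real"
  assumes "real_polynomial_function p"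
  shows "(\<lambda>x. p (circle_map x)) \<in> trig_polys"
  using assms
proof induction
  case (linear f)
  interpret f: bounded_linear f by fact
  have "f (circle_map x) = (\<Sum>j\<in>UNIV. f (axis j 1) * cos (phase (axis j 1) x) + f (axis j \<i>) * sin (phase (axis j 1) x))" for x
  proof -
    have "circle_map x = (\<Sum>j\<in>UNIV. cos (2 * pi * x $ j) *\<^sub>R axis j 1 + sin (2 * pi * x $ j) *\<^sub>R axis j \<i>)"
      by (auto simp: vec_eq_iff circle_map_def axis_def sum.distrib if_distrib[of "\<lambda>t. _ *\<^sub>R t"]
          complex_eq_iff cong: if_cong)
    then show ?thesis unfolding phase_axis by (simp add: f.sum f.add f.scaleR mult.commute)
  qed
  then show ?case
    by (simp only:) (intro trig_polys_sum trig_polys_scale trig_polys_add trig_polys_cos trig_polys_sin)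
qed (auto intro: trig_polys_const trig_polys_add trig_polys_mult)

text \<open>Equal images force integer coordinate differences, and a coordinate strictly inside the
  unit interval leaves no room for a nonzero one. So only boundary points are identified, and only
  with each other.\<close>

lemma circle_map_eq:
  fixes x y :: "real^'d"
  assumes "x \<in> cube" "y \<in> cube" "circle_map x = circle_map y"
  shows "x = y \<or> (x \<notin> box 0 One \<and> y \<notin> box 0 One)"
proof (rule disjCI)
  assume *: "\<not> (x \<notin> box 0 One \<and> y \<notin> box 0 One)"
  have mem: "z \<in> box 0 One \<longleftrightarrow> (\<forall>j. 0 < z $ j \<and> z $ j < 1)" for z :: "real^'d"
  proof -
    have "z \<in> box 0 One \<longleftrightarrow> (\<forall>i\<in>Basis. 0 < z \<bullet> i \<and> z \<bullet> i < 1)"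
      unfolding mem_box by (intro ball_cong) auto
    then show ?thesis unfolding Basis_vec_real by (simp add: inner_axis)
  qed
  have "x $ j = y $ j" for j
  proof -
    have "cis (2 * pi * x $ j) = cis (2 * pi * y $ j)" using assms(3) by (simp add: circle_map_def vec_eq_iff)
    then have "sin (2 * pi * x $ j) = sin (2 * pi * y $ j) \<and> cos (2 * pi * x $ j) = cos (2 * pi * y $ j)"
      by (simp add: cis.ctr)
    then obtain n :: int where "2 * pi * x $ j = 2 * pi * y $ j + 2 * pi * n" unfolding sin_cos_eq_iff by blast
    then have "2 * pi * (x $ j - y $ j - n) = 0" by (simp add: algebra_simps)
    then have n: "x $ j - y $ j = n" by simp
    have "0 \<le> x $ j" "x $ j \<le> 1" "0 \<le> y $ j" "y $ j \<le> 1" using assms(1,2) by (auto simp: mem_cube)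
    moreover have "(0 < x $ j \<and> x $ j < 1) \<or> (0 < y $ j \<and> y $ j < 1)" using * unfolding mem by blast
    ultimately have "\<bar>real_of_int n\<bar> < 1" unfolding n[symmetric] by linarith
    then have "n = 0" by linarith
    then show ?thesis using n by simp
  qed
  then show "x = y" by (simp add: vec_eq_iff)
qed

lemma compact_cube: "compact (cube :: (real^'d) set)"
  unfolding cube_def by simp

text \<open>Stone--Weierstrass on the product of circles: a function vanishing on the boundary of the cube
  factors through the quotient map \<open>circle_map\<close>.\<close>

lemma trig_polys_dense:
  fixes h :: "real^'d \<Rightarrow> real"
  assumes h: "continuous_on cube h" and h0: "\<And>x. x \<in> cube \<Longrightarrow> x \<notin> box 0 One \<Longrightarrow> h x = 0" and e: "0 < e"
  obtains t where "t \<in> trig_polys" "\<And>x. x \<in> cube \<Longrightarrow> \<bar>h x - t x\<bar> < e"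
proof -
  define S where "S = circle_map ` (cube :: (real^'d) set)"
  define G where "G y = h (SOME x. x \<in> cube \<and> circle_map x = y)" for y
  have cm: "continuous_on A circle_map" for A
    unfolding circle_map_def by (intro continuous_intros)
  have S: "compact S" unfolding S_def by (intro compact_continuous_image cm compact_cube)
  have G: "G (circle_map x) = h x" if x: "x \<in> cube" for x
  proof -
    define z where "z = (SOME z. z \<in> cube \<and> circle_map z = circle_map x)"
    have "\<exists>z. z \<in> cube \<and> circle_map z = circle_map x" using x by blast
    then have z: "z \<in> cube" "circle_map z = circle_map x" unfolding z_def by (metis (mono_tags, lifting) someI_ex)+
    have "h z = h x" using circle_map_eq[OF z(1) x z(2)] h0[OF z(1)] h0[OF x] by auto
    then show ?thesis unfolding G_def z_def[symmetric] .
  qed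
  \<comment> \<open>The preimage of a closed set under \<open>G\<close> is the image of a compact
    set, hence closed; this is the quotient property of \<open>circle_map\<close>.\<close>
  have "continuous_on S G"
    unfolding continuous_on_closed_vimage[OF compact_imp_closed[OF S]]
  proof (intro allI impI)
    fix B :: "real set" assume B: "closed B"
    have "G -` B \<inter> S = circle_map ` (h -` B \<inter> cube)" unfolding S_def using G by auto
    moreover have "closed (h -` B \<inter> cube)"
      using continuous_on_closed_vimage[OF compact_imp_closed[OF compact_cube]] h B by blast
    then have "compact (h -` B \<inter> cube)"
      unfolding compact_eq_bounded_closed
      using bounded_subset[OF compact_imp_bounded[OF compact_cube]] by blast
    ultimately show "closed (G -` B \<inter> S)"
      by (simp add: compact_imp_closed compact_continuous_image cm)
  qed
  from Stone_Weierstrass_real_polynomial_function[OF S this e] obtain p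
    where p: "real_polynomial_function p" "\<And>y. y \<in> S \<Longrightarrow> \<bar>G y - p y\<bar> < e" by blast
  show thesis
  proof (rule that[of "\<lambda>x. p (circle_map x)"])
    show "(\<lambda>x. p (circle_map x)) \<in> trig_polys" by (rule real_polynomial_circle_map[OF p(1)])
    show "\<bar>h x - p (circle_map x)\<bar> < e" if "x \<in> cube" for x
      using p(2)[of "circle_map x"] G[OF that] that unfolding S_def by auto
  qed
qed


text \<open>Measurable functions are almost everywhere limits of continuous ones. Clipping at
  \<open>C'\<close> provides domination, and a cutoff provides the boundary condition of
  \<open>trig_polys_dense\<close>.\<close>

lemma ess_bounded_approx_continuous:
  fixes f :: "real^'d \<Rightarrow> real"
  assumes f: "ess_bounded torus f" and e: "0 < e"
  obtains h where "continuous_on UNIV h" "\<And>x. x \<in> cube \<Longrightarrow> x \<notin> box 0 One \<Longrightarrow> h x = 0"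
    "(\<integral>x. (f x - h x)\<^sup>2 \<partial>torus) < e"
proof -
  obtain C where C: "AE x in torus. \<bar>f x\<bar> \<le> C" using f unfolding ess_bounded_def by blast
  define C' where "C' = max 0 C"
  have "(\<lambda>x. indicator cube x *\<^sub>R f x) \<in> borel_measurable lborel"
    using ess_bounded_measurable[OF f] unfolding torus_def
    by (subst (asm) borel_measurable_restrict_space_iff) auto
  then have "(\<lambda>x. indicator cube x *\<^sub>R f x) \<in> borel_measurable lebesgue"
    by (rule measurable_completion)
  then have "(\<lambda>x. indicator cube x *\<^sub>R f x) measurable_on UNIV"
    by (intro lebesgue_measurable_imp_measurable_on) auto
  then obtain N g where N: "negligible N" and g: "\<And>n :: nat. continuous_on UNIV (g n)"
    and lim: "\<And>x. x \<notin> N \<Longrightarrow> (\<lambda>n. g n x) \<longlonglongrightarrow> indicator cube x *\<^sub>R f x"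
    unfolding measurable_on_def by auto
  \<comment> \<open>Continuous, zero off the open cube, and eventually 1 at each interior
    point.\<close>
  define cutoff where "cutoff n x = min 1 (real n * infdist x (- box 0 One))" for n and x :: "real^'d"
  define h where "h n x = cutoff n x * max (- C') (min C' (g n x))" for n x
  have cutoff01: "0 \<le> cutoff n x" "cutoff n x \<le> 1" for n x
    unfolding cutoff_def by (auto intro!: mult_nonneg_nonneg infdist_nonneg)
  have h_cont: "continuous_on UNIV (h n)" for n
    unfolding h_def cutoff_def by (intro continuous_intros g)
  have h_zero: "h n x = 0" if "x \<notin> box 0 One" for n x
    using that unfolding h_def cutoff_def by simp
  have C0: "0 \<le> C'" unfolding C'_def by simp
  have h_bd: "\<bar>h n x\<bar> \<le> C'" for n x
  proof -
    have "\<bar>h n x\<bar> \<le> 1 * C'"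
      unfolding h_def abs_mult using cutoff01[of n x] C0 by (intro mult_mono) auto
    then show ?thesis by simp
  qed
  have ebh: "ess_bounded torus (h n)" for n
    by (rule ess_boundedI[where C = C'])
      (auto intro!: borel_measurable_torus borel_measurable_continuous_onI h_cont simp: h_bd)
  have AE_N: "AE x in torus. x \<notin> N \<union> (cube - box 0 One)"
  proof -
    have "negligible (N \<union> (cube - box 0 One))"
      unfolding cube_def using N negligible_frontier_interval by (rule negligible_Un)
    then have "N \<union> (cube - box 0 One) \<in> null_sets lebesgue" by (simp add: negligible_iff_null_sets)
    then have "AE x in lebesgue. x \<notin> N \<union> (cube - box 0 One)" by (rule AE_not_in)
    then have "AE x in lborel. x \<notin> N \<union> (cube - box 0 One)" by (simp add: AE_completion_iff)
    then show ?thesis unfolding AE_torus by eventually_elim auto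
  qed
  have h_lim: "AE x in torus. (\<lambda>n. (f x - h n x)\<^sup>2) \<longlonglongrightarrow> 0"
    using AE_N C AE_space
  proof eventually_elim
    case (elim x)
    then have x: "x \<in> cube" "x \<in> box 0 One" "x \<notin> N" by (auto simp: space_torus)
    have "closed (- box 0 One :: (real^'d) set)" by (simp add: closed_Compl open_box)
    moreover have "(0 :: real^'d) \<in> - box 0 One" using nonempty_Basis by (auto simp: mem_box)
    then have "- box 0 One \<noteq> ({} :: (real^'d) set)" by blast
    ultimately have "infdist x (- box 0 One) \<noteq> 0" using x in_closed_iff_infdist_zero by blast
    then have pos: "0 < infdist x (- box 0 One)" using infdist_nonneg[of x] by (simp add: less_le)
    obtain m :: nat where m: "1 < real m * infdist x (- box 0 One)" using reals_Archimedean3[OF pos] by blast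
    have "eventually (\<lambda>n. cutoff n x = 1) sequentially"
      using eventually_ge_at_top[of m]
    proof eventually_elim
      case (elim n)
      then have "real m * infdist x (- box 0 One) \<le> real n * infdist x (- box 0 One)"
        using pos by (intro mult_right_mono) auto
      then show ?case unfolding cutoff_def using m by simp
    qed
    then have c1: "(\<lambda>n. cutoff n x) \<longlonglongrightarrow> 1" by (rule tendsto_eventually)
    have "(\<lambda>n. g n x) \<longlonglongrightarrow> f x" using lim[OF x(3)] x(1) by simp
    then have "(\<lambda>n. h n x) \<longlonglongrightarrow> 1 * max (- C') (min C' (f x))"
      unfolding h_def by (intro tendsto_intros c1)
    moreover have "max (- C') (min C' (f x)) = f x" using elim(2) unfolding C'_def by auto
    ultimately have "(\<lambda>n. (f x - h n x)\<^sup>2) \<longlonglongrightarrow> (f x - f x)\<^sup>2" by (intro tendsto_intros) simp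
    then show ?case by simp
  qed
  have "(\<lambda>n. \<integral>x. (f x - h n x)\<^sup>2 \<partial>torus) \<longlonglongrightarrow> (\<integral>x. 0 \<partial>(torus :: (real^'d) measure))"
  proof (rule integral_dominated_convergence[where w = "\<lambda>_. (2 * C')\<^sup>2"])
    show "(\<lambda>x. (f x - h n x)\<^sup>2) \<in> borel_measurable torus" for n
      by (intro ess_bounded_measurable ess_bounded_intros f ebh)
    show "AE x in torus. norm ((f x - h n x)\<^sup>2) \<le> (2 * C')\<^sup>2" for n
      using C
    proof eventually_elim
      case (elim x)
      then have "\<bar>f x - h n x\<bar> \<le> 2 * C'" using h_bd[of n x] unfolding C'_def by linarith
      then have "\<bar>f x - h n x\<bar>\<^sup>2 \<le> (2 * C')\<^sup>2" by (intro power_mono) auto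
      then show ?case by simp
    qed
  qed (use h_lim in auto)
  then have "(\<lambda>n. \<integral>x. (f x - h n x)\<^sup>2 \<partial>torus) \<longlonglongrightarrow> 0" by simp
  from order_tendstoD(2)[OF this e] obtain n where "(\<integral>x. (f x - h n x)\<^sup>2 \<partial>torus) < e"
    unfolding eventually_sequentially by blast
  then show thesis using h_cont h_zero by (intro that[of "h n"]) auto
qed

lemma ess_bounded_approx_trig:
  fixes f :: "real^'d \<Rightarrow> real"
  assumes f: "ess_bounded torus f" and e: "0 < e"
  obtains n c where "(\<integral>x. (f x - (\<Sum>k\<in>freq_box n. c k * hartley k x))\<^sup>2 \<partial>torus) < e"
proof -
  have "0 < e / 4" using e by simp
  then obtain h where h: "continuous_on UNIV h" "\<And>x. x \<in> cube \<Longrightarrow> x \<notin> box 0 One \<Longrightarrow> h x = 0"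
    "(\<integral>x. (f x - h x)\<^sup>2 \<partial>torus) < e / 4"
    using ess_bounded_approx_continuous[OF f] by blast
  have "0 < sqrt (e / 4)" using e by simp
  then obtain t where t: "t \<in> trig_polys" "\<And>x. x \<in> cube \<Longrightarrow> \<bar>h x - t x\<bar> < sqrt (e / 4)"
    using trig_polys_dense[OF continuous_on_subset[OF h(1)] h(2)] by (metis top_greatest)
  obtain n c where nc: "\<And>x. t x = (\<Sum>k\<in>freq_box n. c k * hartley k x)" using t(1) unfolding trig_polys_def by blast
  obtain D where D: "\<And>x. x \<in> cube \<Longrightarrow> \<bar>h x\<bar> \<le> D"
  proof -
    have "compact (h ` cube)" by (intro compact_continuous_image continuous_on_subset[OF h(1)] compact_cube) simp
    then show ?thesis using that unfolding compact_eq_bounded_closed bounded_real by auto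
  qed
  have ebh: "ess_bounded torus h"
    by (rule ess_boundedI[where C = D])
      (auto intro!: borel_measurable_torus borel_measurable_continuous_onI h AE_I2 D simp: space_torus)
  have ebt: "ess_bounded torus t"
    unfolding nc by (intro ess_bounded_intros ess_bounded_hartley)
  have "(\<integral>x. (f x - t x)\<^sup>2 \<partial>torus) \<le> (\<integral>x. 2 * (f x - h x)\<^sup>2 + e / 2 \<partial>torus)"
  proof (intro integral_mono torus.ess_bounded_integrable ess_bounded_intros f ebh ebt)
    fix x :: "real^'d" assume "x \<in> space torus"
    then have x: "x \<in> cube" by (simp add: space_torus)
    have "\<bar>h x - t x\<bar>\<^sup>2 \<le> (sqrt (e / 4))\<^sup>2" using t(2)[OF x] by (intro power_mono) auto
    then have "(h x - t x)\<^sup>2 \<le> e / 4" using e by simp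
    moreover have "(f x - t x)\<^sup>2 \<le> 2 * (f x - h x)\<^sup>2 + 2 * (h x - t x)\<^sup>2"
      using power2_sum_le[of "f x - h x" "h x - t x"] by simp
    ultimately show "(f x - t x)\<^sup>2 \<le> 2 * (f x - h x)\<^sup>2 + e / 2" by linarith
  qed
  also have "\<dots> = 2 * (\<integral>x. (f x - h x)\<^sup>2 \<partial>torus) + e / 2"
    by (subst Bochner_Integration.integral_add)
      (intro torus.ess_bounded_integrable ess_bounded_intros f ebh | simp add: torus.prob_space)+
  also have "\<dots> < e" using h(3) by simp
  finally show thesis using that unfolding nc by blast
qed

text \<open>The last sum is the excess of an arbitrary \<open>c\<close> over the best approximation,
  so the identity yields both Bessel's inequality and optimality of the Fourier
  coefficients.\<close>

lemma hartley_projection: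
  fixes f :: "real^'d \<Rightarrow> real"
  assumes f: "ess_bounded torus f"
  shows "(\<integral>x. (f x - (\<Sum>k\<in>freq_box n. c k * hartley k x))\<^sup>2 \<partial>torus)
    = (\<integral>x. (f x)\<^sup>2 \<partial>torus) - (\<Sum>k\<in>freq_box n. (\<integral>x. f x * hartley k x \<partial>torus)\<^sup>2)
      + (\<Sum>k\<in>freq_box n. (c k - (\<integral>x. f x * hartley k x \<partial>torus))\<^sup>2)"
proof -
  define a where "a k = (\<integral>x. f x * hartley k x \<partial>torus)" for k
  define t where "t x = (\<Sum>k\<in>freq_box n. c k * hartley k x)" for x :: "real^'d"
  have et: "ess_bounded torus t" unfolding t_def by (intro ess_bounded_intros ess_bounded_hartley)
  have "(\<integral>x. f x * t x \<partial>torus) = (\<integral>x. (\<Sum>k\<in>freq_box n. c k * (f x * hartley k x)) \<partial>torus)"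
    unfolding t_def sum_distrib_left by (simp add: mult_ac)
  also have "\<dots> = (\<Sum>k\<in>freq_box n. \<integral>x. c k * (f x * hartley k x) \<partial>torus)"
    by (intro Bochner_Integration.integral_sum torus.ess_bounded_integrable ess_bounded_intros ess_bounded_hartley f)
  finally have ft: "(\<integral>x. f x * t x \<partial>torus) = (\<Sum>k\<in>freq_box n. c k * a k)" unfolding a_def by simp
  have "(\<integral>x. (f x - t x)\<^sup>2 \<partial>torus) = (\<integral>x. (f x)\<^sup>2 - 2 * (f x * t x) + (t x)\<^sup>2 \<partial>torus)"
    by (intro Bochner_Integration.integral_cong) (auto simp: power2_eq_square algebra_simps)
  also have "\<dots> = (\<integral>x. (f x)\<^sup>2 \<partial>torus) - 2 * (\<integral>x. f x * t x \<partial>torus) + (\<integral>x. (t x)\<^sup>2 \<partial>torus)"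
    by (subst Bochner_Integration.integral_add Bochner_Integration.integral_diff;
        (intro Bochner_Integration.integrable_diff torus.ess_bounded_integrable ess_bounded_intros f et)?)+ simp
  also have "(\<integral>x. (t x)\<^sup>2 \<partial>torus) = (\<Sum>k\<in>freq_box n. (c k)\<^sup>2)"
    unfolding t_def by (rule integral_sum_hartley_sq[OF finite_freq_box])
  also have "(\<integral>x. (f x)\<^sup>2 \<partial>torus) - 2 * (\<integral>x. f x * t x \<partial>torus) + (\<Sum>k\<in>freq_box n. (c k)\<^sup>2)
      = (\<integral>x. (f x)\<^sup>2 \<partial>torus) - (\<Sum>k\<in>freq_box n. (a k)\<^sup>2) + (\<Sum>k\<in>freq_box n. (c k - a k)\<^sup>2)"
    unfolding ft by (simp add: power2_diff sum.distrib sum_subtractf sum_distrib_left mult_ac)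
  finally show ?thesis unfolding a_def t_def .
qed

text \<open>The partial sums increase and obey Bessel's inequality; some trigonometric polynomial
  has squared distance below \<open>e\<close>, and the projection onto its frequency box is at least
  as close.\<close>

lemma hartley_parseval:
  fixes f :: "real^'d \<Rightarrow> real"
  assumes f: "ess_bounded torus f"
  shows "(\<lambda>n. \<Sum>k\<in>freq_box n. (\<integral>x. f x * hartley k x \<partial>torus)\<^sup>2) \<longlonglongrightarrow> (\<integral>x. (f x)\<^sup>2 \<partial>torus)"
proof -
  define S where "S n = (\<Sum>k\<in>(freq_box n :: (int^'d) set). (\<integral>x. f x * hartley k x \<partial>torus)\<^sup>2)" for n
  have le: "S n \<le> (\<integral>x. (f x)\<^sup>2 \<partial>torus)" for n
  proof -
    have "0 \<le> (\<integral>x. (f x - (\<Sum>k\<in>freq_box n. (\<integral>x. f x * hartley k x \<partial>torus) * hartley k x))\<^sup>2 \<partial>torus)" by simp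
    then show ?thesis unfolding hartley_projection[OF f] S_def by simp
  qed
  have "\<exists>N. \<forall>n\<ge>N. norm (S n - (\<integral>x. (f x)\<^sup>2 \<partial>torus)) < e" if e: "0 < e" for e
  proof -
    obtain N c where N: "(\<integral>x. (f x - (\<Sum>k\<in>freq_box N. c k * hartley k x))\<^sup>2 \<partial>torus) < e"
      using ess_bounded_approx_trig[OF f e] by blast
    have "(\<integral>x. (f x)\<^sup>2 \<partial>torus) - S N < e"
      using N sum_nonneg[of "freq_box N" "\<lambda>k. (c k - (\<integral>x. f x * hartley k x \<partial>torus))\<^sup>2"]
      unfolding hartley_projection[OF f] S_def by simp
    moreover have "S N \<le> S n" if "N \<le> n" for n
      unfolding S_def by (intro sum_mono2 finite_freq_box freq_box_mono that) auto
    ultimately have "norm (S n - (\<integral>x. (f x)\<^sup>2 \<partial>torus)) < e" if "N \<le> n" for n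
      using le[of n] that by (smt (verit) real_norm_def)
    then show ?thesis by blast
  qed
  then show ?thesis unfolding S_def LIMSEQ_iff by blast
qed

theorem galerkin_basis_torus:
  assumes d: "CARD('d) \<in> {1, 2, 3}"
  shows "galerkin_basis (torus :: (real^'d) measure) freq_box hartley eigenvalue 0 36 139968"
proof -
  interpret torus: prob_space "torus :: (real^'d) measure" by (rule prob_space_torus)
  show ?thesis
  proof
    show "(\<integral>y. (\<Sum>j\<in>freq_box n. hartley j x * hartley j y / (1 + eigenvalue j))\<^sup>2 * g y \<partial>torus)
        \<le> 139968 * (1 + (\<integral>y. g y ^ 7 \<partial>torus))"
      if "ess_bounded torus g" "\<And>y. 0 \<le> g y" for g n and x :: "real^'d"
      by (rule green_bound[OF d that])
    show "(\<lambda>n. \<Sum>k\<in>freq_box n. (\<integral>x. f x * hartley k x \<partial>torus)\<^sup>2) \<longlonglongrightarrow> (\<integral>x. (f x)\<^sup>2 \<partial>torus)"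
      if "ess_bounded torus f" for f :: "real^'d \<Rightarrow> real"
      by (rule hartley_parseval[OF that])
  qed (auto simp: finite_freq_box zero_in_freq_box freq_box_cover hartley_bound hartley_orthonormal
      eigenvalue_0 eigenvalue_ge_1 sum_eigenvalue_le[OF d] hartley_def[of 0] phase_def[of 0]
      dest: subsetD[OF freq_box_mono] intro: borel_measurable_torus)
qed

section \<open>Noise and nonlinearity\<close>

context prob_space
begin

text \<open>Written with \<open>sigma_sets\<close> to match what \<open>indep_vars\<close> unfolds
  to.\<close>

definition preimages :: "('i \<Rightarrow> 'a \<Rightarrow> real) \<Rightarrow> 'i \<Rightarrow> 'a set set" where
  "preimages X p = sigma_sets (space M) {X p -` A \<inter> space M | A. A \<in> sets borel}"

definition generated :: "('i \<Rightarrow> 'a \<Rightarrow> real) \<Rightarrow> 'i set \<Rightarrow> 'a measure" where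
  "generated X I = sigma (space M) (\<Union>p\<in>I. preimages X p)"

lemma preimages_subset: "preimages X p \<subseteq> Pow (space M)"
  unfolding preimages_def by (rule sigma_sets_into_sp[THEN subsetI[of _ "Pow _", unfolded Pow_iff]]) auto

lemma space_generated: "space (generated X I) = space M"
  unfolding generated_def by (simp add: space_measure_of_conv)

lemma sets_generated: "sets (generated X I) = sigma_sets (space M) (\<Union>p\<in>I. preimages X p)"
  unfolding generated_def by (intro sets_measure_of UN_least preimages_subset)

lemma generated_mono: "I \<subseteq> I' \<Longrightarrow> sets (generated X I) \<subseteq> sets (generated X I')"
  unfolding sets_generated by (intro sigma_sets_mono') auto

lemma generated_measurable:
  assumes "p \<in> I"
  shows "X p \<in> borel_measurable (generated X I)"
proof (rule measurableI)
  fix A :: "real set" assume "A \<in> sets borel"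
  then have "X p -` A \<inter> space M \<in> preimages X p"
    unfolding preimages_def by (intro sigma_sets.Basic) auto
  then show "X p -` A \<inter> space (generated X I) \<in> sets (generated X I)"
    unfolding space_generated sets_generated using assms by (intro sigma_sets.Basic) auto
qed simp

lemma generated_subset:
  assumes "\<And>p. p \<in> I \<Longrightarrow> X p \<in> borel_measurable M"
  shows "sets (generated X I) \<subseteq> sets M"
proof -
  have "preimages X p \<subseteq> sets M" if "p \<in> I" for p
    unfolding preimages_def
    by (rule sets.sigma_sets_subset) (auto intro: measurable_sets[OF assms[OF that]])
  then show ?thesis
    unfolding sets_generated by (intro sets.sigma_sets_subset) blast
qed

text \<open>The identity map is regarded as a random variable with values in \<open>F\<close> and,
  separately, in \<open>G\<close>. Independence of the two generated sigma-algebras makes the law of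
  the diagonal map the product of their laws, and Fubini's theorem for that product gives the
  claim.\<close>

lemma generated_fubini:
  assumes indep: "indep_vars (\<lambda>_. borel) X L" and I: "I \<subseteq> L" "I' \<subseteq> L" "I \<inter> I' = {}"
    and h: "h \<in> borel_measurable (generated X I \<Otimes>\<^sub>M generated X I')"
  shows "(\<integral>\<^sup>+\<omega>. h (\<omega>, \<omega>) \<partial>M) = (\<integral>\<^sup>+\<omega>. (\<integral>\<^sup>+\<omega>'. h (\<omega>, \<omega>') \<partial>M) \<partial>M)"
proof -
  define F G where "F = generated X I" and "G = generated X I'"
  have rv: "X p \<in> borel_measurable M" if "p \<in> L" for p
    using indep that unfolding indep_vars_def by auto
  have FM: "sets F \<subseteq> sets M" "sets G \<subseteq> sets M"
    unfolding F_def G_def by (rule generated_subset, rule rv, use I in blast)+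
  have idF: "(\<lambda>\<omega>. \<omega>) \<in> measurable M F" and idG: "(\<lambda>\<omega>. \<omega>) \<in> measurable M G"
    using FM by (auto simp: measurable_def F_def G_def space_generated)
  have "indep_sets (preimages X) L"
    using indep unfolding indep_vars_def preimages_def by simp
  then have "indep_sets (preimages X) (\<Union>j\<in>UNIV. case_bool I I' j)"
    by (rule indep_sets_mono_index[rotated]) (use I in \<open>auto split: bool.splits\<close>)
  then have "indep_sets (\<lambda>j. sigma_sets (space M) (\<Union>i\<in>case_bool I I' j. preimages X i)) UNIV"
  proof (rule indep_sets_collect_sigma)
    show "Int_stable (preimages X i)" for i
    proof -
      have "sigma_algebra (space M) (preimages X i)"
        unfolding preimages_def by (rule sigma_algebra_sigma_sets) auto
      then interpret sigma_algebra "space M" "preimages X i" .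
      show ?thesis by (rule Int_stableI) auto
    qed
    show "disjoint_family_on (case_bool I I') UNIV"
      using I(3) by (auto simp: disjoint_family_on_def split: bool.splits)
  qed
  also have "(\<lambda>j. sigma_sets (space M) (\<Union>i\<in>case_bool I I' j. preimages X i)) = case_bool (sets F) (sets G)"
    unfolding F_def G_def sets_generated by (auto split: bool.splits)
  finally have "indep_set (sets F) (sets G)" unfolding indep_set_def .
  moreover have "sigma_sets (space M) {(\<lambda>\<omega>. \<omega>) -` A \<inter> space M | A. A \<in> sets N} = sets N"
    if "space N = space M" for N :: "'a measure"
  proof -
    have "(\<lambda>\<omega>. \<omega>) -` A \<inter> space M = A" if "A \<in> sets N" for A
      using sets.sets_into_space[OF that] \<open>space N = space M\<close> by auto
    then have "{(\<lambda>\<omega>. \<omega>) -` A \<inter> space M | A. A \<in> sets N} = sets N"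
      unfolding setcompr_eq_image by simp
    then show ?thesis using sets.sigma_sets_eq[of N] that by simp
  qed
  ultimately have "indep_var F (\<lambda>\<omega>. \<omega>) G (\<lambda>\<omega>. \<omega>)"
    unfolding indep_var_eq using idF idG by (simp add: F_def G_def space_generated)
  then have eq: "distr M F (\<lambda>\<omega>. \<omega>) \<Otimes>\<^sub>M distr M G (\<lambda>\<omega>. \<omega>) = distr M (F \<Otimes>\<^sub>M G) (\<lambda>\<omega>. (\<omega>, \<omega>))"
    unfolding indep_var_distribution_eq by simp
  interpret F: prob_space "distr M F (\<lambda>\<omega>. \<omega>)" by (rule prob_space_distr[OF idF])
  interpret G: prob_space "distr M G (\<lambda>\<omega>. \<omega>)" by (rule prob_space_distr[OF idG])
  interpret FG: pair_sigma_finite "distr M F (\<lambda>\<omega>. \<omega>)" "distr M G (\<lambda>\<omega>. \<omega>)" ..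
  have h': "h \<in> borel_measurable (F \<Otimes>\<^sub>M G)" using h unfolding F_def G_def .
  have h'': "h \<in> borel_measurable (distr M F (\<lambda>\<omega>. \<omega>) \<Otimes>\<^sub>M distr M G (\<lambda>\<omega>. \<omega>))"
    using h' by (subst measurable_cong_sets[OF sets_pair_measure_cong refl]) auto
  have sec: "(\<lambda>\<omega>'. h (\<omega>, \<omega>')) \<in> borel_measurable G" if "\<omega> \<in> space M" for \<omega>
    by (rule measurable_compose[OF measurable_Pair1' h']) (use that in \<open>simp add: F_def space_generated\<close>)
  have inner: "(\<integral>\<^sup>+\<omega>'. h (\<omega>, \<omega>') \<partial>distr M G (\<lambda>\<omega>. \<omega>)) = (\<integral>\<^sup>+\<omega>'. h (\<omega>, \<omega>') \<partial>M)" if "\<omega> \<in> space M" for \<omega>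
    by (rule nn_integral_distr[OF idG]) (use sec[OF that] in simp)
  have "(\<integral>\<^sup>+\<omega>. h (\<omega>, \<omega>) \<partial>M) = (\<integral>\<^sup>+p. h p \<partial>distr M (F \<Otimes>\<^sub>M G) (\<lambda>\<omega>. (\<omega>, \<omega>)))"
    by (subst nn_integral_distr[OF measurable_Pair[OF idF idG]]) (use h' in auto)
  also have "\<dots> = (\<integral>\<^sup>+\<omega>. (\<integral>\<^sup>+\<omega>'. h (\<omega>, \<omega>') \<partial>distr M G (\<lambda>\<omega>. \<omega>)) \<partial>distr M F (\<lambda>\<omega>. \<omega>))"
    unfolding eq[symmetric] by (rule G.nn_integral_fst[OF h'', symmetric])
  also have "\<dots> = (\<integral>\<^sup>+\<omega>. (\<integral>\<^sup>+\<omega>'. h (\<omega>, \<omega>') \<partial>distr M G (\<lambda>\<omega>. \<omega>)) \<partial>M)"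
    by (rule nn_integral_distr[OF idF]) (use G.borel_measurable_nn_integral_fst[OF h''] in simp)
  also have "\<dots> = (\<integral>\<^sup>+\<omega>. (\<integral>\<^sup>+\<omega>'. h (\<omega>, \<omega>') \<partial>M) \<partial>M)"
    by (intro nn_integral_cong inner)
  finally show ?thesis .
qed

lemma std_normal_mgf:
  assumes X: "distributed M lborel X std_normal_density"
  shows "(\<integral>\<^sup>+\<omega>. ennreal (exp (a * X \<omega>)) \<partial>M) = ennreal (exp (a\<^sup>2 / 2))"
proof -
  have "(\<integral>\<^sup>+\<omega>. ennreal (exp (a * X \<omega>)) \<partial>M) = (\<integral>\<^sup>+x. ennreal (std_normal_density x) * ennreal (exp (a * x)) \<partial>lborel)"
    by (rule distributed_nn_integral[OF X, symmetric]) simp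
  also have "\<dots> = (\<integral>\<^sup>+x. ennreal (exp (a\<^sup>2 / 2)) * ennreal (normal_density a 1 x) \<partial>lborel)"
  proof (rule nn_integral_cong)
    fix x :: real
    have "- x\<^sup>2 / 2 + a * x = a\<^sup>2 / 2 + - (x - a)\<^sup>2 / 2"
      by (simp add: power2_eq_square field_simps)
    then have "exp (- x\<^sup>2 / 2) * exp (a * x) = exp (a\<^sup>2 / 2) * exp (- (x - a)\<^sup>2 / 2)"
      by (simp only: exp_add[symmetric])
    then have "std_normal_density x * exp (a * x) = exp (a\<^sup>2 / 2) * normal_density a 1 x"
      unfolding std_normal_density_def normal_density_def by simp
    then show "ennreal (std_normal_density x) * ennreal (exp (a * x)) = ennreal (exp (a\<^sup>2 / 2)) * ennreal (normal_density a 1 x)"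
      by (simp add: ennreal_mult'[symmetric])
  qed
  also have "\<dots> = ennreal (exp (a\<^sup>2 / 2)) * (\<integral>\<^sup>+x. ennreal (normal_density a 1 x) \<partial>lborel)"
    by (intro nn_integral_cmult) simp
  also have "(\<integral>\<^sup>+x. ennreal (normal_density a 1 x) \<partial>lborel) = 1"
    by (subst nn_integral_eq_integral) auto
  finally show ?thesis by simp
qed

text \<open>The past of layer \<open>i\<close> consists of all noises of smaller index and is
  trivial for \<open>i = 0\<close>; the fresh noise has index \<open>i\<close>.\<close>

lemma independent_noise_generated:
  fixes \<xi> :: "nat \<Rightarrow> 'k \<Rightarrow> 'a \<Rightarrow> real"
  assumes indep: "indep_vars (\<lambda>_. borel) (\<lambda>(i, k). \<xi> i k) ({..J} \<times> UNIV)"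
    and gauss: "\<forall>i\<le>J. \<forall>k. distributed M lborel (\<xi> i k) std_normal_density"
    and i: "i \<le> J"
  shows "independent_noise M (generated (\<lambda>(i, k). \<xi> i k) ({..<i} \<times> UNIV))
    (generated (\<lambda>(i, k). \<xi> i k) ({i} \<times> UNIV)) (\<xi> i)"
proof
  let ?X = "\<lambda>(i, k). \<xi> i k"
  have rv: "?X p \<in> borel_measurable M" if "p \<in> {..J} \<times> UNIV" for p
    using indep that unfolding indep_vars_def by auto
  show "space (generated ?X ({..<i} \<times> UNIV)) = space M" "space (generated ?X ({i} \<times> UNIV)) = space M"
    by (rule space_generated)+
  show "sets (generated ?X ({..<i} \<times> UNIV)) \<subseteq> sets M"
    by (rule generated_subset, rule rv) (use i in auto)
  show "sets (generated ?X ({i} \<times> UNIV)) \<subseteq> sets M"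
    by (rule generated_subset, rule rv) (use i in auto)
  show "\<xi> i k \<in> borel_measurable (generated ?X ({i} \<times> UNIV))" for k
    using generated_measurable[of "(i, k)" "{i} \<times> UNIV" ?X] by simp
  show "(\<integral>\<^sup>+\<omega>. h (\<omega>, \<omega>) \<partial>M) = (\<integral>\<^sup>+\<omega>. (\<integral>\<^sup>+\<omega>'. h (\<omega>, \<omega>') \<partial>M) \<partial>M)"
    if "h \<in> borel_measurable (generated ?X ({..<i} \<times> UNIV) \<Otimes>\<^sub>M generated ?X ({i} \<times> UNIV))" for h
    by (rule generated_fubini[OF indep _ _ _ that]) (use i in auto)
  show "(\<integral>\<^sup>+\<omega>. ennreal (exp (\<Sum>k\<in>S. a k * \<xi> i k \<omega>)) \<partial>M) = ennreal (exp ((\<Sum>k\<in>S. (a k)\<^sup>2) / 2))"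
    if S: "finite S" for S a
  proof -
    have inj: "inj_on (Pair i) S" by (auto intro: inj_onI)
    have "indep_vars (\<lambda>_. borel) ?X ({i} \<times> S)"
      by (rule indep_vars_subset[OF indep]) (use i in auto)
    then have ind: "indep_vars (\<lambda>_. borel) (\<lambda>p \<omega>. ennreal (exp (a (snd p) * ?X p \<omega>))) ({i} \<times> S)"
      by (rule indep_vars_compose2[where Y = "\<lambda>p x. ennreal (exp (a (snd p) * x))"]) simp
    have "(\<integral>\<^sup>+\<omega>. ennreal (exp (\<Sum>k\<in>S. a k * \<xi> i k \<omega>)) \<partial>M)
        = (\<integral>\<^sup>+\<omega>. (\<Prod>p\<in>{i} \<times> S. ennreal (exp (a (snd p) * ?X p \<omega>))) \<partial>M)"
    proof (rule nn_integral_cong)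
      fix \<omega>
      have "{i} \<times> S = Pair i ` S" by auto
      then have "(\<Prod>p\<in>{i} \<times> S. ennreal (exp (a (snd p) * ?X p \<omega>))) = (\<Prod>k\<in>S. ennreal (exp (a k * \<xi> i k \<omega>)))"
        by (simp add: prod.reindex[OF inj])
      also have "\<dots> = ennreal (exp (\<Sum>k\<in>S. a k * \<xi> i k \<omega>))"
        unfolding exp_sum[OF S] by (rule prod_ennreal) simp
      finally show "ennreal (exp (\<Sum>k\<in>S. a k * \<xi> i k \<omega>)) = (\<Prod>p\<in>{i} \<times> S. ennreal (exp (a (snd p) * ?X p \<omega>)))" by simp
    qed
    also have "\<dots> = (\<Prod>p\<in>{i} \<times> S. \<integral>\<^sup>+\<omega>. ennreal (exp (a (snd p) * ?X p \<omega>)) \<partial>M)"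
      by (rule indep_vars_nn_integral[OF _ ind]) (use S in auto)
    also have "\<dots> = (\<Prod>p\<in>{i} \<times> S. ennreal (exp ((a (snd p))\<^sup>2 / 2)))"
      using gauss i by (intro prod.cong refl) (auto intro!: std_normal_mgf)
    also have "\<dots> = (\<Prod>k\<in>S. ennreal (exp ((a k)\<^sup>2 / 2)))"
    proof -
      have "{i} \<times> S = Pair i ` S" by auto
      then show ?thesis by (simp add: prod.reindex[OF inj])
    qed
    also have "\<dots> = ennreal (exp (\<Sum>k\<in>S. (a k)\<^sup>2 / 2))"
      unfolding exp_sum[OF S] by (rule prod_ennreal) simp
    finally show ?thesis by (simp add: sum_divide_distrib)
  qed
qed

end

text \<open>Growth of \<open>\<kappa>\<close> and of its derivative together with the lower bound
  control the derivative of the power, and the mean value inequality on an interval containing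
  \<open>s\<close> and \<open>t\<close> gives the local Lipschitz bound.\<close>

lemma powr_exp_growth:
  fixes \<kappa> :: "real \<Rightarrow> real"
  assumes p: "0 < p" and pos: "\<forall>t. \<kappa> t > 0" and C1: "\<kappa> C1_differentiable_on UNIV"
    and c: "c1 > 0" "c2 > 0" "a1 > 0" "a2 > 0"
    and lower: "\<forall>t. c1 * exp (- a1 * \<bar>t\<bar>) \<le> \<kappa> t"
    and upper: "\<forall>t. \<kappa> t \<le> c2 * exp (a2 * \<bar>t\<bar>)"
    and deriv: "\<forall>t. \<bar>deriv \<kappa> t\<bar> \<le> c2 * exp (a2 * \<bar>t\<bar>)"
  obtains K b where "\<And>t. \<kappa> t powr p \<le> K * exp (b * \<bar>t\<bar>)" "\<And>t. 1 / \<kappa> t powr p \<le> K * exp (b * \<bar>t\<bar>)"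
    "\<And>s t. \<bar>\<kappa> s powr p - \<kappa> t powr p\<bar> \<le> K * \<bar>s - t\<bar> * exp (b * (\<bar>s\<bar> + \<bar>t\<bar>))"
proof -
  have d: "(\<kappa> has_real_derivative deriv \<kappa> t) (at t)" for t
  proof -
    obtain D where "(\<kappa> has_vector_derivative D t) (at t)"
      using C1 unfolding C1_differentiable_on_def by blast
    then have "(\<kappa> has_real_derivative D t) (at t)" by (simp add: has_real_derivative_iff_has_vector_derivative)
    then show ?thesis using DERIV_imp_deriv by metis
  qed
  define K1 K2 K3 where "K1 = c2 powr p" and "K2 = c1 powr - p" and "K3 = p * c2 * K1 / c1"
  \<comment> \<open>A single rate that dominates those of the power, its reciprocal and its
    derivative.\<close>
  define b where "b = p * a1 + p * a2 + a1 + a2"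
  have K0: "0 \<le> K1" "0 \<le> K2" "0 \<le> K3" unfolding K1_def K2_def K3_def using p c by auto
  have pa: "0 \<le> p * a1" "0 \<le> p * a2" using p c by auto
  have up: "\<kappa> t powr p \<le> K1 * exp (p * a2 * \<bar>t\<bar>)" for t
  proof -
    have "\<kappa> t powr p \<le> (c2 * exp (a2 * \<bar>t\<bar>)) powr p"
      using pos[rule_format, of t] upper p by (intro powr_mono2) (auto simp: less_imp_le)
    then show ?thesis unfolding K1_def using c by (simp add: powr_mult exp_powr_real mult_ac)
  qed
  have low: "1 / \<kappa> t powr p \<le> K2 * exp (p * a1 * \<bar>t\<bar>)" for t
  proof -
    have "\<kappa> t powr - p \<le> (c1 * exp (- a1 * \<bar>t\<bar>)) powr - p"
      using lower c p by (intro powr_mono2') auto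
    also have "\<dots> = K2 * exp (p * a1 * \<bar>t\<bar>)"
      unfolding K2_def using c by (simp add: powr_mult exp_powr_real mult_ac)
    finally show ?thesis by (simp add: powr_minus_divide)
  qed
  have der: "((\<lambda>t. \<kappa> t powr p) has_real_derivative p * \<kappa> t powr (p - 1) * deriv \<kappa> t) (at t)" for t
    using DERIV_fun_powr[OF d, of t p] pos by (simp add: less_imp_le)
  have der_le: "\<bar>p * \<kappa> t powr (p - 1) * deriv \<kappa> t\<bar> \<le> K3 * exp (b * \<bar>t\<bar>)" for t
  proof -
    \<comment> \<open>Dividing by \<open>\<kappa> t\<close> treats \<open>p < 1\<close> and
      \<open>p \<ge> 1\<close> alike.\<close>
    have "\<kappa> t powr (p - 1) = \<kappa> t powr p / \<kappa> t"
      using pos by (simp add: powr_diff less_imp_le)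
    also have "\<dots> \<le> (K1 * exp (p * a2 * \<bar>t\<bar>)) / (c1 * exp (- a1 * \<bar>t\<bar>))"
      using up lower c K0 by (intro frac_le) auto
    also have "\<dots> = (K1 / c1) * exp (p * a2 * \<bar>t\<bar> + a1 * \<bar>t\<bar>)"
      by (simp add: exp_add exp_minus field_simps)
    finally have "\<kappa> t powr (p - 1) \<le> (K1 / c1) * exp (p * a2 * \<bar>t\<bar> + a1 * \<bar>t\<bar>)" .
    then have "p * \<kappa> t powr (p - 1) * \<bar>deriv \<kappa> t\<bar>
        \<le> p * ((K1 / c1) * exp (p * a2 * \<bar>t\<bar> + a1 * \<bar>t\<bar>)) * (c2 * exp (a2 * \<bar>t\<bar>))"
      using p deriv K0 c by (intro mult_mono mult_left_mono) auto
    also have "\<dots> = K3 * exp ((p * a2 + a1 + a2) * \<bar>t\<bar>)"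
      unfolding K3_def by (simp add: exp_add[symmetric] distrib_right)
    also have "\<dots> \<le> K3 * exp (b * \<bar>t\<bar>)"
      unfolding b_def using pa K0 by (intro mult_left_mono) (auto intro!: mult_right_mono)
    finally show ?thesis using p by (simp add: abs_mult)
  qed
  define K where "K = K1 + K2 + K3"
  show thesis
  proof (rule that[of K b])
    fix s t :: real
    have "\<kappa> t powr p \<le> K1 * exp (p * a2 * \<bar>t\<bar>)" by (rule up)
    also have "\<dots> \<le> K * exp (b * \<bar>t\<bar>)"
      unfolding K_def b_def using K0 pa c by (intro mult_mono) (auto intro!: mult_right_mono)
    finally show "\<kappa> t powr p \<le> K * exp (b * \<bar>t\<bar>)" .
    have "1 / \<kappa> t powr p \<le> K2 * exp (p * a1 * \<bar>t\<bar>)" by (rule low)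
    also have "\<dots> \<le> K * exp (b * \<bar>t\<bar>)"
      unfolding K_def b_def using K0 pa c by (intro mult_mono) (auto intro!: mult_right_mono)
    finally show "1 / \<kappa> t powr p \<le> K * exp (b * \<bar>t\<bar>)" .
    define m where "m = K3 * exp (b * (\<bar>s\<bar> + \<bar>t\<bar>))"
    have b0: "0 \<le> b" unfolding b_def using pa c by auto
    have "norm (\<kappa> s powr p - \<kappa> t powr p) \<le> m * norm (s - t)"
    proof (rule field_differentiable_bound[where S = "{- (\<bar>s\<bar> + \<bar>t\<bar>)..\<bar>s\<bar> + \<bar>t\<bar>}"])
      fix r assume r: "r \<in> {- (\<bar>s\<bar> + \<bar>t\<bar>)..\<bar>s\<bar> + \<bar>t\<bar>}"
      show "((\<lambda>t. \<kappa> t powr p) has_real_derivative p * \<kappa> r powr (p - 1) * deriv \<kappa> r) (at r within {- (\<bar>s\<bar> + \<bar>t\<bar>)..\<bar>s\<bar> + \<bar>t\<bar>})"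
        using der by (rule DERIV_subset) simp
      have "K3 * exp (b * \<bar>r\<bar>) \<le> m"
        unfolding m_def using r b0 K0 by (intro mult_left_mono) (auto intro!: mult_left_mono)
      then show "norm (p * \<kappa> r powr (p - 1) * deriv \<kappa> r) \<le> m" using der_le[of r] by simp
    qed auto
    also have "m * norm (s - t) \<le> K * \<bar>s - t\<bar> * exp (b * (\<bar>s\<bar> + \<bar>t\<bar>))"
    proof -
      have "K3 * (\<bar>s - t\<bar> * exp (b * (\<bar>s\<bar> + \<bar>t\<bar>))) \<le> K * (\<bar>s - t\<bar> * exp (b * (\<bar>s\<bar> + \<bar>t\<bar>)))"
        unfolding K_def using K0 by (intro mult_right_mono) auto
      then show ?thesis unfolding m_def by (simp add: mult_ac)
    qed
    finally show "\<bar>\<kappa> s powr p - \<kappa> t powr p\<bar> \<le> K * \<bar>s - t\<bar> * exp (b * (\<bar>s\<bar> + \<bar>t\<bar>))" by simp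
  qed
qed

section \<open>Reduction to the real basis\<close>

lemma phase_translate: "phase k (x + t *\<^sub>R axis j 1) = phase k x + t * (2 * pi * real_of_int (k $ j))"
proof -
  have "(\<Sum>i\<in>UNIV. real_of_int (k $ i) * (x + t *\<^sub>R axis j 1) $ i)
      = (\<Sum>i\<in>UNIV. real_of_int (k $ i) * x $ i) + (\<Sum>i\<in>UNIV. if i = j then real_of_int (k $ j) * t else 0)"
    unfolding sum.distrib[symmetric] by (intro sum.cong) (auto simp: axis_def algebra_simps)
  then show ?thesis unfolding phase_def by (simp add: algebra_simps)
qed

text \<open>Differentiation exchanges \<open>hartley k\<close> and \<open>hartley (- k)\<close>,
  because \<open>cos + sin\<close> is the Hartley function of the reflected frequency. A second
  derivative restores the frequency.\<close>

lemma hartley_has_pd: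
  "((\<lambda>t. hartley k (x + t *\<^sub>R axis j 1)) has_real_derivative - (2 * pi * real_of_int (k $ j)) * hartley (- k) x) (at 0)"
  unfolding hartley_def phase_translate phase_minus
  by (auto intro!: derivative_eq_intros simp: algebra_simps)

lemma cplx_trig_has_pd:
  fixes c :: "int^'d \<Rightarrow> real"
  assumes v: "\<And>x. v x = (\<Sum>k\<in>S. c k * hartley k x)"
  shows "((\<lambda>t. cplx v (x + t *\<^sub>R axis j 1)) has_vector_derivative
      complex_of_real (\<Sum>k\<in>S. c k * (- (2 * pi * real_of_int (k $ j)) * hartley (- k) x))) (at 0)"
proof -
  have "((\<lambda>t. v (x + t *\<^sub>R axis j 1)) has_real_derivative (\<Sum>k\<in>S. c k * (- (2 * pi * real_of_int (k $ j)) * hartley (- k) x))) (at 0)"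
    unfolding v by (intro DERIV_sum DERIV_cmult hartley_has_pd)
  then show ?thesis
    unfolding cplx_def has_real_derivative_iff_has_vector_derivative by (rule bounded_linear.has_vector_derivative[OF bounded_linear_of_real])
qed

lemma pd_cplx_trig:
  assumes "\<And>x. v x = (\<Sum>k\<in>S. c k * hartley k x)"
  shows "pd j (cplx v) = cplx (\<lambda>x. \<Sum>k\<in>S. c k * (- (2 * pi * real_of_int (k $ j)) * hartley (- k) x))"
  using vector_derivative_at[OF cplx_trig_has_pd[OF assms]] unfolding pd_def cplx_def by auto

lemma has_pd_cplx_trig:
  assumes "\<And>x. v x = (\<Sum>k\<in>S. c k * hartley k x)"
  shows "has_pd j (cplx v)"
  using cplx_trig_has_pd[OF assms] unfolding has_pd_def by (blast intro: differentiableI_vector)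

lemma pd_cplx_hartley:
  "pd j (cplx (\<lambda>x. a * hartley k x)) = cplx (\<lambda>x. (a * - (2 * pi * real_of_int (k $ j))) * hartley (- k) x)"
  by (subst pd_cplx_trig[where S = "{k}" and c = "\<lambda>_. a"]) (auto simp: mult.assoc)

lemma has_pd_cplx_hartley: "has_pd j (cplx (\<lambda>x. a * hartley k x))"
  by (rule has_pd_cplx_trig[where S = "{k}" and c = "\<lambda>_. a"]) simp

lemma pd_pd_cplx_hartley:
  "pd l (pd j (cplx (hartley k))) = cplx (\<lambda>x. - (4 * pi\<^sup>2 * real_of_int (k $ j) * real_of_int (k $ l)) * hartley k x)"
proof -
  have "pd l (pd j (cplx (hartley k))) = pd l (pd j (cplx (\<lambda>x. 1 * hartley k x)))" by simp
  also have "\<dots> = cplx (\<lambda>x. ((1 * - (2 * pi * real_of_int (k $ j))) * - (2 * pi * real_of_int ((- k) $ l))) * hartley (- (- k)) x)"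
    unfolding pd_cplx_hartley ..
  finally show ?thesis by (simp add: power2_eq_square mult_ac)
qed

lemma hartley_periodic: "Zperiodic (cplx (hartley k))"
  unfolding Zperiodic_def
proof (intro allI)
  fix x and m :: "int^'a"
  define n where "n = (\<Sum>j\<in>UNIV. k $ j * m $ j)"
  have "phase k (x + (\<chi> j. real_of_int (m $ j))) = phase k x + 2 * pi * n"
    unfolding phase_def n_def by (simp add: algebra_simps sum.distrib)
  then have "sin (phase k (x + (\<chi> j. real_of_int (m $ j)))) = sin (phase k x) \<and>
      cos (phase k (x + (\<chi> j. real_of_int (m $ j)))) = cos (phase k x)"
    unfolding sin_cos_eq_iff by blast
  then show "cplx (hartley k) (x + (\<chi> j. real_of_int (m $ j))) = cplx (hartley k) x"
    unfolding cplx_def hartley_def by simp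
qed

lemma cplx_hartley_continuous: "continuous_on A (cplx (\<lambda>x. a * hartley k x))"
  unfolding cplx_def by (intro continuous_intros)

lemma C2_torus_hartley: "C2_torus (cplx (hartley k))"
proof -
  have 1: "has_pd j (cplx (hartley k))" "continuous_on UNIV (cplx (hartley k))" for j
    using has_pd_cplx_hartley[of j 1 k] cplx_hartley_continuous[of UNIV 1 k] by simp_all
  have 2: "pd j (cplx (hartley k)) = cplx (\<lambda>x. - (2 * pi * real_of_int (k $ j)) * hartley (- k) x)" for j
    using pd_cplx_hartley[of j 1 k] by simp
  show ?thesis
    unfolding C2_torus_def
  proof (intro conjI allI hartley_periodic 1)
    show "continuous_on UNIV (pd j (cplx (hartley k)))" for j
      unfolding 2 by (rule cplx_hartley_continuous)
    show "has_pd l (pd j (cplx (hartley k)))" for j l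
      unfolding 2 by (rule has_pd_cplx_hartley)
    show "continuous_on UNIV (pd l (pd j (cplx (hartley k))))" for j l
      unfolding pd_pd_cplx_hartley by (rule cplx_hartley_continuous)
  qed
qed

lemma laplacian_hartley: "laplacian (cplx (hartley k)) = cplx (\<lambda>x. - eigenvalue k * hartley k x)"
proof
  fix x
  have "laplacian (cplx (hartley k)) x
      = complex_of_real (\<Sum>j\<in>UNIV. - (4 * pi\<^sup>2 * real_of_int (k $ j) * real_of_int (k $ j)) * hartley k x)"
    unfolding laplacian_def pd_pd_cplx_hartley cplx_def by simp
  also have "(\<Sum>j\<in>UNIV. - (4 * pi\<^sup>2 * real_of_int (k $ j) * real_of_int (k $ j)) * hartley k x) = - eigenvalue k * hartley k x"
    unfolding eigenvalue_def sum_distrib_left sum_distrib_right sum_negf[symmetric]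
    by (intro sum.cong refl) (simp add: power2_eq_square mult_ac)
  finally show "laplacian (cplx (hartley k)) x = cplx (\<lambda>x. - eigenvalue k * hartley k x) x" unfolding cplx_def .
qed

lemma ip_cplx: "ip (cplx f) (cplx g) = complex_of_real (\<integral>x. f x * g x \<partial>torus)"
  unfolding ip_def cplx_def integral_torus[symmetric]
  by (simp flip: of_real_mult)

lemma freq_box_uminus: "bij_betw uminus (freq_box n) (freq_box n)"
  by (rule bij_betwI[where g = uminus]) (auto simp: freq_box_def)

lemma sum_freq_box_uminus: "(\<Sum>k\<in>freq_box n. f (- k)) = (\<Sum>k\<in>freq_box n. f k)"
  by (rule sum.reindex_bij_betw[OF freq_box_uminus])

lemma uminus_in_freq_box: "- k \<in> freq_box n \<longleftrightarrow> k \<in> freq_box n"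
  unfolding freq_box_def by simp

text \<open>Taking real parts turns each term into a combination of \<open>hartley k\<close> and
  \<open>hartley (- k)\<close>; reindexing the second half by the symmetry of the frequency box
  gives the formula for \<open>c\<close>.\<close>

lemma H_real_trig:
  fixes v :: "real^'d \<Rightarrow> real"
  assumes "cplx v \<in> H n"
  obtains c where "\<And>x. v x = (\<Sum>k\<in>freq_box n. c k * hartley k x)"
proof -
  obtain a where a: "\<And>x. cplx v x = (\<Sum>k\<in>freq_box n. a k * fourier k x)"
    using assms unfolding H_def by blast
  define c where "c k = (Re (a k) + Im (a k)) / 2 + (Re (a (- k)) - Im (a (- k))) / 2" for k
  have "v x = (\<Sum>k\<in>freq_box n. c k * hartley k x)" for x
  proof -
    have "v x = Re (\<Sum>k\<in>freq_box n. a k * fourier k x)" unfolding a[symmetric] cplx_def by simp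
    also have "\<dots> = (\<Sum>k\<in>freq_box n. (Re (a k) + Im (a k)) / 2 * hartley k x + (Re (a k) - Im (a k)) / 2 * hartley (- k) x)"
      unfolding Re_sum
      by (intro sum.cong refl) (simp add: fourier_phase hartley_def phase_minus field_simps)
    also have "\<dots> = (\<Sum>k\<in>freq_box n. (Re (a k) + Im (a k)) / 2 * hartley k x)
        + (\<Sum>k\<in>freq_box n. (Re (a (- k)) - Im (a (- k))) / 2 * hartley k x)"
      unfolding sum.distrib
      using sum_freq_box_uminus[of "\<lambda>k. (Re (a (- k)) - Im (a (- k))) / 2 * hartley k x" n] by simp
    also have "\<dots> = (\<Sum>k\<in>freq_box n. c k * hartley k x)"
      unfolding c_def by (simp add: distrib_right sum.distrib)
    finally show ?thesis .
  qed
  then show thesis by (rule that)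
qed

lemma hartley_in_H:
  assumes "k \<in> freq_box n"
  shows "cplx (hartley k) \<in> H n"
proof -
  \<comment> \<open>The two summands overlap for \<open>k = 0\<close>, where they add up to the
    coefficient 1.\<close>
  define a where "a l = (if l = k then (1 + \<i>) / 2 else 0) + (if l = - k then (1 - \<i>) / 2 else 0)" for l
  have "cplx (hartley k) x = (\<Sum>l\<in>freq_box n. a l * fourier l x)" for x
  proof -
    have "(\<Sum>l\<in>freq_box n. a l * fourier l x) = (\<Sum>l\<in>freq_box n. if l = k then (1 + \<i>) / 2 * fourier k x else 0)
        + (\<Sum>l\<in>freq_box n. if l = - k then (1 - \<i>) / 2 * fourier (- k) x else 0)"
    proof -
      have "(if l = m then b else 0) * fourier l x = (if l = m then b * fourier m x else 0)" for l m b
        by simp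
      then show ?thesis unfolding a_def distrib_right sum.distrib by simp
    qed
    also have "\<dots> = (1 + \<i>) / 2 * fourier k x + (1 - \<i>) / 2 * fourier (- k) x"
      using assms by (simp add: finite_freq_box uminus_in_freq_box)
    also have "\<dots> = cplx (hartley k) x"
      by (simp add: complex_eq_iff cplx_def fourier_phase hartley_def phase_minus field_simps)
    finally show ?thesis by simp
  qed
  then show ?thesis unfolding H_def by blast
qed

text \<open>\<open>\<xi> i k\<close> enters the coefficients at \<open>k\<close> and at
  \<open>- k\<close>; collecting both gives \<open>(1 + \<i>) / 2 * fourier k x + (1 - \<i>) / 2 *
  fourier (- k) x\<close>, which is \<open>hartley k x\<close>.\<close>

lemma noise_trunc_eq: "noise_trunc \<xi> n i \<omega> x = complex_of_real (\<Sum>k\<in>freq_box n. \<xi> i k \<omega> * hartley k x)"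
proof -
  have "noise_trunc \<xi> n i \<omega> x = (\<Sum>k\<in>freq_box n. of_real (\<xi> i k \<omega>) * ((1 + \<i>) / 2 * fourier k x))
      + (\<Sum>k\<in>freq_box n. of_real (\<xi> i (- k) \<omega>) * ((1 - \<i>) / 2 * fourier k x))"
    unfolding noise_trunc_def noise_coeff_def sum.distrib[symmetric]
    by (intro sum.cong refl) (simp add: field_simps)
  also have "(\<Sum>k\<in>freq_box n. of_real (\<xi> i (- k) \<omega>) * ((1 - \<i>) / 2 * fourier k x))
      = (\<Sum>k\<in>freq_box n. of_real (\<xi> i k \<omega>) * ((1 - \<i>) / 2 * fourier (- k) x))"
    using sum_freq_box_uminus[of "\<lambda>k. of_real (\<xi> i k \<omega>) * ((1 - \<i>) / 2 * fourier (- k) x)" n] by simp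
  also have "(\<Sum>k\<in>freq_box n. of_real (\<xi> i k \<omega>) * ((1 + \<i>) / 2 * fourier k x)) + \<dots>
      = (\<Sum>k\<in>freq_box n. complex_of_real (\<xi> i k \<omega> * hartley k x))"
    unfolding sum.distrib[symmetric]
    by (intro sum.cong refl) (simp add: complex_eq_iff fourier_phase hartley_def phase_minus field_simps)
  finally show ?thesis by simp
qed

lemma grad_ip_hartley:
  fixes v :: "real^'d \<Rightarrow> real"
  assumes v: "\<And>x. v x = (\<Sum>k\<in>freq_box n. c k * hartley k x)" and j: "j \<in> freq_box n"
  shows "grad_ip (cplx v) (cplx (hartley j)) = complex_of_real (eigenvalue j * c j)"
proof -
  have 1: "ip (pd l (cplx v)) (pd l (cplx (hartley j))) = complex_of_real (c j * (4 * pi\<^sup>2 * (real_of_int (j $ l))\<^sup>2))" for l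
  proof -
    define d where "d k = c k * - (2 * pi * real_of_int (k $ l))" for k
    define e where "e = - (2 * pi * real_of_int (j $ l))"
    have "pd l (cplx (hartley j)) = cplx (\<lambda>x. e * hartley (- j) x)"
      using pd_cplx_hartley[of l 1 j] unfolding e_def by simp
    moreover have "pd l (cplx v) = cplx (\<lambda>x. \<Sum>k\<in>freq_box n. d k * hartley (- k) x)"
      unfolding pd_cplx_trig[OF v] d_def by (simp add: mult.assoc)
    ultimately have "ip (pd l (cplx v)) (pd l (cplx (hartley j)))
        = complex_of_real (\<integral>x. (\<Sum>k\<in>freq_box n. d k * hartley (- k) x) * (e * hartley (- j) x) \<partial>torus)"
      by (simp add: ip_cplx)
    also have "(\<integral>x. (\<Sum>k\<in>freq_box n. d k * hartley (- k) x) * (e * hartley (- j) x) \<partial>torus)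
        = (\<integral>x. (\<Sum>k\<in>freq_box n. (d k * e) * (hartley (- k) x * hartley (- j) x)) \<partial>torus)"
      by (simp add: sum_distrib_left sum_distrib_right mult_ac)
    also have "\<dots> = (\<Sum>k\<in>freq_box n. (\<integral>x. (d k * e) * (hartley (- k) x * hartley (- j) x) \<partial>torus))"
      by (intro Bochner_Integration.integral_sum torus.ess_bounded_integrable ess_bounded_intros ess_bounded_hartley)
    also have "\<dots> = (\<Sum>k\<in>freq_box n. if k = j then d j * e else 0)"
      by (intro sum.cong refl) (simp add: hartley_orthonormal)
    also have "\<dots> = c j * (4 * pi\<^sup>2 * (real_of_int (j $ l))\<^sup>2)"
      using j unfolding d_def e_def by (simp add: finite_freq_box power2_eq_square mult_ac)
    finally show ?thesis .
  qed
  show ?thesis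
    unfolding grad_ip_def 1 eigenvalue_def of_real_sum[symmetric]
    by (simp add: sum_distrib_left sum_distrib_right mult_ac)
qed

text \<open>The complex equation is tested with \<open>hartley j\<close>, which lies in
  \<open>H n\<close>; every term is then a real integral.\<close>

lemma galerkin_sol_real:
  fixes v :: "nat \<Rightarrow> real^'d \<Rightarrow> real"
  assumes sol: "galerkin_sol \<kappa> \<nu> um1 J \<xi> n \<omega> v" and i: "i \<le> J"
    and \<kappa>: "continuous_on UNIV (\<lambda>t. (\<kappa> t)\<^sup>2)" "continuous_on UNIV (\<lambda>t. \<kappa> t powr \<nu>)"
  obtains c where "\<And>x. v i x = (\<Sum>k\<in>freq_box n. c k * hartley k x)"
    "\<And>j. j \<in> freq_box n \<Longrightarrow> eigenvalue j * c j + (\<integral>x. (\<kappa> (prev um1 v i x))\<^sup>2 * v i x * hartley j x \<partial>torus)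
      = (\<Sum>k\<in>freq_box n. (\<integral>x. \<kappa> (prev um1 v i x) powr \<nu> * hartley k x * hartley j x \<partial>torus) * \<xi> i k \<omega>)"
proof -
  have "cplx (v l) \<in> H n" if "l \<le> J" for l using sol that unfolding galerkin_sol_def by blast
  then have trig: "\<exists>c. \<forall>x. v l x = (\<Sum>k\<in>freq_box n. c k * hartley k x)" if "l \<le> J" for l
    using H_real_trig that by metis
  then have "ess_bounded torus (v l)" if "l \<le> J" for l
  proof -
    obtain c where "v l = (\<lambda>x. \<Sum>k\<in>freq_box n. c k * hartley k x)" using trig[OF \<open>l \<le> J\<close>] by blast
    then show ?thesis by (auto intro!: ess_bounded_intros ess_bounded_hartley)
  qed
  then have ep: "ess_bounded torus (prev um1 v i)"
    using i unfolding prev_def by (auto intro: ess_bounded_const)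
  have es: "ess_bounded torus (\<lambda>x. \<kappa> (prev um1 v i x) powr \<nu>)"
    by (rule ess_bounded_compose[OF ep \<kappa>(2)])
  obtain c where c: "\<And>x. v i x = (\<Sum>k\<in>freq_box n. c k * hartley k x)" using trig[OF i] by blast
  have "eigenvalue j * c j + (\<integral>x. (\<kappa> (prev um1 v i x))\<^sup>2 * v i x * hartley j x \<partial>torus)
      = (\<Sum>k\<in>freq_box n. (\<integral>x. \<kappa> (prev um1 v i x) powr \<nu> * hartley k x * hartley j x \<partial>torus) * \<xi> i k \<omega>)"
    if j: "j \<in> freq_box n" for j
  proof -
    have "grad_ip (cplx (v i)) (cplx (hartley j)) + ip (\<lambda>x. complex_of_real ((\<kappa> (prev um1 v i x))\<^sup>2 * v i x)) (cplx (hartley j))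
        = ip (\<lambda>x. complex_of_real (\<kappa> (prev um1 v i x) powr \<nu>) * noise_trunc \<xi> n i \<omega> x) (cplx (hartley j))"
      using sol i hartley_in_H[OF j] unfolding galerkin_sol_def by blast
    also have "(\<lambda>x. complex_of_real (\<kappa> (prev um1 v i x) powr \<nu>) * noise_trunc \<xi> n i \<omega> x)
        = cplx (\<lambda>x. \<kappa> (prev um1 v i x) powr \<nu> * (\<Sum>k\<in>freq_box n. \<xi> i k \<omega> * hartley k x))"
      unfolding noise_trunc_eq cplx_def by simp
    also have "(\<lambda>x. complex_of_real ((\<kappa> (prev um1 v i x))\<^sup>2 * v i x)) = cplx (\<lambda>x. (\<kappa> (prev um1 v i x))\<^sup>2 * v i x)"
      unfolding cplx_def ..
    finally have "complex_of_real (eigenvalue j * c j + (\<integral>x. (\<kappa> (prev um1 v i x))\<^sup>2 * v i x * hartley j x \<partial>torus))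
        = complex_of_real (\<integral>x. \<kappa> (prev um1 v i x) powr \<nu> * (\<Sum>k\<in>freq_box n. \<xi> i k \<omega> * hartley k x) * hartley j x \<partial>torus)"
      unfolding ip_cplx grad_ip_hartley[OF c j] by simp
    then have "eigenvalue j * c j + (\<integral>x. (\<kappa> (prev um1 v i x))\<^sup>2 * v i x * hartley j x \<partial>torus)
        = (\<integral>x. \<kappa> (prev um1 v i x) powr \<nu> * (\<Sum>k\<in>freq_box n. \<xi> i k \<omega> * hartley k x) * hartley j x \<partial>torus)"
      by (simp only: of_real_eq_iff)
    also have "\<dots> = (\<integral>x. (\<Sum>k\<in>freq_box n. \<xi> i k \<omega> * (\<kappa> (prev um1 v i x) powr \<nu> * hartley k x * hartley j x)) \<partial>torus)"
      by (simp add: sum_distrib_left sum_distrib_right mult_ac)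
    also have "\<dots> = (\<Sum>k\<in>freq_box n. (\<integral>x. \<xi> i k \<omega> * (\<kappa> (prev um1 v i x) powr \<nu> * hartley k x * hartley j x) \<partial>torus))"
      by (intro Bochner_Integration.integral_sum torus.ess_bounded_integrable ess_bounded_intros ess_bounded_hartley es)
    finally show ?thesis by (simp add: mult.commute)
  qed
  with c show thesis by (rule that)
qed

text \<open>Summing before integrating turns the complex coefficients into the truncated noise,
  which \<open>noise_trunc_eq\<close> identifies as real; the integral is then expanded in the real
  basis.\<close>

lemma weak_form_real:
  fixes s :: "real^'d \<Rightarrow> real" and w :: "real^'d \<Rightarrow> real"
  assumes s: "ess_bounded torus s"
    and lim: "(\<lambda>n. \<Sum>k\<in>freq_box n. noise_coeff \<xi> i k \<omega> * ip (\<lambda>x. complex_of_real (s x) * fourier k x) (cplx (hartley j)))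
      \<longlonglongrightarrow> - ip (cplx w) (laplacian (cplx (hartley j))) + ip (\<lambda>x. complex_of_real (V x * w x)) (cplx (hartley j))"
  shows "(\<lambda>n. \<Sum>k\<in>freq_box n. (\<integral>x. s x * hartley k x * hartley j x \<partial>torus) * \<xi> i k \<omega>)
      \<longlonglongrightarrow> eigenvalue j * (\<integral>x. w x * hartley j x \<partial>torus) + (\<integral>x. V x * w x * hartley j x \<partial>torus)"
proof -
  have "ip (cplx w) (laplacian (cplx (hartley j))) = complex_of_real (\<integral>x. (- eigenvalue j) * (w x * hartley j x) \<partial>torus)"
    unfolding laplacian_hartley ip_cplx by (simp add: mult_ac)
  then have 1: "- ip (cplx w) (laplacian (cplx (hartley j))) = complex_of_real (eigenvalue j * (\<integral>x. w x * hartley j x \<partial>torus))"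
    by simp
  have 2: "ip (\<lambda>x. complex_of_real (V x * w x)) (cplx (hartley j)) = complex_of_real (\<integral>x. V x * w x * hartley j x \<partial>torus)"
    using ip_cplx[of "\<lambda>x. V x * w x" "hartley j"] unfolding cplx_def .
  have 3: "(\<Sum>k\<in>freq_box n. noise_coeff \<xi> i k \<omega> * ip (\<lambda>x. complex_of_real (s x) * fourier k x) (cplx (hartley j)))
      = complex_of_real (\<Sum>k\<in>freq_box n. (\<integral>x. s x * hartley k x * hartley j x \<partial>torus) * \<xi> i k \<omega>)" for n
  proof -
    have int: "integrable torus (\<lambda>x. complex_of_real (s x * hartley j x) * cis (phase k x))" for k
    proof -
      obtain C where C: "AE x in torus. \<bar>s x * hartley j x\<bar> \<le> C"
        using ess_bounded_mult[OF s ess_bounded_hartley, of j] unfolding ess_bounded_def by blast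
      have [measurable]: "(\<lambda>x. s x * hartley j x) \<in> borel_measurable torus"
        using ess_bounded_mult[OF s ess_bounded_hartley, of j] unfolding ess_bounded_def by blast
      have [measurable]: "(\<lambda>x. cis (phase k x)) \<in> borel_measurable torus"
        using integrable_cis_phase by (rule borel_measurable_integrable)
      show ?thesis
      proof (rule torus.integrable_const_bound[where B = C])
        show "AE x in torus. norm (complex_of_real (s x * hartley j x) * cis (phase k x)) \<le> C"
          using C by (simp add: norm_mult abs_mult)
      qed measurable
    qed
    have "(\<Sum>k\<in>freq_box n. noise_coeff \<xi> i k \<omega> * ip (\<lambda>x. complex_of_real (s x) * fourier k x) (cplx (hartley j)))
        = (\<Sum>k\<in>freq_box n. (\<integral>x. noise_coeff \<xi> i k \<omega> * (complex_of_real (s x * hartley j x) * cis (phase k x)) \<partial>torus))"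
      unfolding ip_def integral_torus[symmetric] cplx_def fourier_phase integral_mult_right_zero
      by (simp add: mult_ac)
    also have "\<dots> = (\<integral>x. (\<Sum>k\<in>freq_box n. noise_coeff \<xi> i k \<omega> * (complex_of_real (s x * hartley j x) * cis (phase k x))) \<partial>torus)"
      by (intro Bochner_Integration.integral_sum[symmetric] integrable_mult_right int)
    also have "\<dots> = (\<integral>x. complex_of_real (s x * hartley j x) * noise_trunc \<xi> n i \<omega> x \<partial>torus)"
      unfolding noise_trunc_def fourier_phase by (simp add: sum_distrib_left mult_ac)
    also have "\<dots> = (\<integral>x. complex_of_real (s x * hartley j x * (\<Sum>k\<in>freq_box n. \<xi> i k \<omega> * hartley k x)) \<partial>torus)"
      unfolding noise_trunc_eq by simp
    also have "\<dots> = complex_of_real (\<integral>x. s x * hartley j x * (\<Sum>k\<in>freq_box n. \<xi> i k \<omega> * hartley k x) \<partial>torus)"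
      by (rule integral_complex_of_real)
    also have "(\<integral>x. s x * hartley j x * (\<Sum>k\<in>freq_box n. \<xi> i k \<omega> * hartley k x) \<partial>torus)
        = (\<integral>x. (\<Sum>k\<in>freq_box n. \<xi> i k \<omega> * (s x * hartley k x * hartley j x)) \<partial>torus)"
      by (simp add: sum_distrib_left mult_ac)
    also have "\<dots> = (\<Sum>k\<in>freq_box n. (\<integral>x. \<xi> i k \<omega> * (s x * hartley k x * hartley j x) \<partial>torus))"
      by (intro Bochner_Integration.integral_sum torus.ess_bounded_integrable ess_bounded_intros ess_bounded_hartley s)
    finally show ?thesis by (simp add: mult.commute)
  qed
  show ?thesis using lim unfolding 1 2 3 of_real_add[symmetric] tendsto_of_real_iff .
qed

section \<open>Induction over the layers\<close>

lemma (in galerkin_basis) trig_cong: "(\<And>k. k \<in> B n \<Longrightarrow> c k = d k) \<Longrightarrow> trig n c = trig n d"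
  unfolding trig_def by (intro ext sum.cong) auto

lemma (in galerkin_basis) field_const: "field (\<lambda>n k \<omega>. if k = z0 then a else 0) n \<omega> = (\<lambda>x. a)"
  unfolding field_def trig_def using z0_B
  by (simp add: if_distrib[of "\<lambda>t. t * _"] finite_B psi_z0 cong: if_cong)

text \<open>Base of the induction over layers: the constant is a multiple of the mode
  \<open>z0\<close> for every \<open>n\<close>, so the error is zero.\<close>

lemma (in galerkin_basis) approximates_const:
  assumes M: "prob_space M"
  shows "approximates M F (\<lambda>n k \<omega>. if k = z0 then a else 0) (\<lambda>\<omega> x. a)"
proof -
  interpret M: prob_space M by (rule M)
  have "M.tight_family (\<lambda>n \<omega>. exp_moment a' (field (\<lambda>n k \<omega>. if k = z0 then a else 0) n \<omega>))" for a'
    unfolding M.tight_family_def field_const by (auto intro!: exI[of _ "exp_moment a' (\<lambda>x. a)"] bexI[of _ "{}"])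
  moreover have "M.null_in_prob (\<lambda>n \<omega>. ennreal 0)"
    unfolding M.null_in_prob_def by simp
  ultimately show ?thesis
    unfolding approximates_def field_const
    by (auto intro!: exI[of _ "\<lambda>n \<omega>. 0"] ess_bounded_const)
qed

lemma (in prob_space) null_in_prob_sum:
  assumes "\<And>i. i \<in> I \<Longrightarrow> null_in_prob (X i)" "\<And>i n. i \<in> I \<Longrightarrow> X i n \<in> borel_measurable M"
  shows "null_in_prob (\<lambda>n \<omega>. \<Sum>i\<in>I. X i n \<omega>)"
  using assms
proof (induction I rule: infinite_finite_induct)
  case (insert i I)
  have IH: "null_in_prob (\<lambda>n \<omega>. \<Sum>i\<in>I. X i n \<omega>)" using insert by auto
  have [measurable]: "X j n \<in> borel_measurable M" if "j \<in> insert i I" for j n using insert that by auto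
  have le: "(\<integral>\<^sup>+\<omega>. min 1 (\<Sum>i\<in>insert i I. X i n \<omega>) \<partial>M)
      \<le> (\<integral>\<^sup>+\<omega>. min 1 (X i n \<omega>) \<partial>M) + (\<integral>\<^sup>+\<omega>. min 1 (\<Sum>i\<in>I. X i n \<omega>) \<partial>M)" for n
  proof -
    have "(\<integral>\<^sup>+\<omega>. min 1 (\<Sum>i\<in>insert i I. X i n \<omega>) \<partial>M) \<le> (\<integral>\<^sup>+\<omega>. min 1 (X i n \<omega>) + min 1 (\<Sum>i\<in>I. X i n \<omega>) \<partial>M)"
      using insert.hyps by (intro nn_integral_mono) (auto simp: min_def add_increasing add_increasing2)
    also have "\<dots> = (\<integral>\<^sup>+\<omega>. min 1 (X i n \<omega>) \<partial>M) + (\<integral>\<^sup>+\<omega>. min 1 (\<Sum>i\<in>I. X i n \<omega>) \<partial>M)"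
      by (intro nn_integral_add) auto
    finally show ?thesis .
  qed
  have "(\<lambda>n. (\<integral>\<^sup>+\<omega>. min 1 (X i n \<omega>) \<partial>M) + (\<integral>\<^sup>+\<omega>. min 1 (\<Sum>i\<in>I. X i n \<omega>) \<partial>M)) \<longlonglongrightarrow> 0 + 0"
    using insert.prems(1)[of i] IH unfolding null_in_prob_def by (intro tendsto_add) auto
  then have lim: "(\<lambda>n. (\<integral>\<^sup>+\<omega>. min 1 (X i n \<omega>) \<partial>M) + (\<integral>\<^sup>+\<omega>. min 1 (\<Sum>i\<in>I. X i n \<omega>) \<partial>M)) \<longlonglongrightarrow> 0"
    by simp
  show ?case
    unfolding null_in_prob_def
    by (rule tendsto_sandwich[OF always_eventually always_eventually tendsto_const lim]) (use le in auto)
qed (simp_all add: null_in_prob_def)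

lemma (in prob_space) null_in_prob_imp_tendsto_zero_in_prob:
  assumes X [measurable]: "\<And>n. X n \<in> borel_measurable M" and null: "null_in_prob X"
    and eq: "AE \<omega> in M. \<forall>n. D n \<omega> = X n \<omega>"
  shows "tendsto_zero_in_prob M D"
  unfolding tendsto_zero_in_prob_def
proof (intro allI impI)
  fix \<epsilon> \<delta> :: real assume e: "\<epsilon> > 0" and d: "\<delta> > 0"
  \<comment> \<open>\<open>D\<close> agrees with the measurable \<open>X\<close> only off a null
    set; since outer probability is asked for, that set joins the cover.\<close>
  obtain N where N: "N \<in> null_sets M" "{\<omega>\<in>space M. \<not> (\<forall>n. D n \<omega> = X n \<omega>)} \<subseteq> N"
    using eq by (auto elim!: AE_E intro: null_setsI)
  \<comment> \<open>The threshold must not exceed 1, or the truncated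
    \<open>min 1 (X n \<omega>)\<close> could not reach it.\<close>
  define \<eta> where "\<eta> = min 1 \<epsilon>"
  have \<eta>: "\<eta> > 0" "\<eta> \<le> 1" "\<eta> \<le> \<epsilon>" using e unfolding \<eta>_def by auto
  have "0 < ennreal (\<eta> * \<delta>)" using \<eta> d by simp
  with null have "eventually (\<lambda>n. (\<integral>\<^sup>+\<omega>. min 1 (X n \<omega>) \<partial>M) < ennreal (\<eta> * \<delta>)) sequentially"
    unfolding null_in_prob_def by (rule order_tendstoD(2))
  then show "eventually (\<lambda>n. \<exists>A\<in>sets M. {\<omega>\<in>space M. D n \<omega> > ennreal \<epsilon>} \<subseteq> A \<and> measure M A < \<delta>) sequentially"
  proof eventually_elim
    case (elim n)
    define A where "A = {\<omega>\<in>space M. 1 \<le> ennreal (1 / \<eta>) * min 1 (X n \<omega>)}"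
    have A [measurable]: "A \<in> sets M" unfolding A_def by measurable
    have "emeasure M A \<le> ennreal (1 / \<eta>) * (\<integral>\<^sup>+\<omega>. min 1 (X n \<omega>) * indicator (space M) \<omega> \<partial>M)"
      unfolding A_def by (rule nn_integral_Markov_inequality) auto
    also have "(\<integral>\<^sup>+\<omega>. min 1 (X n \<omega>) * indicator (space M) \<omega> \<partial>M) = (\<integral>\<^sup>+\<omega>. min 1 (X n \<omega>) \<partial>M)"
      by (intro nn_integral_cong) simp
    also have "ennreal (1 / \<eta>) * \<dots> < ennreal (1 / \<eta>) * ennreal (\<eta> * \<delta>)"
      using elim \<eta> by (intro ennreal_mult_strict_left_mono) auto
    also have "\<dots> = ennreal \<delta>" using \<eta> d by (subst ennreal_mult[symmetric]) auto
    finally have "measure M A < \<delta>" using d by (simp add: emeasure_eq_measure ennreal_less_iff)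
    moreover have "{\<omega>\<in>space M. D n \<omega> > ennreal \<epsilon>} \<subseteq> A \<union> N"
    proof
      fix \<omega> assume w: "\<omega> \<in> {\<omega>\<in>space M. D n \<omega> > ennreal \<epsilon>}"
      show "\<omega> \<in> A \<union> N"
      proof (cases "\<omega> \<in> N")
        case False
        then have "D n \<omega> = X n \<omega>" using N(2) w by auto
        then have "ennreal \<epsilon> < X n \<omega>" using w by simp
        then have "ennreal \<eta> \<le> X n \<omega>" using \<eta>(3) by (meson ennreal_leI less_imp_le order_trans)
        then have "ennreal \<eta> \<le> min 1 (X n \<omega>)" using \<eta>(2) by (auto simp: ennreal_le_1)
        then have "ennreal (1 / \<eta>) * ennreal \<eta> \<le> ennreal (1 / \<eta>) * min 1 (X n \<omega>)" by (rule mult_left_mono) simp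
        moreover have "ennreal (1 / \<eta>) * ennreal \<eta> = 1" using \<eta> by (subst ennreal_mult[symmetric]) auto
        ultimately show ?thesis using w unfolding A_def by simp
      qed simp
    qed
    moreover have "measure M (A \<union> N) = measure M A"
      by (rule measure_Un_null_set[OF A N(1)])
    ultimately show ?case using A N(1) by (intro bexI[of _ "A \<union> N"]) auto
  qed
qed

lemma nn_integral_cube_sq:
  fixes h :: "real^'d \<Rightarrow> real"
  assumes "ess_bounded torus h"
  shows "(\<integral>\<^sup>+ x\<in>cube. ennreal ((h x)\<^sup>2) \<partial>lborel) = ennreal (\<integral>x. (h x)\<^sup>2 \<partial>torus)"
proof -
  have "(\<integral>\<^sup>+ x\<in>cube. ennreal ((h x)\<^sup>2) \<partial>lborel) = (\<integral>\<^sup>+x. ennreal ((h x)\<^sup>2) \<partial>torus)"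
    unfolding torus_def by (subst nn_integral_restrict_space) auto
  also have "\<dots> = ennreal (\<integral>x. (h x)\<^sup>2 \<partial>torus)"
    by (intro nn_integral_eq_integral torus.ess_bounded_integrable ess_bounded_intros assms) auto
  finally show ?thesis .
qed

theorem theorem3p6:
  fixes M :: "'w measure"
    and \<xi> :: "nat \<Rightarrow> int^'d \<Rightarrow> 'w \<Rightarrow> real"
    and \<kappa> :: "real \<Rightarrow> real"
    and \<nu> um1 c1 c2 a1 a2 :: real
    and J :: nat
    and u :: "nat \<Rightarrow> 'w \<Rightarrow> real^'d \<Rightarrow> real"
    and uN :: "nat \<Rightarrow> nat \<Rightarrow> 'w \<Rightarrow> real^'d \<Rightarrow> real"
  assumes dim: "CARD('d) \<in> {1, 2, 3}"
    and nu: "\<nu> > 0"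
    and kappa_pos: "\<forall>t. \<kappa> t > 0"
    and kappa_C1: "\<kappa> C1_differentiable_on UNIV"
    and cpos: "c1 > 0" "c2 > 0" "a1 > 0" "a2 > 0"
    and kappa_lower: "\<forall>t. c1 * exp (- a1 * \<bar>t\<bar>) \<le> \<kappa> t"
    and kappa_upper: "\<forall>t. \<kappa> t \<le> c2 * exp (a2 * \<bar>t\<bar>)"
    and kappa_deriv: "\<forall>t. \<bar>deriv \<kappa> t\<bar> \<le> c2 * exp (a2 * \<bar>t\<bar>)"
    and P: "prob_space M"
    and noise_indep: "prob_space.indep_vars M (\<lambda>_. borel) (\<lambda>(i, k). \<xi> i k) ({..J} \<times> UNIV)"
    and noise_gauss: "\<forall>i\<le>J. \<forall>k. distributed M lborel (\<xi> i k) std_normal_density"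
    and galerkin: "\<forall>n. AE \<omega> in M. galerkin_sol \<kappa> \<nu> um1 J \<xi> n \<omega> (\<lambda>i. uN n i \<omega>)"
    and weak: "weak_sol M \<kappa> \<nu> um1 J \<xi> u"
  shows "tendsto_zero_in_prob M (\<lambda>n \<omega>. L2dist_sq J (\<lambda>i. uN n i \<omega>) (\<lambda>i. u i \<omega>))"
proof -
  interpret P: prob_space M by (rule P)
  interpret T: galerkin_basis "torus :: (real^'d) measure" freq_box hartley eigenvalue 0 36 139968
    by (rule galerkin_basis_torus[OF dim])
  note growth = powr_exp_growth[OF _ kappa_pos kappa_C1 cpos kappa_lower kappa_upper kappa_deriv]
  obtain K1 b1 where K1: "\<And>t. \<kappa> t powr 2 \<le> K1 * exp (b1 * \<bar>t\<bar>)" "\<And>t. 1 / \<kappa> t powr 2 \<le> K1 * exp (b1 * \<bar>t\<bar>)"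
    "\<And>s t. \<bar>\<kappa> s powr 2 - \<kappa> t powr 2\<bar> \<le> K1 * \<bar>s - t\<bar> * exp (b1 * (\<bar>s\<bar> + \<bar>t\<bar>))"
    using growth[of 2] by (metis zero_less_numeral)
  obtain K2 b2 where K2: "\<And>t. \<kappa> t powr \<nu> \<le> K2 * exp (b2 * \<bar>t\<bar>)" "\<And>t. 1 / \<kappa> t powr \<nu> \<le> K2 * exp (b2 * \<bar>t\<bar>)"
    "\<And>s t. \<bar>\<kappa> s powr \<nu> - \<kappa> t powr \<nu>\<bar> \<le> K2 * \<bar>s - t\<bar> * exp (b2 * (\<bar>s\<bar> + \<bar>t\<bar>))"
    using growth[OF nu] by metis
  \<comment> \<open>The constants for the exponents 2 and \<open>\<nu>\<close> are merged; the
    entries 1 provide \<open>1 \<le> K\<close> and \<open>0 < b\<close>.\<close>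
  define K where "K = max 1 (max K1 K2)"
  define b where "b = max 1 (max b1 b2)"
  have Kb: "1 \<le> K" "K1 \<le> K" "K2 \<le> K" "0 < b" "b1 \<le> b" "b2 \<le> b" unfolding K_def b_def by auto
  have up: "K' * exp (b' * t) \<le> K * exp (b * t)" if "K' \<le> K" "b' \<le> b" "0 \<le> t" for K' b' t
    using that Kb by (intro mult_mono) (auto intro: mult_right_mono)
  have up2: "K' * a * exp (b' * t) \<le> K * a * exp (b * t)" if "K' \<le> K" "b' \<le> b" "0 \<le> t" "0 \<le> a" for K' b' t a
    using mult_left_mono[OF up[OF that(1-3)] that(4)] by (simp add: mult_ac)
  have sq: "(\<kappa> t)\<^sup>2 = \<kappa> t powr 2" for t using kappa_pos by (simp add: less_imp_le)
  have \<kappa>_cont: "continuous_on UNIV \<kappa>" using C1_differentiable_imp_continuous_on[OF kappa_C1] .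
  have kV_cont: "continuous_on UNIV (\<lambda>t. (\<kappa> t)\<^sup>2)" by (intro continuous_intros \<kappa>_cont)
  have kS_cont: "continuous_on UNIV (\<lambda>t. \<kappa> t powr \<nu>)"
    using kappa_pos by (intro continuous_intros \<kappa>_cont) (auto simp: less_imp_neq[symmetric])
  define X where "X = (\<lambda>(i, k). \<xi> i k)"
  \<comment> \<open>The information in the noises of index below \<open>i\<close>, with respect to
    which the input of layer \<open>i\<close> has measurable coefficients.\<close>
  define F where "F i = P.generated X ({..<i} \<times> UNIV)" for i :: nat
  have gal: "AE \<omega> in M. \<forall>n. galerkin_sol \<kappa> \<nu> um1 J \<xi> n \<omega> (\<lambda>i. uN n i \<omega>)"
    using galerkin by (simp add: AE_all_countable)
  have u_bdd: "AE \<omega> in M. ess_bounded torus (u i \<omega>)" if "i \<le> J" for i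
  proof -
    have "AE \<omega> in M. u i \<omega> \<in> borel_measurable lborel \<and> (\<exists>C. AE x in lborel. x \<in> cube \<longrightarrow> \<bar>u i \<omega> x\<bar> \<le> C)"
      using weak that unfolding weak_sol_def by blast
    then show ?thesis
      by eventually_elim (auto simp: ess_bounded_def AE_torus intro: borel_measurable_torus)
  qed
  have uN_trig: "AE \<omega> in M. \<forall>n. uN n i \<omega> = T.trig n (T.coeff (uN n i \<omega>))" if i: "i \<le> J" for i
    using gal
  proof eventually_elim
    case (elim \<omega>)
    show ?case
    proof
      fix n
      obtain c where "\<And>x. uN n i \<omega> x = (\<Sum>k\<in>freq_box n. c k * hartley k x)"
        using galerkin_sol_real[OF elim[rule_format] i kV_cont kS_cont] by metis
      then have 1: "uN n i \<omega> = T.trig n c" unfolding T.trig_def by auto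
      have "T.trig n (T.coeff (T.trig n c)) = T.trig n c"
        by (rule T.trig_cong) (simp add: T.coeff_trig)
      then show "uN n i \<omega> = T.trig n (T.coeff (uN n i \<omega>))" using 1 by simp
    qed
  qed
  \<comment> \<open>\<open>prev\<close> shifts the index, so the statement at \<open>i\<close>
    concerns the input of layer \<open>i\<close>: the constant \<open>um1\<close> for
    \<open>i = 0\<close>, layer \<open>i - 1\<close> otherwise. It runs to \<open>Suc J\<close> in
    order to reach the last layer \<open>J\<close>.\<close>
  have main: "\<exists>c. T.approximates M (F i) c (\<lambda>\<omega>. prev um1 (\<lambda>l. u l \<omega>) i) \<and>
      (AE \<omega> in M. \<forall>n. prev um1 (\<lambda>l. uN n l \<omega>) i = T.field c n \<omega>)" if "i \<le> Suc J" for i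
    using that
  proof (induction i)
    case 0
    show ?case
    proof (intro exI conjI)
      show "T.approximates M (F 0) (\<lambda>n k \<omega>. if k = 0 then um1 else 0) (\<lambda>\<omega>. prev um1 (\<lambda>l. u l \<omega>) 0)"
        unfolding prev_def by (simp add: T.approximates_const[OF P])
      show "AE \<omega> in M. \<forall>n. prev um1 (\<lambda>l. uN n l \<omega>) 0 = T.field (\<lambda>n k \<omega>. if k = 0 then um1 else 0) n \<omega>"
        unfolding prev_def by (simp add: T.field_const)
    qed
  next
    case (Suc i)
    then have i: "i \<le> J" by simp
    obtain c where c: "T.approximates M (F i) c (\<lambda>\<omega>. prev um1 (\<lambda>l. u l \<omega>) i)"
      and c_field: "AE \<omega> in M. \<forall>n. prev um1 (\<lambda>l. uN n l \<omega>) i = T.field c n \<omega>"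
      using Suc by auto
    \<comment> \<open>Coefficients taken as integrals are defined for every sample, including those
      where the Galerkin equation fails.\<close>
    define g where "g n k \<omega> = T.coeff (uN n i \<omega>) k" for n k \<omega>
    have Xm: "X p \<in> borel_measurable M" if "p \<in> {..J} \<times> UNIV" for p
      using noise_indep that unfolding P.indep_vars_def X_def by auto
    interpret L: layer_step "torus :: (real^'d) measure" freq_box hartley eigenvalue 0 36 139968
      M "F i" "P.generated X ({i} \<times> UNIV)" "\<xi> i" "\<lambda>t. (\<kappa> t)\<^sup>2" "\<lambda>t. \<kappa> t powr \<nu>" K b
      "F (Suc i)" c g "\<lambda>\<omega>. prev um1 (\<lambda>l. u l \<omega>) i" "u i"
    proof (intro layer_step.intro layer.intro layer_axioms.intro layer_step_axioms.intro)
      show "galerkin_basis (torus :: (real^'d) measure) freq_box hartley eigenvalue 0 36 139968"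
        by (rule galerkin_basis_torus[OF dim])
      show "independent_noise M (F i) (P.generated X ({i} \<times> UNIV)) (\<xi> i)"
        unfolding F_def X_def by (rule P.independent_noise_generated[OF noise_indep noise_gauss i])
      show "1 \<le> K" "0 < b" by (fact Kb)+
      show "0 < (\<kappa> t)\<^sup>2" for t using kappa_pos[rule_format, of t] by simp
      show "continuous_on UNIV (\<lambda>t. (\<kappa> t)\<^sup>2)" "continuous_on UNIV (\<lambda>t. \<kappa> t powr \<nu>)" by fact+
      show "(\<kappa> t)\<^sup>2 \<le> K * exp (b * \<bar>t\<bar>)" for t
        unfolding sq by (rule order_trans[OF K1(1) up]) (auto simp: Kb)
      show "1 / (\<kappa> t)\<^sup>2 \<le> K * exp (b * \<bar>t\<bar>)" for t
        unfolding sq by (rule order_trans[OF K1(2) up]) (auto simp: Kb)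
      show "\<bar>\<kappa> t powr \<nu>\<bar> \<le> K * exp (b * \<bar>t\<bar>)" for t
        using order_trans[OF K2(1)[of t] up[of K2 b2 "\<bar>t\<bar>"]] Kb by simp
      show "\<bar>(\<kappa> s)\<^sup>2 - (\<kappa> t)\<^sup>2\<bar> \<le> K * \<bar>s - t\<bar> * exp (b * (\<bar>s\<bar> + \<bar>t\<bar>))" for s t
        unfolding sq by (rule order_trans[OF K1(3) up2]) (auto simp: Kb)
      show "\<bar>\<kappa> s powr \<nu> - \<kappa> t powr \<nu>\<bar> \<le> K * \<bar>s - t\<bar> * exp (b * (\<bar>s\<bar> + \<bar>t\<bar>))" for s t
        by (rule order_trans[OF K2(3) up2]) (auto simp: Kb)
      show "space (F (Suc i)) = space M" unfolding F_def by (rule P.space_generated)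
      show "sets (F i) \<subseteq> sets (F (Suc i))" "sets (P.generated X ({i} \<times> UNIV)) \<subseteq> sets (F (Suc i))"
        unfolding F_def by (intro P.generated_mono; auto)+
      show "sets (F (Suc i)) \<subseteq> sets M"
        unfolding F_def by (rule P.generated_subset, rule Xm) (use i in auto)
      show "T.approximates M (F i) c (\<lambda>\<omega>. prev um1 (\<lambda>l. u l \<omega>) i)" by (rule c)
      show "AE \<omega> in M. ess_bounded torus (u i \<omega>)" by (rule u_bdd[OF i])
      show "AE \<omega> in M. \<forall>n. T.galerkin_eq n (\<lambda>x. (\<kappa> (T.field c n \<omega> x))\<^sup>2)
          (\<lambda>j. \<Sum>k\<in>freq_box n. T.noise_matrix (\<lambda>x. \<kappa> (T.field c n \<omega> x) powr \<nu>) k j * \<xi> i k \<omega>) (\<lambda>k. g n k \<omega>)"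
        using gal c_field uN_trig[OF i]
      proof eventually_elim
        case (elim \<omega>)
        show ?case
        proof
          fix n
          obtain a where a: "\<And>x. uN n i \<omega> x = (\<Sum>k\<in>freq_box n. a k * hartley k x)"
            and eq: "\<And>j. j \<in> freq_box n \<Longrightarrow> eigenvalue j * a j
                + (\<integral>x. (\<kappa> (prev um1 (\<lambda>l. uN n l \<omega>) i x))\<^sup>2 * uN n i \<omega> x * hartley j x \<partial>torus)
              = (\<Sum>k\<in>freq_box n. (\<integral>x. \<kappa> (prev um1 (\<lambda>l. uN n l \<omega>) i x) powr \<nu> * hartley k x * hartley j x \<partial>torus) * \<xi> i k \<omega>)"
            using galerkin_sol_real[OF elim(1)[rule_format] i kV_cont kS_cont, of n] by blast
          have ua: "uN n i \<omega> = T.trig n a" unfolding T.trig_def using a by auto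
          have ga: "g n j \<omega> = a j" if "j \<in> freq_box n" for j
            unfolding g_def ua T.coeff_trig using that by simp
          have tg: "T.trig n (\<lambda>k. g n k \<omega>) = uN n i \<omega>" using elim(3) unfolding g_def by simp
          show "T.galerkin_eq n (\<lambda>x. (\<kappa> (T.field c n \<omega> x))\<^sup>2)
            (\<lambda>j. \<Sum>k\<in>freq_box n. T.noise_matrix (\<lambda>x. \<kappa> (T.field c n \<omega> x) powr \<nu>) k j * \<xi> i k \<omega>) (\<lambda>k. g n k \<omega>)"
            unfolding T.galerkin_eq_def tg T.coeff_def T.noise_matrix_def
            using eq ga elim(2) by simp
        qed
      qed
      show "AE \<omega> in M. \<forall>j. (\<lambda>n. \<Sum>k\<in>freq_box n. T.noise_matrix (\<lambda>x. \<kappa> (prev um1 (\<lambda>l. u l \<omega>) i x) powr \<nu>) k j * \<xi> i k \<omega>)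
          \<longlonglongrightarrow> eigenvalue j * T.coeff (u i \<omega>) j + T.coeff (\<lambda>x. (\<kappa> (prev um1 (\<lambda>l. u l \<omega>) i x))\<^sup>2 * u i \<omega> x) j"
        \<comment> \<open>\<open>weak_sol\<close> has its own null set for each test function; there
          are countably many frequencies, so one common null set suffices.\<close>
        unfolding AE_all_countable
      proof
        fix j :: "int^'d"
        have "AE \<omega> in M. (\<lambda>n. \<Sum>k\<in>freq_box n. noise_coeff \<xi> i k \<omega> *
              ip (\<lambda>x. complex_of_real (\<kappa> (prev um1 (\<lambda>l. u l \<omega>) i x) powr \<nu>) * fourier k x) (cplx (hartley j)))
            \<longlonglongrightarrow> (- ip (cplx (u i \<omega>)) (laplacian (cplx (hartley j)))
             + ip (\<lambda>x. complex_of_real ((\<kappa> (prev um1 (\<lambda>l. u l \<omega>) i x))\<^sup>2 * u i \<omega> x)) (cplx (hartley j)))"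
          using weak i C2_torus_hartley[of j] unfolding weak_sol_def by blast
        moreover have "AE \<omega> in M. ess_bounded torus (prev um1 (\<lambda>l. u l \<omega>) i)"
          using c unfolding T.approximates_def by blast
        ultimately show "AE \<omega> in M. (\<lambda>n. \<Sum>k\<in>freq_box n. T.noise_matrix (\<lambda>x. \<kappa> (prev um1 (\<lambda>l. u l \<omega>) i x) powr \<nu>) k j * \<xi> i k \<omega>)
          \<longlonglongrightarrow> eigenvalue j * T.coeff (u i \<omega>) j + T.coeff (\<lambda>x. (\<kappa> (prev um1 (\<lambda>l. u l \<omega>) i x))\<^sup>2 * u i \<omega> x) j"
        proof eventually_elim
          case (elim \<omega>)
          show ?case
            unfolding T.noise_matrix_def T.coeff_def
            by (rule weak_form_real[OF ess_bounded_compose[OF elim(2) kS_cont] elim(1)])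
        qed
      qed
    qed
    have "T.approximates M (F (Suc i)) L.sol (\<lambda>\<omega>. prev um1 (\<lambda>l. u l \<omega>) (Suc i))"
      using L.layer_approximates by (simp add: prev_def)
    moreover have "AE \<omega> in M. \<forall>n. prev um1 (\<lambda>l. uN n l \<omega>) (Suc i) = T.field L.sol n \<omega>"
      using uN_trig[OF i] L.g_eq_sol
    proof eventually_elim
      case (elim \<omega>)
      show ?case
      proof
        fix n
        have "T.trig n (T.coeff (uN n i \<omega>)) = T.field L.sol n \<omega>"
          using elim(2) unfolding T.field_def g_def by (intro T.trig_cong) auto
        then show "prev um1 (\<lambda>l. uN n l \<omega>) (Suc i) = T.field L.sol n \<omega>"
          using elim(1)[rule_format, of n] unfolding prev_def by simp
      qed
    qed
    ultimately show ?case by blast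
  qed
  have "\<forall>i\<in>{..J}. \<exists>d. (\<forall>n. d n \<in> borel_measurable M) \<and> P.null_in_prob (\<lambda>n \<omega>. ennreal (d n \<omega>)) \<and>
      (AE \<omega> in M. \<forall>n. (\<integral>\<^sup>+ x\<in>cube. ennreal ((uN n i \<omega> x - u i \<omega> x)\<^sup>2) \<partial>lborel) = ennreal (d n \<omega>))"
  proof
    fix i assume "i \<in> {..J}"
    then have i: "i \<le> J" by simp
    obtain c where "T.approximates M (F (Suc i)) c (u i)" and cf: "AE \<omega> in M. \<forall>n. uN n i \<omega> = T.field c n \<omega>"
      using main[of "Suc i"] i by (auto simp: prev_def)
    then obtain d where d: "\<forall>n. d n \<in> borel_measurable M" "P.null_in_prob (\<lambda>n \<omega>. ennreal (d n \<omega>))"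
      and de: "AE \<omega> in M. \<forall>n. d n \<omega> = (\<integral>x. (T.field c n \<omega> x - u i \<omega> x)\<^sup>2 \<partial>torus)"
      unfolding T.approximates_def by blast
    have "AE \<omega> in M. \<forall>n. (\<integral>\<^sup>+ x\<in>cube. ennreal ((uN n i \<omega> x - u i \<omega> x)\<^sup>2) \<partial>lborel) = ennreal (d n \<omega>)"
      using cf de u_bdd[OF i]
    proof eventually_elim
      case (elim \<omega>)
      have "ess_bounded torus (\<lambda>x. T.field c n \<omega> x - u i \<omega> x)" for n
        by (intro ess_bounded_diff T.ess_bounded_field elim)
      from nn_integral_cube_sq[OF this] show ?case using elim by simp
    qed
    with d show "\<exists>d. (\<forall>n. d n \<in> borel_measurable M) \<and> P.null_in_prob (\<lambda>n \<omega>. ennreal (d n \<omega>)) \<and>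
      (AE \<omega> in M. \<forall>n. (\<integral>\<^sup>+ x\<in>cube. ennreal ((uN n i \<omega> x - u i \<omega> x)\<^sup>2) \<partial>lborel) = ennreal (d n \<omega>))"
      by blast
  qed
  from bchoice[OF this] obtain d where d: "\<And>i n. i \<le> J \<Longrightarrow> d i n \<in> borel_measurable M"
    "\<And>i. i \<le> J \<Longrightarrow> P.null_in_prob (\<lambda>n \<omega>. ennreal (d i n \<omega>))"
    and de: "\<And>i. i \<le> J \<Longrightarrow> AE \<omega> in M. \<forall>n. (\<integral>\<^sup>+ x\<in>cube. ennreal ((uN n i \<omega> x - u i \<omega> x)\<^sup>2) \<partial>lborel) = ennreal (d i n \<omega>)"
    by auto
  have "AE \<omega> in M. \<forall>i\<in>{..J}. \<forall>n. (\<integral>\<^sup>+ x\<in>cube. ennreal ((uN n i \<omega> x - u i \<omega> x)\<^sup>2) \<partial>lborel) = ennreal (d i n \<omega>)"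
    by (rule AE_finite_allI) (auto intro: de)
  then have "AE \<omega> in M. \<forall>n. L2dist_sq J (\<lambda>i. uN n i \<omega>) (\<lambda>i. u i \<omega>) = (\<Sum>i\<in>{..J}. ennreal (d i n \<omega>))"
    by eventually_elim (auto simp: L2dist_sq_def intro!: sum.cong)
  then show ?thesis
    using d by (intro P.null_in_prob_imp_tendsto_zero_in_prob[where X = "\<lambda>n \<omega>. \<Sum>i\<in>{..J}. ennreal (d i n \<omega>)"]
      P.null_in_prob_sum borel_measurable_sum) (auto intro: measurable_compose)
qed

end
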